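(* Let $\Omega\subset\mathbb{R}^3$ with subdomain $\Omega_C$ satisfy the geometry assumption, and let the material assumptions and the data assumption hold. Let $T\in\mathbb{R}_{\ge0}\cup\{\infty\}$, $\boldsymbol{v}\in L^2_{\rm loc}([0,T);\mathbb{R}^m)$ and $\boldsymbol{A}_0\in X_0(\operatorname{curl},\Omega,\Omega_C)$, and let $(\boldsymbol{A},\boldsymbol{i})$ be a solution of the coupled MQS system. Then for all $0\le t<T$, $$E(\boldsymbol{A}(t))\le E(\boldsymbol{A}_0)+\tfrac14\,\|R^{-1/2}\boldsymbol{v}\|^2_{L^2([0,t);\mathbb{R}^m)},$$ $$\|\nabla\times\boldsymbol{A}(t)\|_{L^2(\Omega;\mathbb{R}^3)}\le\sqrt{\tfrac{L_\nu}{m_\nu}}\,\|\nabla\times\boldsymbol{A}_0\|_{L^2(\Omega;\mathbb{R}^3)}+\tfrac{1}{\sqrt{2m_\nu}}\,\|R^{-1/2}\boldsymbol{v}\|_{L^2([0,t);\mathbb{R}^m)}.$$ In particular, if $\boldsymbol{v}\in L^2([0,T);\mathbb{R}^m)$, then $\nabla\times\boldsymbol{A}\in L^\infty([0,T);L^2(\Omega;\mathbb{R}^3))$ with $$\|\nabla\times\boldsymbol{A}\|_{L^\infty([0,T);L^2(\Omega;\mathbb{R}^3))}\le\sqrt{\tfrac{L_\nu}{m_\nu}}\,\|\nabla\times\boldsymbol{A}_0\|_{L^2(\Omega;\mathbb{R}^3)}+\tfrac{1}{\sqrt{2m_\nu}}\,\|R^{-1/2}\boldsymbol{v}\|_{L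^2([0,T);\mathbb{R}^m)}.$$
   Context: Geometry assumption: $\Omega\subset\mathbb{R}^3$ is a simply connected bounded Lipschitz domain, decomposed into two Lipschitz regular open subsets $\Omega_C,\Omega_I\subset\Omega$ with $\overline{\Omega}_C\subset\Omega$ and $\Omega_I=\Omega\setminus\overline{\Omega}_C$. $\Omega_C$ is connected, and $\Omega_I$ consists of finitely many connected internal subdomains $\Omega_{I,1},\dots,\Omega_{I,q}$ with single boundary components $\Gamma_1,\dots,\Gamma_q$, respectively, and an external subdomain $\Omega_{I,\rm ext}$ which has two boundary components $\Gamma_{\rm ext}=\overline{\Omega}_{I,\rm ext}\cap\overline{\Omega}_C$ and $\partial\Omega$. Material assumptions: (a) $\sigma=\sigma_C\mathbb{1}_{\Omega_C}$ with a constant $\sigma_C>0$; (b) $\nu:\Omega\times\mathbb{R}_{\ge0}\to\mathbb{R}_{\ge0}$ is measurable and there are $m_\nu,L_\nu>0$ such that for all $\xi\in\Omega$, $\zeta,\varsigma\ge0$: $(\nu(\xi,\zeta)\zeta-\nu(\xi,\varsigma)\varsigma)(\zeta-\varsigma)\ge m_\nu(\zeta-\varsigma)^2$ and $|\nu(\xi,\zeta)\zeta-\nu(\xi,\varsigma)\varsigma|\le L_\nu|\zeta-\varsigma|$; (c) $R\in\mathbb{R}^{m\times m}$ is symmetric positive definite. Spaces: $X(\Omega,\Omega_C)$ is the set of all functions in $L^2(\Omega;\mathbb{R}^3)$ that are $L^2$-orthogonal to $\nabla\psi$ for all $\psi\in H^1_0(\Omega)$ that are constant on each of $\Gamma_1,\dots,\Gamma_q,\Gamma_{\rm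 ext}$; it carries the $L^2$ inner product. $H_0(\operatorname{curl},\Omega)$ is the usual space of $L^2$ fields with weak curl in $L^2$ and vanishing tangential trace, and $X_0(\operatorname{curl},\Omega,\Omega_C)=H_0(\operatorname{curl},\Omega)\cap X(\Omega,\Omega_C)$ with the $H_0(\operatorname{curl},\Omega)$ inner product. Data assumption: $\boldsymbol{A}_0\in X(\Omega,\Omega_C)$, and the columns of $\chi:\Omega\to\mathbb{R}^{3\times m}$ belong to $X(\Omega,\Omega_C)$. Coupled MQS system and solutions: the system is $\frac{\partial}{\partial t}(\sigma\boldsymbol{A})+\nabla\times(\nu(\cdot,\|\nabla\times\boldsymbol{A}\|_2)\nabla\times\boldsymbol{A})=\chi\boldsymbol{i}$ in $\Omega\times(0,T)$, $\frac{\rm d}{{\rm d}t}\int_\Omega\chi^\top\boldsymbol{A}\,{\rm d}\xi+R\boldsymbol{i}=\boldsymbol{v}$ on $(0,T)$, $\boldsymbol{A}\times\boldsymbol{n}_o=0$ on $\partial\Omega\times(0,T)$, $\sigma\boldsymbol{A}(\cdot,0)=\sigma\boldsymbol{A}_0$, $\int_\Omega\chi^\top\boldsymbol{A}(\cdot,0)\,{\rm d}\xi=\int_\Omega\chi^\top\boldsymbol{A}_0\,{\rm d}\xi$. For finite $T>0$ and $\boldsymbol{v}\in L^2([0,T];\mathbb{R}^m)$, a (weak) solution on $[0,T]$ is a pair $(\boldsymbol{A},\boldsymbol{i})$ such that (1) $\sigma\boldsymbol{A}\in C([0,T];X(\Omega,\Omega_C))\cap H^1_{\rm loc}((0,T];X(\Omega,\Omega_C))$,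 $\sigma\boldsymbol{A}(0)=\sigma\boldsymbol{A}_0$; (2) $\int_\Omega\chi^\top\boldsymbol{A}\,{\rm d}\xi\in C([0,T];\mathbb{R}^m)\cap H^1_{\rm loc}((0,T];\mathbb{R}^m)$, with value $\int_\Omega\chi^\top\boldsymbol{A}_0\,{\rm d}\xi$ at $t=0$; (3) $\boldsymbol{A}\in L^2([0,T];X_0(\operatorname{curl},\Omega,\Omega_C))$ and $\boldsymbol{i}\in L^2_{\rm loc}((0,T];\mathbb{R}^m)$; (4) for all $\boldsymbol{F}\in X_0(\operatorname{curl},\Omega,\Omega_C)$ and almost all $t\in[0,T]$, $\frac{\rm d}{{\rm d}t}\int_\Omega\sigma\boldsymbol{A}(t)\cdot\boldsymbol{F}\,{\rm d}\xi+\int_\Omega\nu(\cdot,\|\nabla\times\boldsymbol{A}(t)\|_2)(\nabla\times\boldsymbol{A}(t))\cdot(\nabla\times\boldsymbol{F})\,{\rm d}\xi=\int_\Omega\chi\,\boldsymbol{i}(t)\cdot\boldsymbol{F}\,{\rm d}\xi$ and $\frac{\rm d}{{\rm d}t}\int_\Omega\chi^\top\boldsymbol{A}(t)\,{\rm d}\xi+R\,\boldsymbol{i}(t)=\boldsymbol{v}(t)$. A solution on a half-open interval $[0,T)$, $T\le\infty$, is a pair whose restriction to $[0,T']$ is a solution for every $0<T'<T$. Pointwise-in-time assertions about $\boldsymbol{A}(t)$ are understood for a suitable representative of $\boldsymbol{A}$ with respect to almost-everywhere equality in time. Magnetic energy: with $\vartheta(\xi,\varrho)=\int_0^{\sqrt{\varrho}}\nu(\xi,\zeta)\zeta\,{\rm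 d}\zeta$, define $E:X(\Omega,\Omega_C)\to\mathbb{R}\cup\{\infty\}$ by $E(\boldsymbol{A})=\int_\Omega\vartheta(\xi,\|\nabla\times\boldsymbol{A}(\xi)\|_2^2)\,{\rm d}\xi$ if $\boldsymbol{A}\in X_0(\operatorname{curl},\Omega,\Omega_C)$ and $E(\boldsymbol{A})=\infty$ otherwise. $R^{-1/2}$ is the inverse of the symmetric positive definite square root of $R$. *)

theory Defs
  imports "HOL-Analysis.Analysis"
begin

section \<open>Square-integrable functions\<close>

text \<open>Elements of \<open>L\<^sup>2\<close> are represented by functions; all notions below depend only on the
  almost-everywhere class. Integrals are Lebesgue integrals.\<close>

definition L2 :: "'a::euclidean_space set \<Rightarrow> ('a \<Rightarrow> 'b::euclidean_space) set" where
  "L2 S = {f. f \<in> borel_measurable (lebesgue_on S) \<and>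
              integrable (lebesgue_on S) (\<lambda>x. (norm (f x))\<^sup>2)}"

definition l2_norm :: "'a::euclidean_space set \<Rightarrow> ('a \<Rightarrow> 'b::euclidean_space) \<Rightarrow> real" where
  "l2_norm S f = sqrt (LINT x|lebesgue_on S. (norm (f x))\<^sup>2)"

definition l2_inner ::
    "'a::euclidean_space set \<Rightarrow> ('a \<Rightarrow> 'b::euclidean_space) \<Rightarrow> ('a \<Rightarrow> 'b) \<Rightarrow> real" where
  "l2_inner S f g = (LINT x|lebesgue_on S. f x \<bullet> g x)"


section \<open>Smooth functions and classical differential operators\<close>

primrec Ck :: "nat \<Rightarrow> ('a::euclidean_space \<Rightarrow> 'b::real_normed_vector) \<Rightarrow> bool" where
  "Ck 0 f = continuous_on UNIV f"
| "Ck (Suc k) f = ((\<forall>x. f differentiable (at x)) \<and>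
                   (\<forall>b\<in>Basis. Ck k (\<lambda>x. frechet_derivative f (at x) b)))"

definition smooth :: "('a::euclidean_space \<Rightarrow> 'b::real_normed_vector) \<Rightarrow> bool" where
  "smooth f \<longleftrightarrow> (\<forall>k. Ck k f)"

definition test_functions ::
    "'a::euclidean_space set \<Rightarrow> ('a \<Rightarrow> 'b::real_normed_vector) set" where
  "test_functions S = {\<phi>. smooth \<phi> \<and> compact (closure {x. \<phi> x \<noteq> 0}) \<and> closure {x. \<phi> x \<noteq> 0} \<subseteq> S}"

definition grad :: "(real^3 \<Rightarrow> real) \<Rightarrow> real^3 \<Rightarrow> real^3" where
  "grad \<phi> x = (\<chi> i. frechet_derivative \<phi> (at x) (axis i 1))"

definition curl :: "(real^3 \<Rightarrow> real^3) \<Rightarrow> real^3 \<Rightarrow> real^3" where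
  "curl \<Phi> x = (let D = (\<lambda>i. frechet_derivative \<Phi> (at x) (axis i 1)) in
     vector [D 2 $ 3 - D 3 $ 2, D 3 $ 1 - D 1 $ 3, D 1 $ 2 - D 2 $ 1])"


section \<open>Lipschitz sets and the geometry\<close>

text \<open>Near every boundary point the set is, after an orthogonal change of coordinates, the
  strict epigraph of a Lipschitz function.\<close>

definition lipschitz_regular :: "(real^3) set \<Rightarrow> bool" where
  "lipschitz_regular S \<longleftrightarrow> open S \<and>
     (\<forall>x\<in>frontier S. \<exists>U (Q :: real^3 \<Rightarrow> real^3) (g :: real^2 \<Rightarrow> real) L.
        open U \<and> x \<in> U \<and> orthogonal_transformation Q \<and> L-lipschitz_on UNIV g \<and>
        S \<inter> U = {y \<in> U. g (vector [Q y $ 1, Q y $ 2]) < Q y $ 3})"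

text \<open>The component \<open>E\<close> is the external subdomain; all other components are the internal
  ones. Since \<open>components\<close> consists of nonempty sets, the conducting domain is
  nonempty.\<close>

definition mqs_geometry :: "(real^3) set \<Rightarrow> (real^3) set \<Rightarrow> bool" where
  "mqs_geometry \<Omega> \<Omega>C \<longleftrightarrow>
     \<Omega> \<noteq> {} \<and> connected \<Omega> \<and> simply_connected \<Omega> \<and> bounded \<Omega> \<and> lipschitz_regular \<Omega> \<and>
     lipschitz_regular \<Omega>C \<and> connected \<Omega>C \<and> closure \<Omega>C \<subseteq> \<Omega> \<and>
     (let \<Omega>I = \<Omega> - closure \<Omega>C in
        lipschitz_regular \<Omega>I \<and> finite (components \<Omega>I) \<and>
        (\<exists>E\<in>components \<Omega>I.
           closure E \<inter> closure \<Omega>C \<noteq> frontier \<Omega> \<and>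
           components (frontier E) = {closure E \<inter> closure \<Omega>C, frontier \<Omega>} \<and>
           (\<forall>U\<in>components \<Omega>I - {E}. closure U \<subseteq> \<Omega> \<and> (\<exists>\<Gamma>. components (frontier U) = {\<Gamma>}))))"

text \<open>The surfaces \<open>\<Gamma>\<^sub>1, \<dots>, \<Gamma>\<^sub>q\<close> and \<open>\<Gamma>\<^sub>e\<^sub>x\<^sub>t\<close>.\<close>

definition interfaces :: "(real^3) set \<Rightarrow> (real^3) set \<Rightarrow> (real^3) set set" where
  "interfaces \<Omega> \<Omega>C = (\<Union>U\<in>components (\<Omega> - closure \<Omega>C). components (frontier U)) - {frontier \<Omega>}"


section \<open>Weak gradient, traces and the space \<open>X\<close>\<close>

definition is_weak_grad :: "(real^3) set \<Rightarrow> (real^3 \<Rightarrow> real) \<Rightarrow> (real^3 \<Rightarrow> real^3) \<Rightarrow> bool" where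
  "is_weak_grad \<Omega> \<psi> g \<longleftrightarrow> \<psi> \<in> L2 \<Omega> \<and> g \<in> L2 \<Omega> \<and>
     (\<forall>\<phi>\<in>test_functions \<Omega>. (LINT x|lebesgue_on \<Omega>. \<psi> x *\<^sub>R grad \<phi> x)
                           = - (LINT x|lebesgue_on \<Omega>. \<phi> x *\<^sub>R g x))"

text \<open>Unique up to null sets when it exists.\<close>

definition weak_grad :: "(real^3) set \<Rightarrow> (real^3 \<Rightarrow> real) \<Rightarrow> real^3 \<Rightarrow> real^3" where
  "weak_grad \<Omega> \<psi> = (SOME g. is_weak_grad \<Omega> \<psi> g)"

definition H1_approx ::
    "(real^3) set \<Rightarrow> (real^3 \<Rightarrow> real) \<Rightarrow> (nat \<Rightarrow> real^3 \<Rightarrow> real) \<Rightarrow> bool" where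
  "H1_approx \<Omega> \<psi> \<phi> \<longleftrightarrow> (\<forall>n. \<phi> n \<in> test_functions \<Omega>) \<and>
     (\<lambda>n. l2_norm \<Omega> (\<lambda>x. \<phi> n x - \<psi> x)) \<longlonglongrightarrow> 0 \<and>
     (\<lambda>n. l2_norm \<Omega> (\<lambda>x. grad (\<phi> n) x - weak_grad \<Omega> \<psi> x)) \<longlonglongrightarrow> 0"

definition H10 :: "(real^3) set \<Rightarrow> (real^3 \<Rightarrow> real) set" where
  "H10 \<Omega> = {\<psi>. (\<exists>g. is_weak_grad \<Omega> \<psi> g) \<and> (\<exists>\<phi>. H1_approx \<Omega> \<psi> \<phi>)}"

text \<open>Two-dimensional Hausdorff measure, normalised to agree with surface area. It is a metric
  outer measure, hence countably additive on Borel sets.\<close>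

definition hausdorff2 :: "(real^3) set \<Rightarrow> ennreal" where
  "hausdorff2 S = (SUP \<delta>\<in>{0::real<..}.
     INF C\<in>{C :: nat \<Rightarrow> (real^3) set. S \<subseteq> (\<Union>n. C n) \<and> (\<forall>n. bounded (C n) \<and> diameter (C n) \<le> \<delta>)}.
       (\<Sum>n. ennreal (pi / 4 * (diameter (C n))\<^sup>2)))"

definition surface_measure :: "(real^3) measure" where
  "surface_measure = measure_of UNIV (sets borel) hausdorff2"

text \<open>The trace on a surface \<open>\<Gamma>\<close> inside \<open>\<Omega>\<close> is the continuous extension of the restriction map
  \<open>\<phi> \<mapsto> \<phi>|\<Gamma>\<close> from test functions to \<open>H\<^sup>1\<close>, with values in \<open>L\<^sup>2(\<Gamma>)\<close>.\<close>

definition has_trace ::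
    "(real^3) set \<Rightarrow> (real^3 \<Rightarrow> real) \<Rightarrow> (real^3) set \<Rightarrow> (real^3 \<Rightarrow> real) \<Rightarrow> bool" where
  "has_trace \<Omega> \<psi> \<Gamma> h \<longleftrightarrow> (\<exists>\<phi>. H1_approx \<Omega> \<psi> \<phi> \<and>
     (\<lambda>n. \<integral>\<^sup>+x\<in>\<Gamma>. ennreal ((\<phi> n x - h x)\<^sup>2) \<partial>surface_measure) \<longlonglongrightarrow> 0)"

definition XS :: "(real^3) set \<Rightarrow> (real^3) set \<Rightarrow> (real^3 \<Rightarrow> real^3) set" where
  "XS \<Omega> \<Omega>C = {F \<in> L2 \<Omega>. \<forall>\<psi>\<in>H10 \<Omega>.
     (\<forall>\<Gamma>\<in>interfaces \<Omega> \<Omega>C. \<exists>c. has_trace \<Omega> \<psi> \<Gamma> (\<lambda>_. c)) \<longrightarrow> l2_inner \<Omega> F (weak_grad \<Omega> \<psi>) = 0}"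


section \<open>Weak curl\<close>

definition is_weak_curl ::
    "(real^3) set \<Rightarrow> (real^3 \<Rightarrow> real^3) \<Rightarrow> (real^3 \<Rightarrow> real^3) \<Rightarrow> bool" where
  "is_weak_curl \<Omega> F G \<longleftrightarrow> F \<in> L2 \<Omega> \<and> G \<in> L2 \<Omega> \<and>
     (\<forall>\<Phi>\<in>test_functions \<Omega>. l2_inner \<Omega> F (curl \<Phi>) = l2_inner \<Omega> G \<Phi>)"

text \<open>Unique up to null sets when it exists.\<close>

definition weak_curl :: "(real^3) set \<Rightarrow> (real^3 \<Rightarrow> real^3) \<Rightarrow> real^3 \<Rightarrow> real^3" where
  "weak_curl \<Omega> F = (SOME G. is_weak_curl \<Omega> F G)"

definition Hcurl :: "(real^3) set \<Rightarrow> (real^3 \<Rightarrow> real^3) set" where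
  "Hcurl \<Omega> = {F. \<exists>G. is_weak_curl \<Omega> F G}"

text \<open>The tangential trace is the functional \<open>\<Phi> \<mapsto> \<integral> F \<bullet> curl \<Phi> - curl F \<bullet> \<Phi>\<close> given by Green's
  formula, an element of the dual of the boundary traces of \<open>H\<^sup>1(\<Omega>; \<real>\<^sup>3)\<close>. It is tested with the
  restrictions of smooth fields on the whole space, which are dense in \<open>H\<^sup>1\<close> on a bounded
  Lipschitz domain.\<close>

definition H0curl :: "(real^3) set \<Rightarrow> (real^3 \<Rightarrow> real^3) set" where
  "H0curl \<Omega> = {F \<in> Hcurl \<Omega>.
     \<forall>\<Phi>. smooth \<Phi> \<longrightarrow> l2_inner \<Omega> F (curl \<Phi>) - l2_inner \<Omega> (weak_curl \<Omega> F) \<Phi> = 0}"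

definition hcurl_norm :: "(real^3) set \<Rightarrow> (real^3 \<Rightarrow> real^3) \<Rightarrow> real" where
  "hcurl_norm \<Omega> F = sqrt ((l2_norm \<Omega> F)\<^sup>2 + (l2_norm \<Omega> (weak_curl \<Omega> F))\<^sup>2)"

definition X0curl :: "(real^3) set \<Rightarrow> (real^3) set \<Rightarrow> (real^3 \<Rightarrow> real^3) set" where
  "X0curl \<Omega> \<Omega>C = H0curl \<Omega> \<inter> XS \<Omega> \<Omega>C"


section \<open>Functions of time with values in a space of fields\<close>

text \<open>In this section \<open>V\<close> is a linear space of vector fields with (semi)norm \<open>N\<close>, and \<open>J\<close> is a
  time interval.\<close>

definition bochner_measurable ::
    "real set \<Rightarrow> ('a \<Rightarrow> 'b::real_normed_vector) set \<Rightarrow> (('a \<Rightarrow> 'b) \<Rightarrow> real) \<Rightarrow> (real \<Rightarrow> 'a \<Rightarrow> 'b) \<Rightarrow> bool"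
  where "bochner_measurable J V N f \<longleftrightarrow> (AE t in lebesgue_on J. f t \<in> V) \<and>
     (\<exists>s :: nat \<Rightarrow> real \<Rightarrow> 'a \<Rightarrow> 'b.
        (\<forall>n. simple_function (lebesgue_on J) (s n) \<and> s n ` J \<subseteq> V) \<and>
        (AE t in lebesgue_on J. (\<lambda>n. N (\<lambda>x. s n t x - f t x)) \<longlonglongrightarrow> 0))"

definition bochner_L2 ::
    "real set \<Rightarrow> ('a \<Rightarrow> 'b::real_normed_vector) set \<Rightarrow> (('a \<Rightarrow> 'b) \<Rightarrow> real) \<Rightarrow> (real \<Rightarrow> 'a \<Rightarrow> 'b) set"
  where "bochner_L2 J V N =
     {f. bochner_measurable J V N f \<and> integrable (lebesgue_on J) (\<lambda>t. (N (f t))\<^sup>2)}"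

definition bochner_Linf ::
    "real set \<Rightarrow> ('a \<Rightarrow> 'b::real_normed_vector) set \<Rightarrow> (('a \<Rightarrow> 'b) \<Rightarrow> real) \<Rightarrow> (real \<Rightarrow> 'a \<Rightarrow> 'b) set"
  where "bochner_Linf J V N =
     {f. bochner_measurable J V N f \<and> (\<exists>C. AE t in lebesgue_on J. N (f t) \<le> C)}"

definition bochner_Linf_norm ::
    "real set \<Rightarrow> (('a \<Rightarrow> 'b::real_normed_vector) \<Rightarrow> real) \<Rightarrow> (real \<Rightarrow> 'a \<Rightarrow> 'b) \<Rightarrow> real"
  where "bochner_Linf_norm J N f = Inf {C. 0 \<le> C \<and> (AE t in lebesgue_on J. N (f t) \<le> C)}"

definition bochner_C ::
    "real set \<Rightarrow> ('a \<Rightarrow> 'b::real_normed_vector) set \<Rightarrow> (('a \<Rightarrow> 'b) \<Rightarrow> real) \<Rightarrow> (real \<Rightarrow> 'a \<Rightarrow> 'b) set"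
  where "bochner_C J V N =
     {f. \<forall>t\<in>J. f t \<in> V \<and> ((\<lambda>s. N (\<lambda>x. f s x - f t x)) \<longlongrightarrow> 0) (at t within J)}"

definition weak_deriv_on ::
    "real \<Rightarrow> real \<Rightarrow> (real \<Rightarrow> 'b::euclidean_space) \<Rightarrow> (real \<Rightarrow> 'b) \<Rightarrow> bool" where
  "weak_deriv_on a b f g \<longleftrightarrow> (\<forall>\<phi>\<in>test_functions {a<..<b}.
     (LINT t|lebesgue_on {a<..<b}. deriv \<phi> t *\<^sub>R f t) = - (LINT t|lebesgue_on {a<..<b}. \<phi> t *\<^sub>R g t))"

text \<open>\<open>f \<in> H\<^sup>1\<^sub>l\<^sub>o\<^sub>c((0,T]; \<real>\<^sup>m)\<close> with weak derivative \<open>f'\<close>.\<close>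

definition H1loc_deriv ::
    "real \<Rightarrow> (real \<Rightarrow> 'b::euclidean_space) \<Rightarrow> (real \<Rightarrow> 'b) \<Rightarrow> bool" where
  "H1loc_deriv T f f' \<longleftrightarrow> (\<forall>\<epsilon>\<in>{0<..<T}. f \<in> L2 {\<epsilon>..T} \<and> f' \<in> L2 {\<epsilon>..T}) \<and> weak_deriv_on 0 T f f'"

text \<open>\<open>w \<in> H\<^sup>1\<^sub>l\<^sub>o\<^sub>c((0,T]; V)\<close> with weak derivative \<open>w'\<close>, for a closed subspace \<open>V\<close> of
  \<open>L\<^sup>2(\<Omega>; \<real>\<^sup>3)\<close>. The identity \<open>\<integral> \<phi>' w = - \<integral> \<phi> w'\<close> between Bochner integrals in \<open>V\<close> is
  written by taking inner products with all elements of \<open>V\<close>; the inner product commutes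
  with the integral.\<close>

definition bochner_H1loc_deriv ::
    "real \<Rightarrow> (real^3) set \<Rightarrow> (real^3 \<Rightarrow> real^3) set \<Rightarrow>
     (real \<Rightarrow> real^3 \<Rightarrow> real^3) \<Rightarrow> (real \<Rightarrow> real^3 \<Rightarrow> real^3) \<Rightarrow> bool" where
  "bochner_H1loc_deriv T \<Omega> V w w' \<longleftrightarrow>
     (\<forall>\<epsilon>\<in>{0<..<T}. w \<in> bochner_L2 {\<epsilon>..T} V (l2_norm \<Omega>) \<and> w' \<in> bochner_L2 {\<epsilon>..T} V (l2_norm \<Omega>)) \<and>
     (\<forall>F\<in>V. weak_deriv_on 0 T (\<lambda>t. l2_inner \<Omega> (w t) F) (\<lambda>t. l2_inner \<Omega> (w' t) F))"


section \<open>Material laws\<close>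

definition conductivity :: "real \<Rightarrow> (real^3) set \<Rightarrow> real^3 \<Rightarrow> real" where
  "conductivity \<sigma>C \<Omega>C \<xi> = \<sigma>C * indicator \<Omega>C \<xi>"

definition reluctivity :: "(real^3) set \<Rightarrow> (real^3 \<Rightarrow> real \<Rightarrow> real) \<Rightarrow> real \<Rightarrow> real \<Rightarrow> bool" where
  "reluctivity \<Omega> \<nu> m\<nu> L\<nu> \<longleftrightarrow>
     (\<lambda>(\<xi>, \<zeta>). \<nu> \<xi> \<zeta>) \<in> borel_measurable (lebesgue_on (\<Omega> \<times> {0..})) \<and>
     (\<forall>\<xi>\<in>\<Omega>. \<forall>\<zeta>\<ge>0. 0 \<le> \<nu> \<xi> \<zeta>) \<and> 0 < m\<nu> \<and> 0 < L\<nu> \<and>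
     (\<forall>\<xi>\<in>\<Omega>. \<forall>\<zeta>\<ge>0. \<forall>\<eta>\<ge>0.
        (\<nu> \<xi> \<zeta> * \<zeta> - \<nu> \<xi> \<eta> * \<eta>) * (\<zeta> - \<eta>) \<ge> m\<nu> * (\<zeta> - \<eta>)\<^sup>2 \<and>
        \<bar>\<nu> \<xi> \<zeta> * \<zeta> - \<nu> \<xi> \<eta> * \<eta>\<bar> \<le> L\<nu> * \<bar>\<zeta> - \<eta>\<bar>)"

definition spd :: "real^'m^'m \<Rightarrow> bool" where
  "spd R \<longleftrightarrow> transpose R = R \<and> (\<forall>x. x \<noteq> 0 \<longrightarrow> 0 < x \<bullet> (R *v x))"

definition inv_sqrt :: "real^'m^'m \<Rightarrow> real^'m^'m" where
  "inv_sqrt R = matrix_inv (THE S. spd S \<and> S ** S = R)"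


section \<open>Weak solutions and the magnetic energy\<close>

text \<open>\<open>\<integral>\<^sub>\<Omega> \<chi>\<^sup>\<top> F d\<xi>\<close>; a value of \<open>\<chi>\<close> is a matrix with 3 rows and \<open>m\<close> columns.\<close>

definition flux :: "(real^3) set \<Rightarrow> (real^3 \<Rightarrow> real^'m^3) \<Rightarrow> (real^3 \<Rightarrow> real^3) \<Rightarrow> real^'m" where
  "flux \<Omega> chi F = (LINT \<xi>|lebesgue_on \<Omega>. transpose (chi \<xi>) *v F \<xi>)"

text \<open>Solutions on the compact interval \<open>[0,T]\<close>. As \<open>A\<close> is only determined up to null sets in
  time, \<open>w\<close> and \<open>y\<close> are the continuous representatives of \<open>\<sigma>A\<close> and \<open>\<integral>\<^sub>\<Omega> \<chi>\<^sup>\<top> A d\<xi>\<close>, and \<open>w'\<close>, \<open>y'\<close>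
  are their weak time derivatives; in particular \<open>l2_inner \<Omega> (w' t) F\<close> is the weak derivative
  of \<open>\<integral>\<^sub>\<Omega> \<sigma>A(t) \<bullet> F d\<xi>\<close>.\<close>

definition mqs_solution_cpt ::
    "(real^3) set \<Rightarrow> (real^3) set \<Rightarrow> real \<Rightarrow> (real^3 \<Rightarrow> real \<Rightarrow> real) \<Rightarrow> real^'m^'m \<Rightarrow>
     (real^3 \<Rightarrow> real^'m^3) \<Rightarrow> (real^3 \<Rightarrow> real^3) \<Rightarrow> (real \<Rightarrow> real^'m) \<Rightarrow> real \<Rightarrow>
     (real \<Rightarrow> real^3 \<Rightarrow> real^3) \<Rightarrow> (real \<Rightarrow> real^'m) \<Rightarrow> bool" where
  "mqs_solution_cpt \<Omega> \<Omega>C \<sigma>C \<nu> R chi A0 v T A i \<longleftrightarrow>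
     (\<exists>w w' y y'.
        (AE t in lebesgue_on {0..T}. AE \<xi> in lebesgue_on \<Omega>. w t \<xi> = conductivity \<sigma>C \<Omega>C \<xi> *\<^sub>R A t \<xi>) \<and>
        w \<in> bochner_C {0..T} (XS \<Omega> \<Omega>C) (l2_norm \<Omega>) \<and>
        bochner_H1loc_deriv T \<Omega> (XS \<Omega> \<Omega>C) w w' \<and>
        (AE \<xi> in lebesgue_on \<Omega>. w 0 \<xi> = conductivity \<sigma>C \<Omega>C \<xi> *\<^sub>R A0 \<xi>) \<and>
        (AE t in lebesgue_on {0..T}. y t = flux \<Omega> chi (A t)) \<and>
        continuous_on {0..T} y \<and>
        H1loc_deriv T y y' \<and>
        y 0 = flux \<Omega> chi A0 \<and>
        A \<in> bochner_L2 {0..T} (X0curl \<Omega> \<Omega>C) (hcurl_norm \<Omega>) \<and>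
        (\<forall>\<epsilon>\<in>{0<..<T}. i \<in> L2 {\<epsilon>..T}) \<and>
        (\<forall>F\<in>X0curl \<Omega> \<Omega>C. AE t in lebesgue_on {0..T}.
           l2_inner \<Omega> (w' t) F
             + (LINT \<xi>|lebesgue_on \<Omega>.
                  \<nu> \<xi> (norm (weak_curl \<Omega> (A t) \<xi>)) *\<^sub>R weak_curl \<Omega> (A t) \<xi> \<bullet> weak_curl \<Omega> F \<xi>)
           = (LINT \<xi>|lebesgue_on \<Omega>. (chi \<xi> *v i t) \<bullet> F \<xi>)) \<and>
        (AE t in lebesgue_on {0..T}. y' t + R *v i t = v t))"

text \<open>The half-open interval \<open>[0,T)\<close> for \<open>T \<le> \<infinity>\<close>.\<close>

definition time_interval :: "ereal \<Rightarrow> real set" where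
  "time_interval T = {t. 0 \<le> t \<and> ereal t < T}"

definition L2loc :: "ereal \<Rightarrow> (real \<Rightarrow> 'b::euclidean_space) set" where
  "L2loc T = {v. \<forall>T'\<in>time_interval T. v \<in> L2 {0..T'}}"

definition mqs_solution ::
    "(real^3) set \<Rightarrow> (real^3) set \<Rightarrow> real \<Rightarrow> (real^3 \<Rightarrow> real \<Rightarrow> real) \<Rightarrow> real^'m^'m \<Rightarrow>
     (real^3 \<Rightarrow> real^'m^3) \<Rightarrow> (real^3 \<Rightarrow> real^3) \<Rightarrow> (real \<Rightarrow> real^'m) \<Rightarrow> ereal \<Rightarrow>
     (real \<Rightarrow> real^3 \<Rightarrow> real^3) \<Rightarrow> (real \<Rightarrow> real^'m) \<Rightarrow> bool" where
  "mqs_solution \<Omega> \<Omega>C \<sigma>C \<nu> R chi A0 v T A i \<longleftrightarrow>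
     (\<forall>T'. 0 < T' \<and> ereal T' < T \<longrightarrow> mqs_solution_cpt \<Omega> \<Omega>C \<sigma>C \<nu> R chi A0 v T' A i)"

definition energy_density :: "(real^3 \<Rightarrow> real \<Rightarrow> real) \<Rightarrow> real^3 \<Rightarrow> real \<Rightarrow> real" where
  "energy_density \<nu> \<xi> \<rho> = integral {0..sqrt \<rho>} (\<lambda>\<zeta>. \<nu> \<xi> \<zeta> * \<zeta>)"

definition energy ::
    "(real^3) set \<Rightarrow> (real^3) set \<Rightarrow> (real^3 \<Rightarrow> real \<Rightarrow> real) \<Rightarrow> (real^3 \<Rightarrow> real^3) \<Rightarrow> ereal" where
  "energy \<Omega> \<Omega>C \<nu> A =
     (if A \<in> X0curl \<Omega> \<Omega>C
      then ereal (LINT \<xi>|lebesgue_on \<Omega>. energy_density \<nu> \<xi> ((norm (weak_curl \<Omega> A \<xi>))\<^sup>2))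
      else \<infinity>)"

end

theory Submission
  imports Defs
begin

text \<open>The formulation only fixes \<open>A\<close> up to null sets in time, so it suffices to bound the energy
  for almost every \<open>t\<close>; at the remaining times \<open>A'\<close> is set to \<open>A0\<close>.

  With \<open>w = \<sigma>A\<close>, \<open>y = \<integral> \<chi>\<^sup>\<top> A\<close> and \<open>i = R\<inverse>(v - y')\<close>, convexity of the energy density and the weak
  formulation tested with \<open>A(r)\<close> give, for all \<open>s, r\<close> outside a common null set,
  \<open>E(s) - E(r) \<le> i(s) \<bullet> (y(s) - y(r)) - \<langle>w'(s), w(s) - w(r)\<rangle> / \<sigma>\<close>,
  and the same inequality with \<open>r\<close> replaced by the initial value. At almost every \<open>s\<close> the
  functions \<open>y\<close> and \<open>w\<close> are differentiable from the left, so the Dini derivative of \<open>E\<close> is at most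
  \<open>i \<bullet> y' - \<parallel>w'\<parallel>\<^sup>2 / \<sigma> \<le> i \<bullet> (v - R i) \<le> \<parallel>R\<^sup>-\<^sup>1\<^sup>/\<^sup>2 v\<parallel>\<^sup>2 / 4\<close>. As the difference quotients are dominated
  by an average of an integrable function, Fatou's lemma integrates this bound on compact
  subintervals of \<open>(0,T]\<close>. To reach \<open>t = 0\<close>, where \<open>w'\<close> and \<open>y'\<close> need not be square-integrable, the
  inequality with the initial value is integrated: it shows that the distance of \<open>(w,y)\<close> to its
  initial value is \<open>O(\<surd>t)\<close>, and hence that the average of \<open>E\<close> over \<open>(0,h)\<close> is at most
  \<open>E(A0) + o(1)\<close>.\<close>

section \<open>Differentiation and integration of increments\<close>

text \<open>A solution gives no time derivative of \<open>A\<close>: only \<sigma>A and the flux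
  have one, locally in (0,T]. Convexity replaces the chain rule: the subgradient inequality at the
  later time s involves w'(s) and i(s) but no derivative at r, which is why only left difference
  quotients are controlled. All inequalities hold for almost every pair of times, so the integration
  has to work with an energy that is merely integrable; its increments are recovered at Lebesgue
  points. Two further obstacles: the null set in the weak formulation depends on the test field,
  whereas A(r) must be inserted for uncountably many r; essential separability of the range of
  \<open>A\<close> leaves a countable family. And the inequality carries 1 / \<sigma> although the
  conductivity vanishes off \<Omega>C; there w' vanishes too, being a limit of difference quotients
  of w. The constant 1/4 comes from completing the square in i \<bullet> (v - R i), whose maximum
  over i is attained at R\<inverse> v / 2.\<close>

lemma lebesgue_left_differentiation:
  fixes f :: "real \<Rightarrow> 'b::euclidean_space"
  assumes f: "integrable (lebesgue_on {a..b}) f"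
  obtains N where "negligible N"
    "\<And>x. x \<in> {a<..b} - N \<Longrightarrow> ((\<lambda>h. integral {x-h..x} f /\<^sub>R h) \<longlongrightarrow> f x) (at_right 0)"
proof -
  define g where "g x = (if x \<in> {a..b} then f x else 0)" for x
  have gU: "g integrable_on UNIV"
    using integrable_on_lebesgue_on[OF f] unfolding g_def[abs_def] by (subst integrable_restrict_UNIV) auto
  then have gab: "g integrable_on cbox c d" for c d
    by (rule integrable_on_subcbox) simp
  \<comment> \<open>The differentiation theorem applied below averages over [x, x + h]; reflecting
    at the origin turns these averages into averages over [x - h, x].\<close>
  define k where "k x = g (- x)" for x
  have "k integrable_on cbox c d" for c d
    using gab[of "-d" "-c"] integrable_reflect[of g "-c" "-d"] by (simp add: k_def[abs_def])
  then obtain M where M: "negligible M" and D: "\<And>x e. \<lbrakk>x \<notin> M; 0 < e\<rbrakk> \<Longrightarrow>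
               \<exists>d>0. \<forall>h. 0 < h \<and> h < d \<longrightarrow>
                         norm(integral (cbox x (x + h *\<^sub>R One)) k /\<^sub>R h ^ DIM(real) - k x) < e"
    using integrable_ccontinuous_explicit by blast
  have "negligible (uminus ` M)"
    by (rule negligible_differentiable_image_negligible[OF order_refl M]) (rule linear_imp_differentiable_on, simp add: linear_iff)
  moreover have "((\<lambda>h. integral {x-h..x} f /\<^sub>R h) \<longlongrightarrow> f x) (at_right 0)"
    if x: "x \<in> {a<..b} - uminus ` M" for x
  proof (rule tendstoI)
    fix e :: real assume e: "0 < e"
    have "- x \<notin> M" using x by (metis DiffD2 add.inverse_inverse imageI)
    then obtain d where d: "0 < d" "\<And>h. 0 < h \<Longrightarrow> h < d \<Longrightarrow> norm (integral {-x..-x+h} k /\<^sub>R h - k (-x)) < e"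
      using D[OF \<open>- x \<notin> M\<close> e] by (auto simp del: integral_reflect)
    have "norm (integral {x-h..x} f /\<^sub>R h - f x) < e" if h: "0 < h" "h < min d (x - a)" for h
    proof -
      have "integral {-x..-x+h} k = integral {x-h..x} g"
        using Henstock_Kurzweil_Integration.integral_reflect_real[of x "x-h" g] by (simp add: k_def[abs_def])
      also have "\<dots> = integral {x-h..x} f"
        by (rule integral_cong) (use x h in \<open>auto simp: g_def\<close>)
      finally show ?thesis using d(2)[of h] h x by (simp add: k_def g_def)
    qed
    then show "\<forall>\<^sub>F h in at_right 0. dist (integral {x-h..x} f /\<^sub>R h) (f x) < e"
      unfolding eventually_at_right_field dist_norm using d(1) x by (intro exI[of _ "min d (x-a)"]) auto
  qed
  ultimately show ?thesis using that by blast
qed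

text \<open>\<open>g\<close> may change sign: Fatou's lemma for the nonnegative \<open>q n\<close>
  bounds the integral of its positive part, and the negative part only lowers the integral of
  \<open>g\<close>. The pointwise hypothesis has a margin e because that is the form in which a Dini
  derivative bound arrives.\<close>

lemma integral_le_lim_Fatou:
  fixes q :: "nat \<Rightarrow> 'a \<Rightarrow> real"
  assumes q: "\<And>n. integrable M (q n)" and nn: "\<And>n. AE x in M. 0 \<le> q n x"
    and g: "integrable M g"
    and lim: "AE x in M. \<forall>e>0. \<forall>\<^sub>F n in sequentially. g x - e \<le> q n x"
    and L: "(\<lambda>n. integral\<^sup>L M (q n)) \<longlonglongrightarrow> L"
  shows "integral\<^sup>L M g \<le> L"
proof -
  have [measurable]: "q n \<in> borel_measurable M" for n using q by auto
  have "AE x in M. ennreal (g x) \<le> liminf (\<lambda>n. ennreal (q n x))"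
    using lim
  proof eventually_elim
    case (elim x)
    show ?case
    proof (rule ennreal_le_epsilon)
      fix e :: real assume e: "0 < e"
      have "ennreal (g x) \<le> ennreal (g x - e) + ennreal e"
      proof (cases "e \<le> g x")
        case True
        then show ?thesis using e by (simp add: ennreal_plus[symmetric])
      next
        case False
        then show ?thesis using e by (simp add: ennreal_neg ennreal_leI)
      qed
      moreover have "ennreal (g x - e) \<le> liminf (\<lambda>n. ennreal (q n x))"
        using elim e by (intro Liminf_bounded) (auto elim!: eventually_mono intro: ennreal_leI)
      ultimately show "ennreal (g x) \<le> liminf (\<lambda>n. ennreal (q n x)) + ennreal e"
        by (meson add_right_mono order_trans)
    qed
  qed
  then have "(\<integral>\<^sup>+x. ennreal (g x) \<partial>M) \<le> (\<integral>\<^sup>+x. liminf (\<lambda>n. ennreal (q n x)) \<partial>M)"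
    by (rule nn_integral_mono_AE)
  also have "\<dots> \<le> liminf (\<lambda>n. \<integral>\<^sup>+x. ennreal (q n x) \<partial>M)"
    by (rule nn_integral_liminf) simp
  also have "\<dots> = liminf (\<lambda>n. ennreal (integral\<^sup>L M (q n)))"
    using q nn by (simp add: nn_integral_eq_integral)
  also have "\<dots> = ennreal L"
    using L by (intro lim_imp_Liminf tendsto_ennrealI) simp_all
  finally have le: "(\<integral>\<^sup>+x. ennreal (g x) \<partial>M) \<le> ennreal L" .
  have L0: "0 \<le> L" using L by (rule LIMSEQ_le_const) (use nn in \<open>auto intro: integral_nonneg_AE\<close>)
  have "integral\<^sup>L M g = enn2real (\<integral>\<^sup>+x. ennreal (g x) \<partial>M) - enn2real (\<integral>\<^sup>+x. ennreal (- g x) \<partial>M)"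
    using g by (rule real_lebesgue_integral_def)
  also have "\<dots> \<le> enn2real (\<integral>\<^sup>+x. ennreal (g x) \<partial>M)" by simp
  also have "\<dots> \<le> L" using enn2real_mono[OF le] L0 by simp
  finally show ?thesis .
qed

lemma AE_lebesgue_on_Diff_negligible:
  assumes "negligible N" "S \<in> sets lebesgue" "\<And>x. x \<in> S - N \<Longrightarrow> P x"
  shows "AE x in lebesgue_on S. P x"
proof -
  have "N \<in> null_sets lebesgue" using assms(1) by (simp add: negligible_iff_null_sets)
  then have "AE x in lebesgue. x \<notin> N" by (rule AE_not_in)
  then have "AE x in lebesgue. x \<in> S \<longrightarrow> P x" by eventually_elim (use assms(3) in auto)
  then show ?thesis using assms(2) by (simp add: AE_restrict_space_iff)
qed

lemma AE_lebesgue_on_negligible: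
  assumes "AE x in lebesgue_on S. P x" "S \<in> sets lebesgue"
  obtains N where "negligible N" "\<And>x. x \<in> S - N \<Longrightarrow> P x"
proof -
  have "AE x in lebesgue. x \<in> S \<longrightarrow> P x"
    using assms by (simp add: AE_restrict_space_iff)
  then obtain N where "N \<in> null_sets lebesgue" "{x. \<not> (x \<in> S \<longrightarrow> P x)} \<subseteq> N"
    unfolding eventually_ae_filter by auto
  then show ?thesis using that[of N] by (auto simp: negligible_iff_null_sets)
qed

text \<open>Each lower endpoint \<epsilon> comes with its own exceptional set. The countable choice
  \<epsilon> = T / (k + 2) suffices: these numbers lie in (0,T) and tend to 0, so the union contains
  the set belonging to some \<epsilon> below any given t.\<close>

lemma negligible_exhaustion:
  fixes T :: real
  assumes ex: "\<forall>\<epsilon>\<in>{0<..<T}. \<exists>M. negligible M \<and> Pr \<epsilon> M"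
  shows "\<exists>N. negligible N \<and> (\<forall>t\<in>{0<..<T}. \<exists>\<epsilon> M. \<epsilon> \<in> {0<..<t} \<and> M \<subseteq> N \<and> Pr \<epsilon> M)"
proof (cases "0 < T")
  case T: True
  define \<epsilon> where "\<epsilon> k = T / real (k + 2)" for k
  have \<epsilon>: "\<epsilon> k \<in> {0<..<T}" for k
  proof -
    have "T * 1 < T * real (k + 2)" using T by (intro mult_strict_left_mono) auto
    then show ?thesis using T by (simp add: \<epsilon>_def divide_less_eq add.commute)
  qed
  obtain M where M: "\<And>k. negligible (M k) \<and> Pr (\<epsilon> k) (M k)"
    using choice[of "\<lambda>k M. negligible M \<and> Pr (\<epsilon> k) M"] ex \<epsilon> by blast
  show ?thesis
  proof (intro exI[of _ "\<Union>k. M k"] conjI ballI)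
    show "negligible (\<Union>k. M k)" using M by (intro negligible_countable_Union) auto
    fix t assume t: "t \<in> {0<..<T}"
    have "\<epsilon> \<longlonglongrightarrow> 0" unfolding \<epsilon>_def by (rule LIMSEQ_ignore_initial_segment[OF lim_const_over_n])
    then have "\<forall>\<^sub>F k in sequentially. \<epsilon> k < t" using t by (intro order_tendstoD) auto
    then obtain k where "\<epsilon> k < t" by (auto simp: eventually_sequentially)
    then show "\<exists>\<epsilon> N. \<epsilon> \<in> {0<..<t} \<and> N \<subseteq> (\<Union>k. M k) \<and> Pr \<epsilon> N"
      using M[of k] \<epsilon>[of k] by (intro exI[of _ "\<epsilon> k"] exI[of _ "M k"]) auto
  qed
qed (auto intro: exI[of _ "{}"])

lemma integrable_lebesgue_on_subset:
  assumes "integrable (lebesgue_on S) f" "T \<in> sets lebesgue" "S \<in> sets lebesgue" "T \<subseteq> S"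
  shows "integrable (lebesgue_on T) (f :: _ \<Rightarrow> 'b::euclidean_space)"
  using assms set_integrable_subset[of lebesgue S f T] by (simp add: integrable_restrict_space set_integrable_def)

text \<open>\<open>X\<close> is only integrable, so its increment is reached through averages. The
  integral over [\<delta>, \<tau>] of the backward difference quotient with step h telescopes to the
  mean of \<open>X\<close> over [\<tau> - h, \<tau>] minus the mean over [\<delta> - h, \<delta>],
  which tends to X \<tau> - X \<delta> at left Lebesgue points; \<open>N'\<close> collects the other
  points. Adding \<open>K\<close> makes the quotients nonnegative, so that
  \<open>integral_le_lim_Fatou\<close> applies.\<close>

lemma increment_lower_bound:
  fixes X K \<Gamma> :: "real \<Rightarrow> real"
  assumes X: "integrable (lebesgue_on {a..b}) X"
    and K: "integrable (lebesgue_on {a..b}) K"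
    and \<Gamma>: "integrable (lebesgue_on {a..b}) \<Gamma>"
    and N: "negligible N"
    and dom: "\<And>r s. \<lbrakk>r \<in> {a..b} - N; s \<in> {a..b} - N; r < s\<rbrakk> \<Longrightarrow> - K s * (s - r) \<le> X s - X r"
    and dini: "\<And>s e. \<lbrakk>s \<in> {a<..b} - N; 0 < e\<rbrakk> \<Longrightarrow>
      \<exists>d>0. \<forall>r\<in>{a..b} - N. s - d < r \<and> r < s \<longrightarrow> (\<Gamma> s - e) * (s - r) \<le> X s - X r"
  obtains N' where "negligible N'"
    "\<And>\<delta> \<tau>. \<lbrakk>\<delta> \<in> {a<..b} - N'; \<tau> \<in> {a<..b} - N'; \<delta> < \<tau>\<rbrakk> \<Longrightarrow> integral {\<delta>..\<tau>} \<Gamma> \<le> X \<tau> - X \<delta>"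
proof -
  \<comment> \<open>Extension by zero makes every translate integrable on the whole line.\<close>
  define X0 where "X0 s = (if s \<in> {a..b} then X s else 0)" for s
  have X0i: "integrable lebesgue X0"
  proof -
    have "integrable lebesgue (\<lambda>s. indicat_real {a..b} s *\<^sub>R X s)"
      using X by (simp add: integrable_restrict_space)
    moreover have "(\<lambda>s. indicat_real {a..b} s *\<^sub>R X s) = X0" by (auto simp: X0_def indicator_def)
    ultimately show ?thesis by simp
  qed
  obtain M where M: "negligible M"
    "\<And>x. x \<in> {a<..b} - M \<Longrightarrow> ((\<lambda>h. integral {x-h..x} X /\<^sub>R h) \<longlongrightarrow> X x) (at_right 0)"
    using lebesgue_left_differentiation[OF X] by blast
  have "integral {\<delta>..\<tau>} \<Gamma> \<le> X \<tau> - X \<delta>"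
    if \<delta>: "\<delta> \<in> {a<..b} - M" and \<tau>: "\<tau> \<in> {a<..b} - M" and \<delta>\<tau>: "\<delta> < \<tau>" for \<delta> \<tau>
  proof -
    \<comment> \<open>Dividing by n + 2 keeps h n strictly below \<delta> - a from n = 0 on, so s -
      h n stays in [a, b] for every s in [\<delta>, \<tau>].\<close>
    define h where "h n = (\<delta> - a) / real (n + 2)" for n
    have h: "0 < h n" "h n < \<delta> - a" for n
    proof -
      have "(\<delta> - a) * 1 < (\<delta> - a) * (real n + 2)"
        using \<delta> by (intro mult_strict_left_mono) auto
      then show "h n < \<delta> - a" by (simp add: h_def divide_less_eq add.commute)
    qed (use \<delta> in \<open>simp add: h_def\<close>)
    have h0: "h \<longlonglongrightarrow> 0"
      unfolding h_def by (rule LIMSEQ_ignore_initial_segment[OF lim_const_over_n])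
    have hr: "filterlim h (at_right 0) sequentially"
      using h0 h(1) by (intro tendsto_imp_filterlim_at_right) auto 
    let ?M = "lebesgue_on {\<delta>..\<tau>}"
    have sub: "integrable ?M f" if "integrable (lebesgue_on {a..b}) f" for f :: "real \<Rightarrow> real"
      using integrable_lebesgue_on_subset[OF that] \<delta> \<tau> by auto
    define q where "q n s = K s + (X0 s - X0 (s - h n)) / h n" for n s
    have sh: "integrable lebesgue (\<lambda>s. X0 (s - h n))" for n
      using lebesgue_integrable_real_affine[OF X0i, of 1 "- h n"] by simp
    have on: "integrable ?M f" if "integrable lebesgue f" for f :: "real \<Rightarrow> real"
      using integrable_mult_indicator[OF _ that, of "{\<delta>..\<tau>}"] by (simp add: integrable_restrict_space)
    have qi: "integrable ?M (q n)" for n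
      unfolding q_def using on[OF X0i] on[OF sh] sub[OF K] by auto
    have qint: "integral\<^sup>L ?M (q n) = integral\<^sup>L ?M K +
        (integral {\<tau>-h n..\<tau>} X /\<^sub>R h n - integral {\<delta>-h n..\<delta>} X /\<^sub>R h n)" for n
    proof -
      have i0: "X0 integrable_on {c..d}" for c d
        by (metis X0i integrable_on_lebesgue integrable_on_subinterval subset_UNIV)
      have "integral\<^sup>L ?M (q n) = integral\<^sup>L ?M K + (integral\<^sup>L ?M X0 - integral\<^sup>L ?M (\<lambda>s. X0 (s - h n))) / h n"
        unfolding q_def using on[OF X0i] on[OF sh] sub[OF K] by simp
      also have "integral\<^sup>L ?M X0 = integral {\<delta>..\<tau>} X0"
        using on[OF X0i] by (simp add: lebesgue_integral_eq_integral)
      also have "integral\<^sup>L ?M (\<lambda>s. X0 (s - h n)) = integral {\<delta>..\<tau>} (\<lambda>s. X0 (s - h n))"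
        using on[OF sh] by (simp add: lebesgue_integral_eq_integral)
      also have "\<dots> = integral {\<delta>-h n..\<tau>-h n} X0"
        using integral_shift_real_ivl[of "\<delta>-h n" "- h n" "\<tau>-h n" X0] by simp
      also have "integral {\<delta>..\<tau>} X0 - integral {\<delta>-h n..\<tau>-h n} X0
        = integral {\<tau>-h n..\<tau>} X0 - integral {\<delta>-h n..\<delta>} X0"
        using Henstock_Kurzweil_Integration.integral_combine[of "\<delta>-h n" \<delta> \<tau> X0] Henstock_Kurzweil_Integration.integral_combine[of "\<delta>-h n" "\<tau>-h n" \<tau> X0] h(1)[of n] \<delta>\<tau> i0
        by simp
      also have "integral {\<tau>-h n..\<tau>} X0 = integral {\<tau>-h n..\<tau>} X"
        by (rule integral_cong) (use h[of n] \<delta> \<tau> \<delta>\<tau> in \<open>auto simp: X0_def\<close>)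
      also have "integral {\<delta>-h n..\<delta>} X0 = integral {\<delta>-h n..\<delta>} X"
        by (rule integral_cong) (use h[of n] \<delta> \<tau> \<delta>\<tau> in \<open>auto simp: X0_def\<close>)
      finally show ?thesis by (simp add: diff_divide_distrib[symmetric] divide_inverse_commute right_diff_distrib)
    qed
    have lim: "(\<lambda>n. integral\<^sup>L ?M (q n)) \<longlonglongrightarrow> integral\<^sup>L ?M K + (X \<tau> - X \<delta>)"
      unfolding qint
      by (intro tendsto_intros filterlim_compose[OF M(2)[OF \<tau>] hr] filterlim_compose[OF M(2)[OF \<delta>] hr])
    define g where "g s = K s + \<Gamma> s" for s
    have gi: "integrable ?M g" unfolding g_def using sub[OF K] sub[OF \<Gamma>] by simp
    \<comment> \<open>The translates of \<open>N\<close> are included so that for a good s all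
      shifted times s - h n avoid \<open>N\<close> as well.\<close>
    have neg: "negligible (N \<union> (\<Union>n. (+) (h n) ` N))"
      using N by (intro negligible_Un negligible_countable_Union) (auto intro: negligible_translation)
    have key: "0 \<le> q n s" "(X0 s - X0 (s - h n)) / h n = (X s - X (s - h n)) / h n"
      "s - h n \<in> {a..b} - N"
      if s: "s \<in> {\<delta>..\<tau>} - (N \<union> (\<Union>n. (+) (h n) ` N))" for n s
    proof -
      have "s - h n \<notin> N"
      proof
        assume "s - h n \<in> N"
        then have "h n + (s - h n) \<in> (+) (h n) ` N" by (rule imageI)
        then show False using s by auto
      qed
      then show r: "s - h n \<in> {a..b} - N" using s h[of n] \<delta> \<tau> by auto
      show e: "(X0 s - X0 (s - h n)) / h n = (X s - X (s - h n)) / h n"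
        using r s \<delta> \<tau> by (simp add: X0_def)
      have "- K s * h n \<le> X s - X (s - h n)"
        using dom[OF r, of s] s \<delta> \<tau> h[of n] by auto
      then show "0 \<le> q n s"
        unfolding q_def e using h(1)[of n] by (simp add: field_simps)
    qed
    have "integral\<^sup>L ?M g \<le> integral\<^sup>L ?M K + (X \<tau> - X \<delta>)"
    proof (rule integral_le_lim_Fatou[OF qi _ gi _ lim])
      show "AE s in ?M. 0 \<le> q n s" for n
        by (rule AE_lebesgue_on_Diff_negligible[OF neg]) (use key in auto)
      show "AE s in ?M. \<forall>e>0. \<forall>\<^sub>F n in sequentially. g s - e \<le> q n s"
      proof (rule AE_lebesgue_on_Diff_negligible[OF neg])
        fix s assume s: "s \<in> {\<delta>..\<tau>} - (N \<union> (\<Union>n. (+) (h n) ` N))"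
        show "\<forall>e>0. \<forall>\<^sub>F n in sequentially. g s - e \<le> q n s"
        proof (intro allI impI)
          fix e :: real assume e: "0 < e"
          obtain d where d: "0 < d" "\<And>r. \<lbrakk>r\<in>{a..b} - N; s - d < r; r < s\<rbrakk> \<Longrightarrow> (\<Gamma> s - e) * (s - r) \<le> X s - X r"
            using dini[of s e] s \<delta> \<tau> e by auto
          have "\<forall>\<^sub>F n in sequentially. h n < d" using h0 d(1) by (rule order_tendstoD)
          then show "\<forall>\<^sub>F n in sequentially. g s - e \<le> q n s"
          proof eventually_elim
            case (elim n)
            have "(\<Gamma> s - e) * h n \<le> X s - X (s - h n)"
              using d(2)[OF key(3)[OF s, of n]] elim h(1)[of n] by simp
            then have "\<Gamma> s - e \<le> (X s - X (s - h n)) / h n"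
              using h(1)[of n] by (simp add: field_simps)
            then show ?case unfolding q_def key(2)[OF s] g_def by simp
          qed
        qed
      qed simp
    qed
    then have "integral\<^sup>L ?M \<Gamma> \<le> X \<tau> - X \<delta>"
      unfolding g_def using sub[OF K] sub[OF \<Gamma>] by simp
    then show ?thesis using sub[OF \<Gamma>] by (simp add: lebesgue_integral_eq_integral)
  qed
  then show ?thesis using that[OF M(1)] by blast
qed

text \<open>F(s) times the integral of u over [r, s] is not of the form K(s) (s - r) that
  \<open>increment_lower_bound\<close> asks for. Young's inequality splits it into (F(s))^2 / 2 (s -
  r) and half the integral of u^2. The latter is the increment of P / 2 and is absorbed by passing
  to X = P / 2 - E. At almost every s the left derivative of \<open>P\<close> is u^2, so the same
  term appears in the lower bound for the increment of \<open>X\<close> and cancels in the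
  end.\<close>

lemma increment_upper_bound:
  fixes E F u G :: "real \<Rightarrow> real"
  assumes E: "integrable (lebesgue_on {a..b}) E"
    and F: "integrable (lebesgue_on {a..b}) (\<lambda>s. (F s)\<^sup>2)"
    and u: "u \<in> borel_measurable (lebesgue_on {a..b})" "integrable (lebesgue_on {a..b}) (\<lambda>s. (u s)\<^sup>2)"
    and G: "integrable (lebesgue_on {a..b}) G"
    and N: "negligible N"
    and dom: "\<And>r s. \<lbrakk>r \<in> {a..b} - N; s \<in> {a..b} - N; r < s\<rbrakk> \<Longrightarrow> E s - E r \<le> F s * integral {r..s} u"
    and dini: "\<And>s e. \<lbrakk>s \<in> {a<..b} - N; 0 < e\<rbrakk> \<Longrightarrow>
      \<exists>d>0. \<forall>r\<in>{a..b} - N. s - d < r \<and> r < s \<longrightarrow> E s - E r \<le> (G s + e) * (s - r)"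
  obtains N' where "negligible N'"
    "\<And>\<delta> \<tau>. \<lbrakk>\<delta> \<in> {a<..b} - N'; \<tau> \<in> {a<..b} - N'; \<delta> < \<tau>\<rbrakk> \<Longrightarrow> E \<tau> - E \<delta> \<le> integral {\<delta>..\<tau>} G"
proof -
  define U where "U s = (u s)\<^sup>2" for s
  have U: "integrable (lebesgue_on {a..b}) U" using u(2) unfolding U_def .
  define P where "P s = integral {a..s} U" for s
  define X where "X s = P s / 2 - E s" for s
  have Ui: "U integrable_on {a..b}" by (rule integrable_on_lebesgue_on[OF U]) auto
  have Ui': "U integrable_on {r..s}" if "a \<le> r" "s \<le> b" for r s
    by (rule integrable_on_subinterval[OF Ui]) (use that in auto)
  have PD: "P s - P r = integral {r..s} U" if "a \<le> r" "r \<le> s" "s \<le> b" for r s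
    unfolding P_def using Henstock_Kurzweil_Integration.integral_combine[of a r s U] that Ui' by simp
  have "continuous_on {a..b} P" unfolding P_def using Ui by (rule indefinite_integral_continuous_1)
  then have Pi: "integrable (lebesgue_on {a..b}) P" by (rule continuous_imp_integrable_real)
  obtain M where M: "negligible M"
    "\<And>x. x \<in> {a<..b} - M \<Longrightarrow> ((\<lambda>h. integral {x-h..x} U /\<^sub>R h) \<longlongrightarrow> U x) (at_right 0)"
    using lebesgue_left_differentiation[OF U] by blast
  have CS: "F s * integral {r..s} u \<le> (F s)\<^sup>2 / 2 * (s - r) + integral {r..s} U / 2"
    if rs: "a \<le> r" "r < s" "s \<le> b" for r s
  proof -
    have m: "u \<in> borel_measurable (lebesgue_on {r..s})"
      using u(1) rs by (intro measurable_restrict_mono[OF u(1)]) auto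
    have Urs: "integrable (lebesgue_on {r..s}) U"
      by (rule integrable_lebesgue_on_subset[OF U]) (use rs in auto)
    have uint: "integrable (lebesgue_on {r..s}) u"
    proof (rule Bochner_Integration.integrable_bound)
      show "integrable (lebesgue_on {r..s}) (\<lambda>x. 1 + U x)" using Urs by simp
      show "AE x in lebesgue_on {r..s}. norm (u x) \<le> norm (1 + U x)"
      proof (rule AE_I2)
        fix x show "norm (u x) \<le> norm (1 + U x)"
          unfolding U_def using zero_le_power2[of "\<bar>u x\<bar> - 1"] by (simp add: power2_diff)
      qed
    qed (use m in simp)
    have "F s * integral {r..s} u = integral {r..s} (\<lambda>x. F s * u x)" by simp
    also have "\<dots> \<le> integral {r..s} (\<lambda>x. (F s)\<^sup>2 / 2 + U x / 2)"
    proof (rule integral_le)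
      show "(\<lambda>x. F s * u x) integrable_on {r..s}"
        using uint by (intro integrable_on_lebesgue_on) auto
      show "(\<lambda>x. (F s)\<^sup>2 / 2 + U x / 2) integrable_on {r..s}"
        using Urs by (intro integrable_on_lebesgue_on) auto
      show "F s * u x \<le> (F s)\<^sup>2 / 2 + U x / 2" for x
        unfolding U_def using zero_le_power2[of "F s - u x"] by (simp add: power2_diff)
    qed
    also have "\<dots> = (F s)\<^sup>2 / 2 * (s - r) + integral {r..s} U / 2"
      using rs Ui'[of r s] by (subst Henstock_Kurzweil_Integration.integral_add) (auto intro: integrable_on_divide)
    finally show ?thesis .
  qed
  obtain N' where N': "negligible N'"
    "\<And>\<delta> \<tau>. \<lbrakk>\<delta> \<in> {a<..b} - N'; \<tau> \<in> {a<..b} - N'; \<delta> < \<tau>\<rbrakk> \<Longrightarrow> integral {\<delta>..\<tau>} (\<lambda>s. U s / 2 - G s) \<le> X \<tau> - X \<delta>"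
  proof (rule increment_lower_bound[of a b X "\<lambda>s. (F s)\<^sup>2 / 2" "\<lambda>s. U s / 2 - G s" "N \<union> M"])
    show "integrable (lebesgue_on {a..b}) X" unfolding X_def using Pi E by simp
    show "- ((F s)\<^sup>2 / 2) * (s - r) \<le> X s - X r"
      if "r \<in> {a..b} - (N \<union> M)" "s \<in> {a..b} - (N \<union> M)" "r < s" for r s
      using dom[of r s] CS[of r s] PD[of r s] that by (simp add: X_def diff_divide_distrib[symmetric])
    show "\<exists>d>0. \<forall>r\<in>{a..b} - (N \<union> M). s - d < r \<and> r < s \<longrightarrow> (U s / 2 - G s - e) * (s - r) \<le> X s - X r"
      if s: "s \<in> {a<..b} - (N \<union> M)" and e: "0 < e" for s e
    proof -
      obtain d1 where d1: "0 < d1" "\<And>r. \<lbrakk>r\<in>{a..b} - N; s - d1 < r; r < s\<rbrakk> \<Longrightarrow> E s - E r \<le> (G s + e/2) * (s - r)"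
        using dini[of s "e/2"] s e by auto
      have "\<forall>\<^sub>F h in at_right 0. U s - e < integral {s-h..s} U /\<^sub>R h"
        using M(2)[of s] s e by (intro order_tendstoD) auto
      then obtain d2 where d2: "0 < d2" "\<And>h. \<lbrakk>0 < h; h < d2\<rbrakk> \<Longrightarrow> U s - e < integral {s-h..s} U /\<^sub>R h"
        unfolding eventually_at_right_field by auto
      have "(U s / 2 - G s - e) * (s - r) \<le> X s - X r"
        if r: "r\<in>{a..b} - (N \<union> M)" "s - min d1 d2 < r" "r < s" for r
      proof -
        have "E s - E r \<le> (G s + e/2) * (s - r)" using d1(2) r by auto
        moreover have "U s - e < integral {r..s} U / (s - r)" using d2(2)[of "s - r"] r by (simp add: divide_inverse_commute)
        then have "(U s - e) * (s - r) \<le> P s - P r"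
          using PD[of r s] r s by (simp add: field_simps)
        ultimately show ?thesis unfolding X_def by (simp add: algebra_simps) (simp add: field_simps)
      qed
      then show ?thesis using d1(1) d2(1) by (intro exI[of _ "min d1 d2"]) auto
    qed
  qed (use F G U N M(1) in \<open>auto intro: negligible_Un\<close>)
  show ?thesis
  proof (rule that[OF N'(1)])
    fix \<delta> \<tau> assume dt: "\<delta> \<in> {a<..b} - N'" "\<tau> \<in> {a<..b} - N'" "\<delta> < \<tau>"
    have "G integrable_on {\<delta>..\<tau>}"
      by (rule integrable_on_lebesgue_on[OF integrable_lebesgue_on_subset[OF G]]) (use dt in auto)
    then have "integral {\<delta>..\<tau>} (\<lambda>s. U s / 2 - G s) = integral {\<delta>..\<tau>} U / 2 - integral {\<delta>..\<tau>} G"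
      using Ui'[of \<delta> \<tau>] dt by (subst Henstock_Kurzweil_Integration.integral_diff) (auto intro: integrable_on_divide)
    then show "E \<tau> - E \<delta> \<le> integral {\<delta>..\<tau>} G"
      using N'(2)[OF dt] PD[of \<delta> \<tau>] dt by (simp add: X_def diff_divide_distrib[symmetric])
  qed
qed

section \<open>Square roots of positive definite matrices\<close>

lemma spd_adjoint: assumes "spd (R::real^'m^'m)" shows "x \<bullet> (R *v y) = (R *v x) \<bullet> y"
  using assms unfolding spd_def by (metis dot_lmul_matrix vector_transpose_matrix)

text \<open>The minimum of the quadratic form over the compact unit sphere is attained, hence
  positive; homogeneity extends it to all vectors.\<close>

lemma spd_coercive:
  assumes "spd (R::real^'m^'m)"
  obtains c where "0 < c" "\<And>x. c * (norm x)\<^sup>2 \<le> x \<bullet> (R *v x)"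
proof -
  have c: "continuous_on (sphere 0 1) (\<lambda>x::real^'m. x \<bullet> (R *v x))"
    by (intro continuous_intros)
  have ne: "sphere (0::real^'m) 1 \<noteq> {}" by simp
  obtain x0 where x0: "x0 \<in> sphere 0 1" "\<And>x. x \<in> sphere 0 1 \<Longrightarrow> x0 \<bullet> (R *v x0) \<le> x \<bullet> (R *v x)"
    using continuous_attains_inf[OF compact_sphere ne c] by auto
  have "x0 \<noteq> 0" using x0(1) by auto
  then have p: "0 < x0 \<bullet> (R *v x0)" using assms unfolding spd_def by auto
  have "(x0 \<bullet> (R *v x0)) * (norm x)\<^sup>2 \<le> x \<bullet> (R *v x)" for x
  proof (cases "x = 0")
    case False
    have "x0 \<bullet> (R *v x0) \<le> (x /\<^sub>R norm x) \<bullet> (R *v (x /\<^sub>R norm x))"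
      using False by (intro x0(2)) simp
    also have "\<dots> = (x \<bullet> (R *v x)) / (norm x)\<^sup>2"
      by (simp add: matrix_vector_mult_scaleR power2_eq_square divide_simps)
    finally show ?thesis using False by (simp add: field_simps)
  qed simp
  then show ?thesis using that p by blast
qed

lemma spd_invertible: assumes "spd (R::real^'m^'m)" shows "invertible R"
proof -
  have "R *v x = 0 \<Longrightarrow> x = 0" for x
    using assms unfolding spd_def by (metis inner_zero_right less_irrefl)
  then show ?thesis
    by (metis invertible_left_inverse matrix_left_invertible_ker)
qed

text \<open>With D = S - Q the equality of squares reads S D + D Q = 0. Multiplying by D and taking
  traces gives tr(D S D) + tr(D Q D) = 0, and each trace is a sum of nonnegative quadratic forms
  over the columns of D; positivity of S then forces every column to vanish.\<close>

lemma spd_sqrt_unique: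
  fixes S Q :: "real^'m^'m"
  assumes S: "spd S" and Q: "spd Q" and eq: "S ** S = Q ** Q"
  shows "S = Q"
proof -
  define D where "D = S - Q"
  have tD: "transpose D = D"
    using S Q unfolding spd_def D_def by (simp add: transpose_def vec_eq_iff)
  have "S ** D + D ** Q = 0"
    using eq by (simp add: D_def vec_eq_iff matrix_matrix_mult_def algebra_simps sum_subtractf)
  then have "trace (D ** (S ** D) + D ** (D ** Q)) = 0"
    by (simp flip: matrix_add_ldistrib add: trace_def)
  then have "trace (D ** (S ** D)) + trace (D ** (Q ** D)) = 0"
    by (metis matrix_mul_assoc trace_add trace_mul_sym)
  moreover have *: "trace (D ** (M ** D)) = (\<Sum>j\<in>UNIV. column j D \<bullet> (M *v column j D))" for M
  proof -
    have "(D ** (M ** D)) $ j $ j = column j D \<bullet> (M *v column j D)" for j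
    proof -
      have "row j D = column j D" using tD by (metis row_transpose)
      moreover have "column j (M ** D) = M *v column j D"
        by (simp add: column_def matrix_matrix_mult_def matrix_vector_mult_def vec_eq_iff)
      moreover have "(D ** (M ** D)) $ j $ j = row j D \<bullet> column j (M ** D)"
        by (simp add: matrix_matrix_mult_def row_def column_def inner_vec_def)
      ultimately show ?thesis by simp
    qed
    then show ?thesis by (simp add: trace_def)
  qed
  moreover have nn: "0 \<le> x \<bullet> (M *v x)" if "spd M" for M :: "real^'m^'m" and x
    using that unfolding spd_def by (cases "x = 0") (auto intro: less_imp_le)
  ultimately have "(\<Sum>j\<in>UNIV. column j D \<bullet> (S *v column j D)) = 0"
    by (metis (no_types, lifting) S Q add_nonneg_eq_0_iff sum_nonneg)
  then have "column j D \<bullet> (S *v column j D) = 0" for j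
    using nn[OF S] by (subst (asm) sum_nonneg_eq_0_iff) auto
  then have "column j D = 0" for j
    using S unfolding spd_def by (metis less_irrefl)
  then have "D = 0" by (simp add: column_def vec_eq_iff)
  then show ?thesis by (simp add: D_def)
qed

text \<open>After scaling, \<open>R = 1 - B\<close> with \<open>\<parallel>B\<parallel> < 1\<close>, and the root is \<open>1 - Y\<close> for the fixed point of
  the contraction \<open>Y \<mapsto> (B + Y\<^sup>2) / 2\<close>.\<close>

lemma spd_sqrt_exists:
  fixes R :: "real^'m^'m"
  assumes R: "spd R"
  obtains S where "spd S" "S ** S = R"
proof -
  obtain c where c: "0 < c" "\<And>x. c * (norm x)\<^sup>2 \<le> x \<bullet> (R *v x)"
    using spd_coercive[OF R] by blast
  obtain K where K: "0 < K" "\<And>x. norm (R *v x) \<le> norm x * K"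
    using bounded_linear.pos_bounded[OF matrix_vector_mul_bounded_linear[of R]] by blast
  define b where "b x = x - (1/K) *\<^sub>R (R *v x)" for x
  have lin: "linear b" unfolding b_def
    by (intro linear_compose_sub linear_compose_scale_right linear_ident matrix_vector_mul_linear)
  have b_sym: "x \<bullet> b y = b x \<bullet> y" for x y
    using spd_adjoint[OF R] by (simp add: b_def inner_diff)
  define \<beta> where "\<beta> = max 0 (1 - c / K)"
  have \<beta>: "0 \<le> \<beta>" "\<beta> < 1" using c K by (auto simp: \<beta>_def)
  have b_nn: "0 \<le> x \<bullet> b x" for x
  proof -
    have "x \<bullet> (R *v x) \<le> norm x * norm (R *v x)" by (simp add: Cauchy_Schwarz_ineq2 order_trans[OF abs_ge_self])
    also have "\<dots> \<le> norm x * (norm x * K)" by (simp add: K mult_left_mono)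
    finally show ?thesis using K by (simp add: b_def inner_diff power2_norm_eq_inner flip: power2_norm_eq_inner)
        (simp add: field_simps power2_eq_square)
  qed
  have b_le: "x \<bullet> b x \<le> \<beta> * (norm x)\<^sup>2" for x
  proof -
    have "x \<bullet> b x \<le> (1 - c/K) * (norm x)\<^sup>2"
      using c(2)[of x] K by (simp add: b_def inner_diff flip: power2_norm_eq_inner) (simp add: field_simps)
    also have "\<dots> \<le> \<beta> * (norm x)\<^sup>2" by (intro mult_right_mono) (auto simp: \<beta>_def)
    finally show ?thesis .
  qed
  \<comment> \<open>Cauchy-Schwarz for the semidefinite form x \<bullet> b y. Applied to
    \<open>b x\<close> and \<open>x\<close>, it upgrades the bound on the quadratic form of
    \<open>b\<close> to the operator norm bound \<open>b_norm\<close>.\<close>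
  have b_CS: "(x \<bullet> b y)\<^sup>2 \<le> (x \<bullet> b x) * (y \<bullet> b y)" for x y
  proof -
    have q: "0 \<le> (x \<bullet> b x) + 2 * t * (x \<bullet> b y) + t\<^sup>2 * (y \<bullet> b y)" for t
    proof -
      have "0 \<le> (x + t *\<^sub>R y) \<bullet> b (x + t *\<^sub>R y)" by (rule b_nn)
      also have "\<dots> = (x \<bullet> b x) + 2 * t * (x \<bullet> b y) + t\<^sup>2 * (y \<bullet> b y)"
        using b_sym[of y x] by (simp add: linear_add[OF lin] linear_cmul[OF lin] inner_simps
            inner_commute power2_eq_square algebra_simps)
      finally show ?thesis .
    qed
    show ?thesis
    proof (cases "y \<bullet> b y = 0")
      case True
      have "x \<bullet> b y = 0"
      proof (rule ccontr)
        assume ne: "x \<bullet> b y \<noteq> 0"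
        have "0 \<le> (x \<bullet> b x) + 2 * (- ((x \<bullet> b x) + 1) / (2 * (x \<bullet> b y))) * (x \<bullet> b y)"
          using q[of "- ((x \<bullet> b x) + 1) / (2 * (x \<bullet> b y))"] True by simp
        then show False using ne by (simp add: field_simps)
      qed
      then show ?thesis using True by simp
    next
      case False
      then have p: "0 < y \<bullet> b y" using b_nn[of y] by simp
      have "0 \<le> (x \<bullet> b x) + 2 * (- (x \<bullet> b y) / (y \<bullet> b y)) * (x \<bullet> b y) + (- (x \<bullet> b y) / (y \<bullet> b y))\<^sup>2 * (y \<bullet> b y)"
        by (rule q)
      also have "\<dots> = (x \<bullet> b x) - (x \<bullet> b y)\<^sup>2 / (y \<bullet> b y)"
        using p by (simp add: field_simps power2_eq_square)
      finally show ?thesis using p by (simp add: field_simps)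
    qed
  qed
  have b_norm: "norm (b x) \<le> \<beta> * norm x" for x
  proof -
    have "((norm (b x))\<^sup>2)\<^sup>2 = (b x \<bullet> b x)\<^sup>2" by (simp add: power2_norm_eq_inner)
    also have "\<dots> \<le> (b x \<bullet> b (b x)) * (x \<bullet> b x)" by (rule b_CS)
    also have "\<dots> \<le> (\<beta> * (norm (b x))\<^sup>2) * (\<beta> * (norm x)\<^sup>2)"
      by (intro mult_mono b_le b_nn) (use \<beta> in auto)
    finally have "(norm (b x))\<^sup>2 * (norm (b x))\<^sup>2 \<le> (norm (b x))\<^sup>2 * (\<beta> * norm x)\<^sup>2"
      by (simp add: power2_eq_square mult_ac)
    then have "(norm (b x))\<^sup>2 \<le> (\<beta> * norm x)\<^sup>2 \<or> norm (b x) = 0"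
      by (metis mult_le_cancel_left_pos zero_less_norm_iff norm_eq_zero zero_less_power)
    then show ?thesis
      using \<beta> by (auto simp: power2_le_iff_abs_le)
  qed
  have bl: "bounded_linear b" using lin by (simp add: linear_conv_bounded_linear)
  define B where "B = Blinfun b"
  have B[simp]: "blinfun_apply B x = b x" for x by (simp add: B_def bounded_linear_Blinfun_apply[OF bl])
  have nB: "norm B \<le> \<beta>" by (rule norm_blinfun_bound) (use b_norm \<beta> in auto)
  \<comment> \<open>The smaller root of \<rho> = (\<beta> + \<rho>^2) / 2: the ball of radius \<rho>
    is then mapped into itself, and on it the map contracts with the same factor \<rho> < 1.\<close>
  define \<rho> where "\<rho> = 1 - sqrt (1 - \<beta>)"
  have \<rho>: "0 \<le> \<rho>" "\<rho> < 1" using \<beta> by (auto simp: \<rho>_def)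
  have \<rho>eq: "(\<beta> + \<rho> * \<rho>) / 2 = \<rho>"
  proof -
    define q where "q = sqrt (1 - \<beta>)"
    have "q * q = 1 - \<beta>" using \<beta> by (simp add: q_def)
    then show ?thesis unfolding \<rho>_def q_def[symmetric] by (simp add: field_simps)
  qed
  \<comment> \<open>Symmetry is built into the domain of the iteration because the root has to
    inherit it; being a closed condition, it keeps \<open>X\<close> complete.\<close>
  define X where "X = {Y::(real^'m) \<Rightarrow>\<^sub>L (real^'m). norm Y \<le> \<rho> \<and> (\<forall>x y. x \<bullet> blinfun_apply Y y = blinfun_apply Y x \<bullet> y)}"
  define \<Phi> where "\<Phi> Y = (1/2) *\<^sub>R (B + (Y o\<^sub>L Y))" for Y
  have "\<exists>!Y. Y \<in> X \<and> \<Phi> Y = Y"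
  proof (rule Banach_fix[of X \<rho>])
    have "closed X"
      unfolding X_def
      by (intro closed_Collect_conj closed_Collect_all closed_Collect_le closed_Collect_eq continuous_intros)
    then show "complete X" by (simp add: complete_eq_closed)
    show "X \<noteq> {}" using \<rho> by (auto simp: X_def intro!: exI[of _ 0])
    show "\<Phi> ` X \<subseteq> X"
    proof clarify
      fix Y assume Y: "Y \<in> X"
      have "norm (\<Phi> Y) \<le> (1/2) * (norm B + norm (Y o\<^sub>L Y))"
        unfolding \<Phi>_def by (simp add: norm_triangle_ineq)
      also have "\<dots> \<le> (1/2) * (\<beta> + \<rho> * \<rho>)"
      proof -
        have "norm (Y o\<^sub>L Y) \<le> norm Y * norm Y" by (rule norm_blinfun_compose)
        also have "\<dots> \<le> \<rho> * \<rho>" using Y \<rho> by (intro mult_mono) (auto simp: X_def)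
        finally show ?thesis using nB by simp
      qed
      finally have "norm (\<Phi> Y) \<le> \<rho>" using \<rho>eq by simp
      moreover have "x \<bullet> \<Phi> Y y = \<Phi> Y x \<bullet> y" for x y
        using Y b_sym[of x y] by (simp add: \<Phi>_def X_def blinfun.bilinear_simps inner_simps)
      ultimately show "\<Phi> Y \<in> X" by (simp add: X_def)
    qed
    show "dist (\<Phi> Y) (\<Phi> Z) \<le> \<rho> * dist Y Z" if YZ: "Y \<in> X" "Z \<in> X" for Y Z
    proof -
      have "\<Phi> Y - \<Phi> Z = (1/2) *\<^sub>R ((Y o\<^sub>L (Y - Z)) + ((Y - Z) o\<^sub>L Z))"
        by (rule blinfun_eqI) (simp add: \<Phi>_def blinfun.bilinear_simps algebra_simps)
      then have "norm (\<Phi> Y - \<Phi> Z) \<le> (1/2) * (norm (Y o\<^sub>L (Y - Z)) + norm ((Y - Z) o\<^sub>L Z))"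
        by (simp add: norm_triangle_ineq)
      also have "\<dots> \<le> (1/2) * (norm Y * norm (Y - Z) + norm (Y - Z) * norm Z)"
        by (intro mult_left_mono add_mono norm_blinfun_compose) auto
      also have "\<dots> \<le> (1/2) * (\<rho> * norm (Y - Z) + norm (Y - Z) * \<rho>)"
        using YZ by (intro mult_left_mono add_mono mult_right_mono mult_left_mono) (auto simp: X_def)
      finally show ?thesis by (simp add: dist_norm)
    qed
  qed (use \<rho> in auto)
  then obtain Y where Y: "Y \<in> X" "\<Phi> Y = Y" by blast
  \<comment> \<open>The fixed point equation is 2 Y = B + Y^2, hence (1 - Y)^2 = 1 - B = R / K, and
    the factor \<open>sqrt K\<close> undoes the scaling.\<close>
  define s where "s x = sqrt K *\<^sub>R (x - Y x)" for x
  have lin_s: "linear s" unfolding s_def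
    by (intro linear_compose_scale_right linear_compose_sub linear_ident blinfun.bounded_linear_right bounded_linear.linear)
  have Mv: "matrix s *v x = s x" for x by (simp add: lin_s matrix_works)
  have "s (s x) = R *v x" for x
  proof -
    have "Y x = (1/2) *\<^sub>R (b x + Y (Y x))"
      using arg_cong[OF Y(2), of "\<lambda>Z. blinfun_apply Z x"] by (simp add: \<Phi>_def blinfun.bilinear_simps)
    then have "2 *\<^sub>R Y x = b x + Y (Y x)" by (metis divide_numeral_1 numeral_One scaleR_half_double scaleR_left_imp_eq scaleR_scaleR scaleR_one times_divide_eq_right mult.commute nonzero_divide_eq_eq zero_neq_numeral)
    then have "x - 2 *\<^sub>R Y x + Y (Y x) = (1/K) *\<^sub>R (R *v x)"
      by (simp add: b_def algebra_simps)
    moreover have "s (s x) = K *\<^sub>R (x - 2 *\<^sub>R Y x + Y (Y x))"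
      using K by (simp add: s_def blinfun.bilinear_simps scaleR_right_diff_distrib scaleR_2 algebra_simps)
    ultimately show ?thesis using K by simp
  qed
  then have "matrix s ** matrix s = R"
    by (metis Mv matrix_vector_mul_assoc matrix_eq)
  moreover have "spd (matrix s)"
    unfolding spd_def
  proof (intro conjI allI impI)
    have "x \<bullet> (matrix s *v y) = (matrix s *v x) \<bullet> y" for x y
      using Y(1) by (simp add: Mv s_def X_def inner_simps)
    then have "x \<bullet> (matrix s *v y) = x \<bullet> (transpose (matrix s) *v y)" for x y
      by (simp add: dot_lmul_matrix flip: vector_transpose_matrix)
    then show "transpose (matrix s) = matrix s"
      by (metis matrix_eq vector_eq_ldot)
    fix x :: "real^'m" assume x: "x \<noteq> 0"
    have "x \<bullet> Y x \<le> norm x * norm (Y x)" by (simp add: Cauchy_Schwarz_ineq2 order_trans[OF abs_ge_self])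
    also have "\<dots> \<le> norm x * (norm Y * norm x)" by (intro mult_left_mono norm_blinfun) auto
    also have "\<dots> \<le> \<rho> * (norm x)\<^sup>2" using Y(1)
      by (simp add: X_def power2_eq_square mult.left_commute[of "norm x"] mult_right_mono)
    also have "\<dots> < (norm x)\<^sup>2" using \<rho> x by simp
    finally have "x \<bullet> Y x < x \<bullet> x" by (simp add: power2_norm_eq_inner)
    then show "0 < x \<bullet> (matrix s *v x)" using K by (simp add: Mv s_def inner_simps)
  qed
  ultimately show ?thesis using that by blast
qed

text \<open>Existence and uniqueness of the root S resolve the \<open>THE\<close> in
  \<open>inv_sqrt\<close>; applying S\<inverse> to R x = S (S x) leaves S x, and |S x|^2 = x
  \<bullet> S^2 x by symmetry.\<close>

lemma norm_inv_sqrt: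
  fixes R :: "real^'m^'m"
  assumes R: "spd R"
  shows "(norm (inv_sqrt R *v (R *v x)))\<^sup>2 = x \<bullet> (R *v x)"
proof -
  obtain S where S: "spd S" "S ** S = R" using spd_sqrt_exists[OF R] .
  have "(THE S. spd S \<and> S ** S = R) = S"
    using S spd_sqrt_unique by (intro the_equality) auto
  then have "inv_sqrt R = matrix_inv S" by (simp add: inv_sqrt_def)
  moreover have "matrix_inv S ** S = mat 1"
    using spd_invertible[OF S(1)] unfolding matrix_inv_def invertible_def by (rule someI2_ex) simp
  ultimately have "inv_sqrt R *v (R *v x) = S *v x"
    by (metis S(2) matrix_mul_assoc matrix_mul_lid matrix_vector_mul_assoc)
  then show ?thesis
    by (metis S(1,2) power2_norm_eq_inner spd_adjoint matrix_vector_mul_assoc)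
qed

text \<open>Completing the square: with v = R x, expanding the nonnegative form of R at x / 2 - i is
  exactly the claim, and 1 / 4 is the square of the 1 / 2 in the maximiser i = x / 2.\<close>

lemma spd_power_bound:
  fixes R :: "real^'m^'m"
  assumes R: "spd R"
  shows "i \<bullet> (v - R *v i) \<le> 1 / 4 * (norm (inv_sqrt R *v v))\<^sup>2"
proof -
  obtain x where v: "v = R *v x"
    using spd_invertible[OF R] by (metis invertible_right_inverse matrix_right_invertible_surjective surjD)
  let ?d = "(1/2) *\<^sub>R x - i"
  have "0 \<le> ?d \<bullet> (R *v ?d)"
    using R unfolding spd_def by (cases "?d = 0") (auto intro: less_imp_le)
  also have "\<dots> = 1/4 * (x \<bullet> (R *v x)) - i \<bullet> (R *v x) + i \<bullet> (R *v i)"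
    using spd_adjoint[OF R, of x i]
    by (simp add: matrix_vector_mult_diff_distrib matrix_vector_mult_scaleR inner_simps inner_commute algebra_simps)
  finally show ?thesis using norm_inv_sqrt[OF R, of x] v by (simp add: inner_simps)
qed

section \<open>Smooth step functions and weak derivatives\<close>

lemma Ck_continuous_on: "Ck k f \<Longrightarrow> continuous_on UNIV f"
  by (cases k) (auto intro: continuous_at_imp_continuous_on differentiable_imp_continuous_within)

lemma Ck_mono: "Ck (Suc k) f \<Longrightarrow> Ck k f"
proof (induction k arbitrary: f)
  case 0
  then show ?case using Ck_continuous_on[of 1 f] by simp
next
  case (Suc k)
  then show ?case by (subst (asm) Ck.simps(2)) auto
qed

text \<open>\<open>Ck\<close> is phrased with \<open>frechet_derivative\<close>; by uniqueness of
  derivatives any explicit derivative \<open>D\<close> may stand in for it, so closure properties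
  follow from the usual derivative formulas.\<close>

lemma Ck_SucI:
  assumes "\<And>x. (f has_derivative D x) (at x)" "\<And>b. b \<in> Basis \<Longrightarrow> Ck k (\<lambda>x. D x b)"
  shows "Ck (Suc k) f"
proof -
  have "frechet_derivative f (at x) = D x" for x
    using assms(1) frechet_derivative_at by metis
  then show ?thesis using assms by (auto simp: differentiable_def)
qed

lemma Ck_Suc_has_derivative: "Ck (Suc k) f \<Longrightarrow> (f has_derivative frechet_derivative f (at x)) (at x)"
  by (simp add: frechet_derivative_works[symmetric])

lemma Ck_const [simp]: "Ck k (\<lambda>x. c)"
proof (induction k arbitrary: c)
  case (Suc k)
  show ?case by (rule Ck_SucI[where D="\<lambda>x b. 0"]) (use Suc in auto)
qed simp

lemma Ck_add: "Ck k f \<Longrightarrow> Ck k g \<Longrightarrow> Ck k (\<lambda>x. f x + g x)"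
proof (induction k arbitrary: f g)
  case 0
  then show ?case by (simp add: continuous_on_add)
next
  case (Suc k)
  show ?case
    by (rule Ck_SucI[OF has_derivative_add[OF Suc.prems[THEN Ck_Suc_has_derivative]]])
      (use Suc in auto)
qed

lemma Ck_scaleR: "Ck k f \<Longrightarrow> Ck k g \<Longrightarrow> Ck k (\<lambda>x. f x *\<^sub>R g x)"
proof (induction k arbitrary: f g)
  case 0
  then show ?case by (simp add: continuous_on_scaleR)
next
  case (Suc k)
  show ?case
    by (rule Ck_SucI[OF has_derivative_scaleR[OF Suc.prems[THEN Ck_Suc_has_derivative]]])
      (use Suc.prems in \<open>auto intro!: Ck_add Suc.IH Suc.prems[THEN Ck_mono]\<close>)
qed

lemma Ck_mult: "Ck k f \<Longrightarrow> Ck k g \<Longrightarrow> Ck k (\<lambda>x. f x * g x :: real)"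
  using Ck_scaleR[of k f g] by simp

lemma Ck_prod: "finite I \<Longrightarrow> (\<And>i. i \<in> I \<Longrightarrow> Ck k (f i)) \<Longrightarrow> Ck k (\<lambda>x. \<Prod>i\<in>I. f i x :: real)"
  by (induction I rule: finite_induct) (auto intro: Ck_mult)

lemma Ck_real_SucI:
  fixes f :: "real \<Rightarrow> real"
  assumes "\<And>x. (f has_real_derivative f' x) (at x)" "Ck k f'"
  shows "Ck (Suc k) f"
  by (rule Ck_SucI[where D="\<lambda>x b. f' x * b"])
    (use assms in \<open>auto simp: has_field_derivative_def\<close>)

lemma Ck_real_deriv:
  fixes f :: "real \<Rightarrow> real"
  assumes "Ck (Suc k) f"
  obtains f' where "\<And>x. (f has_real_derivative f' x) (at x)" "Ck k f'"
proof (rule that[of "\<lambda>x. frechet_derivative f (at x) 1"])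
  show "(f has_real_derivative frechet_derivative f (at x) 1) (at x)" for x
  proof -
    have d: "(f has_derivative frechet_derivative f (at x)) (at x)" by (rule Ck_Suc_has_derivative[OF assms])
    have *: "frechet_derivative f (at x) h = frechet_derivative f (at x) 1 * h" for h
      using linear_cmul[OF has_derivative_linear[OF d], of h 1] by (simp add: mult.commute)
    then have "frechet_derivative f (at x) = (*) (frechet_derivative f (at x) 1)" by (intro ext) (rule *)
    then show ?thesis using d unfolding has_field_derivative_def by simp
  qed
qed (use assms in auto)

lemma Ck_compose_affine:
  fixes f :: "real \<Rightarrow> real"
  shows "Ck k f \<Longrightarrow> Ck k (\<lambda>x. f (c * x + d))"
proof (induction k arbitrary: f)
  case 0
  then show ?case by (auto intro!: continuous_on_compose2[of UNIV f] continuous_intros)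
next
  case (Suc k)
  obtain f' where f': "\<And>x. (f has_real_derivative f' x) (at x)" "Ck k f'"
    using Ck_real_deriv[OF Suc.prems] by blast
  have "((\<lambda>x. f (c * x + d)) has_real_derivative c * f' (c * x + d)) (at x)" for x
  proof -
    have "((\<lambda>x. c * x + d) has_real_derivative c) (at x)" by (auto intro!: derivative_eq_intros)
    then show ?thesis using DERIV_chain2[where f=f and g="\<lambda>x. c * x + d", OF f'(1)] by (simp only: mult.commute[of _ "f' _"])
  qed
  then show ?case by (rule Ck_real_SucI) (intro Ck_mult Ck_const Suc.IH f'(2))
qed

lemma Ck_compose_nth:
  fixes f :: "real \<Rightarrow> real"
  shows "Ck k f \<Longrightarrow> Ck k (\<lambda>x::real^'n. f (x $ i))"
proof (induction k arbitrary: f)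
  case 0
  then show ?case by (auto intro!: continuous_on_compose2[of UNIV f] continuous_intros)
next
  case (Suc k)
  obtain f' where f': "\<And>x. (f has_real_derivative f' x) (at x)" "Ck k f'"
    using Ck_real_deriv[OF Suc.prems] by blast
  have n: "((\<lambda>x::real^'n. x $ i) has_derivative (\<lambda>b. b $ i)) (at x)" for x
    by (rule bounded_linear_imp_has_derivative[OF bounded_linear_vec_nth])
  have "((\<lambda>x::real^'n. f (x $ i)) has_derivative (\<lambda>b. b $ i * f' (x $ i))) (at x)" for x
    using has_derivative_compose[OF n f'(1)[of "x $ i", unfolded has_field_derivative_def]]
    by (simp add: mult.commute)
  then show ?case by (rule Ck_SucI) (intro Ck_mult Ck_const Suc.IH f'(2))
qed

lemma smooth_scaleR: "smooth f \<Longrightarrow> smooth g \<Longrightarrow> smooth (\<lambda>x. f x *\<^sub>R g x)"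
  by (simp add: smooth_def Ck_scaleR)

text \<open>The functions x^(-n) exp(-1/x) on x > 0, extended by zero. Derivatives are linear
  combinations of members of the same family, so smoothness of the classical flat function follows
  by one induction for all \<open>n\<close> at once.\<close>

definition exp_flat :: "nat \<Rightarrow> real \<Rightarrow> real" where
  "exp_flat n x = (if 0 < x then (1/x) ^ n * exp (- (1/x)) else 0)"

text \<open>Keeping only the term of order n + 2 in the exponential series of y = 1 / x leaves two
  spare powers of x. A quadratic bound makes the derivative at 0 vanish.\<close>

lemma exp_flat_bound: "\<bar>exp_flat n x\<bar> \<le> fact (n + 2) * x\<^sup>2"
proof (cases "0 < x")
  case True
  define y where "y = 1 / x"
  have y: "0 < y" using True by (simp add: y_def)
  have "y ^ (n+2) / fact (n+2) \<le> exp y"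
    using sum_le_suminf[OF summable_exp[of y], of "{n+2}"] y
    by (simp add: exp_def divide_inverse_commute)
  then have "y ^ (n+2) \<le> fact (n+2) * exp y"
    by (simp only: pos_divide_le_eq fact_gt_zero mult.commute)
  then have "y ^ n * (y\<^sup>2) \<le> fact (n+2) * exp y" by (simp only: power_add)
  then have "y ^ n * exp (- y) \<le> fact (n+2) / y\<^sup>2"
    using y by (simp add: field_simps exp_minus del: fact_Suc)
  then show ?thesis using True by (simp add: exp_flat_def y_def power_divide del: fact_Suc)
qed (simp add: exp_flat_def)

lemma exp_flat_deriv:
  "(exp_flat n has_real_derivative - real n * exp_flat (Suc n) x + exp_flat (n + 2) x) (at x)"
proof (cases x "0::real" rule: linorder_cases)
  case less
  have "((\<lambda>x. 0) has_real_derivative 0) (at x)" by simp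
  moreover have "\<forall>\<^sub>F y in nhds x. exp_flat n y = 0"
    using eventually_nhds_in_open[of "{..<0}" x] less by (auto elim!: eventually_mono simp: exp_flat_def)
  ultimately show ?thesis using less by (subst DERIV_cong_ev) (auto simp: exp_flat_def)
next
  case equal
  have "(\<lambda>h. (exp_flat n (0 + h) - exp_flat n 0) / h) \<midarrow>0\<rightarrow> 0"
  proof (rule Lim_null_comparison)
    show "\<forall>\<^sub>F h in at 0. norm ((exp_flat n (0 + h) - exp_flat n 0) / h) \<le> fact (n + 2) * \<bar>h\<bar>"
      unfolding eventually_at_filter
    proof (intro always_eventually allI impI)
      fix h :: real assume "h \<noteq> 0"
      then show "norm ((exp_flat n (0 + h) - exp_flat n 0) / h) \<le> fact (n + 2) * \<bar>h\<bar>"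
        using exp_flat_bound[of n h]
        by (simp add: exp_flat_def[of _ 0] abs_divide pos_divide_le_eq power2_eq_square mult.assoc)
    qed
    show "((\<lambda>h. fact (n + 2) * \<bar>h\<bar>) \<longlongrightarrow> 0) (at (0::real))"
      by (rule tendsto_eq_intros | simp)+
  qed
  then have "(exp_flat n has_real_derivative 0) (at 0)" by (simp add: DERIV_def)
  then show ?thesis using equal by (simp add: exp_flat_def)
next
  case greater
  have "((\<lambda>x. (1/x) ^ n * exp (- (1/x))) has_real_derivative
      - real n * exp_flat (Suc n) x + exp_flat (n + 2) x) (at x)"
  proof -
    have d: "((\<lambda>x. 1/x) has_real_derivative - (1/x)\<^sup>2) (at x)"
      using greater by (auto intro!: derivative_eq_intros simp: power2_eq_square)
    have "((\<lambda>x. (1/x) ^ n * exp (- (1/x))) has_real_derivative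
        (real n * (- (1/x)\<^sup>2 * (1/x) ^ (n - Suc 0))) * exp (- (1/x)) + (exp (- (1/x)) * - (- (1/x)\<^sup>2)) * (1/x) ^ n) (at x)"
      by (rule DERIV_mult[OF DERIV_power[OF d] DERIV_fun_exp[OF DERIV_minus[OF d]]])
    then show ?thesis using greater
      by (cases n) (simp_all add: exp_flat_def power2_eq_square algebra_simps add_divide_distrib diff_divide_distrib)
  qed
  moreover have "\<forall>\<^sub>F y in nhds x. exp_flat n y = (1/y) ^ n * exp (- (1/y))"
    using eventually_nhds_in_open[of "{0<..}" x] greater by (auto elim!: eventually_mono simp: exp_flat_def)
  ultimately show ?thesis using greater by (subst DERIV_cong_ev) auto
qed

lemma Ck_exp_flat: "Ck k (exp_flat n)"
proof (induction k arbitrary: n)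
  case 0
  show ?case by (auto intro!: continuous_at_imp_continuous_on DERIV_isCont exp_flat_deriv)
next
  case (Suc k)
  show ?case
    by (rule Ck_real_SucI[OF exp_flat_deriv]) (intro Ck_add Ck_mult Ck_const Suc)
qed

text \<open>The normalised primitive of a smooth bump on [0, 1]. Its derivative
  \<open>\<beta>\<close> is exported as well, because its rescalings serve as one-sided averaging
  kernels.\<close>

lemma smooth_step:
  obtains step \<beta> :: "real \<Rightarrow> real"
  where "smooth step" "\<And>x. x \<le> 0 \<Longrightarrow> step x = 0" "\<And>x. 1 \<le> x \<Longrightarrow> step x = 1"
    "\<And>x. 0 \<le> step x" "\<And>x. step x \<le> 1" "\<And>x. (step has_real_derivative \<beta> x) (at x)"
    "\<And>x. 0 \<le> \<beta> x" "\<And>x. x \<le> 0 \<or> 1 \<le> x \<Longrightarrow> \<beta> x = 0" "continuous_on UNIV \<beta>"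
proof -
  define b where "b x = exp_flat 0 x * exp_flat 0 (1 - x)" for x
  have bs: "Ck k b" for k
    unfolding b_def using Ck_compose_affine[OF Ck_exp_flat[of k 0], of "-1" 1]
    by (intro Ck_mult Ck_exp_flat) simp
  have bc: "continuous_on S b" for S
    using Ck_continuous_on[OF bs[of 0]] continuous_on_subset by blast
  have bnn: "0 \<le> b x" for x by (simp add: b_def exp_flat_def)
  have b0: "b x = 0" if "x \<le> 0 \<or> 1 \<le> x" for x using that by (auto simp: b_def exp_flat_def)
  define c where "c = integral {0..1} b"
  have bi: "b integrable_on {x..y}" for x y by (rule integrable_continuous_real[OF bc])
  have c: "0 < c"
  proof -
    have "c \<noteq> 0"
    proof
      assume "c = 0"
      then have "b (1/2) = 0"
        using integral_eq_0_iff[OF bc, of 0 1] bnn by (auto simp: c_def)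
      then show False by (simp add: b_def exp_flat_def)
    qed
    moreover have "0 \<le> c" unfolding c_def using bnn by (intro integral_nonneg bi) auto
    ultimately show ?thesis by simp
  qed
  define step where "step x = integral {0..x} b / c" for x
  have D: "(step has_real_derivative b x / c) (at x)" for x
  proof -
    \<comment> \<open>Near x the integral from 0 is replaced by one from the fixed point -M to the
      left of x, which changes nothing since b vanishes on the negative axis. This also covers
      negative x, where {0..x} is empty.\<close>
    define M where "M = \<bar>x\<bar> + 1"
    have eq: "integral {0..y} b = integral {-M..y} b" if "y \<in> {-M<..<M}" for y
    proof (cases "0 \<le> y")
      case True
      have "integral {-M..0} b = integral {-M..0} (\<lambda>x. 0)" by (rule integral_cong) (use b0 in auto)
      then show ?thesis
        using Henstock_Kurzweil_Integration.integral_combine[of "-M" 0 y b] True that bi by auto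
    next
      case False
      have "integral {-M..y} b = integral {-M..y} (\<lambda>x. 0)" by (rule integral_cong) (use b0 False in auto)
      then show ?thesis using False by simp
    qed
    have "((\<lambda>y. integral {-M..y} b) has_real_derivative b x) (at x within {-M..M})"
      by (rule integral_has_real_derivative[OF bc]) (auto simp: M_def)
    moreover have "at x within {-M..M} = at x"
      by (rule at_within_interior) (auto simp: M_def)
    ultimately have "((\<lambda>y. integral {-M..y} b) has_real_derivative b x) (at x)" by simp
    then have "((\<lambda>y. integral {-M..y} b / c) has_real_derivative b x / c) (at x)"
      by (rule DERIV_cdivide)
    moreover have "\<forall>\<^sub>F y in nhds x. step y = integral {-M..y} b / c"
      using eventually_nhds_in_open[of "{-M<..<M}" x]
    proof (rule eventually_mono)
      show "step y = integral {-M..y} b / c" if "y \<in> {-M<..<M}" for y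
        using eq[OF that] by (simp add: step_def)
    qed (auto simp: M_def)
    ultimately show ?thesis by (subst DERIV_cong_ev) auto
  qed
  have le1: "step x = 1" if "1 \<le> x" for x
  proof -
    have "integral {1..x} b = integral {1..x} (\<lambda>x. 0)" by (rule integral_cong) (use b0 in auto)
    then show ?thesis
      using Henstock_Kurzweil_Integration.integral_combine[of 0 1 x b] that bi c by (auto simp: step_def c_def)
  qed
  have mono: "step x \<le> step y" if "x \<le> y" for x y
    by (rule DERIV_nonneg_imp_nondecreasing[OF that]) (use D bnn c in \<open>auto intro!: exI[of _ "b _ / c"]\<close>)
  have z: "step x = 0" if "x \<le> 0" for x using that by (cases "x = 0") (auto simp: step_def)
  show ?thesis
  proof (rule that[of step "\<lambda>x. b x / c"])
    show "smooth step" unfolding smooth_def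
    proof
      fix k show "Ck k step"
        by (rule Ck_mono, rule Ck_real_SucI[OF D])
          (use Ck_mult[OF bs[of k] Ck_const[of k "1/c"]] in simp)
    qed
    show "0 \<le> step x" for x using mono[of "min x 0" x] z[of "min x 0"] by simp
    show "step x \<le> 1" for x using mono[of x "max x 1"] le1[of "max x 1"] by simp
    show "continuous_on UNIV (\<lambda>x. b x / c)" by (intro continuous_intros bc) (use c in auto)
  qed (use z le1 D bnn b0 c in auto)
qed

section \<open>Testing with smooth approximations of indicator functions\<close>

lemma integral_lebesgue_on_support:
  fixes f :: "'a::euclidean_space \<Rightarrow> 'b::euclidean_space"
  assumes "S \<subseteq> S'" "S \<in> sets lebesgue" "S' \<in> sets lebesgue" "\<And>x. x \<in> S' - S \<Longrightarrow> f x = 0"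
  shows "integral\<^sup>L (lebesgue_on S') f = integral\<^sup>L (lebesgue_on S) f"
proof -
  have "(\<lambda>x. indicat_real S' x *\<^sub>R f x) = (\<lambda>x. indicat_real S x *\<^sub>R f x)"
    using assms(1,4) by (intro ext) (auto split: split_indicator)
  then show ?thesis using assms by (simp add: integral_restrict_space)
qed

text \<open>By the fundamental theorem of calculus the kernel has mass step 1 - step 0 = 1. Since it
  is integrated over [r, r + 1 / Suc n] only, continuity of \<open>z\<close> to the right of r is
  enough.\<close>

lemma tendsto_average_kernel:
  fixes z :: "real \<Rightarrow> 'b::euclidean_space" and step \<beta> :: "real \<Rightarrow> real"
  assumes step: "\<And>x. (step has_real_derivative \<beta> x) (at x)" "step 0 = 0" "step 1 = 1"
    and \<beta>: "\<And>x. 0 \<le> \<beta> x" "continuous_on UNIV \<beta>"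
    and z: "continuous_on {r..r + \<delta>} z" and \<delta>: "0 < \<delta>"
  shows "(\<lambda>n. integral {r..r + 1 / Suc n} (\<lambda>t. (Suc n * \<beta> (Suc n * (t - r))) *\<^sub>R z t)) \<longlonglongrightarrow> z r"
proof (rule LIMSEQ_I)
  fix e :: real assume e: "0 < e"
  obtain d where d: "0 < d" "\<And>t. \<lbrakk>t \<in> {r..r+\<delta>}; dist t r < d\<rbrakk> \<Longrightarrow> dist (z t) (z r) < e / 2"
    using z[unfolded continuous_on_iff, rule_format, of r "e/2"] e \<delta> by auto
  have "(\<lambda>n. 1 / real (Suc n)) \<longlonglongrightarrow> 0" using LIMSEQ_inverse_real_of_nat by (simp add: inverse_eq_divide)
  then have "\<forall>\<^sub>F n in sequentially. 1 / real (Suc n) < min d \<delta>"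
    using d \<delta> by (intro order_tendstoD) auto
  then obtain n0 where n0: "\<And>n. n \<ge> n0 \<Longrightarrow> 1 / real (Suc n) < min d \<delta>"
    unfolding eventually_sequentially by blast
  have "norm (integral {r..r + 1 / Suc n} (\<lambda>t. (Suc n * \<beta> (Suc n * (t - r))) *\<^sub>R z t) - z r) < e"
    if "n \<ge> n0" for n
  proof -
    let ?I = "{r..r + 1 / real (Suc n)}"
    define k where "k t = real (Suc n) * \<beta> (Suc n * (t - r))" for t
    have kc: "continuous_on ?I k" unfolding k_def
      by (intro continuous_intros continuous_on_compose2[OF \<beta>(2)]) auto
    have knn: "0 \<le> k t" for t using \<beta>(1) by (simp add: k_def)
    have "(k has_integral step (Suc n * (r + 1 / Suc n - r)) - step (Suc n * (r - r))) ?I"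
    proof (rule fundamental_theorem_of_calculus)
      fix t assume "t \<in> ?I"
      have "((\<lambda>t. step (real (Suc n) * (t - r))) has_real_derivative k t) (at t)"
        unfolding k_def mult.commute[of "real (Suc n)" "\<beta> _"]
        by (rule DERIV_chain2[OF step(1)]) (auto intro!: derivative_eq_intros)
      then show "((\<lambda>t. step (real (Suc n) * (t - r))) has_vector_derivative k t) (at t within ?I)"
        using has_real_derivative_iff_has_vector_derivative has_vector_derivative_at_within by blast
    qed simp
    moreover have "real (Suc n) * (r + 1 / real (Suc n) - r) = 1" by simp
    ultimately have k1: "(k has_integral 1) ?I" using step by simp
    have zc: "continuous_on ?I z"
      by (rule continuous_on_subset[OF z]) (use n0[OF that] in auto)
    have kz: "(\<lambda>t. k t *\<^sub>R z t) integrable_on ?I"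
      by (rule integrable_continuous_real) (intro continuous_intros kc zc)
    have kr: "((\<lambda>t. k t *\<^sub>R z r) has_integral z r) ?I"
      using has_integral_scaleR_left[OF k1, of "z r"] by simp
    have "integral ?I (\<lambda>t. k t *\<^sub>R z t) - z r = integral ?I (\<lambda>t. k t *\<^sub>R z t - k t *\<^sub>R z r)"
      using kz kr by (subst Henstock_Kurzweil_Integration.integral_diff)
        (auto simp: has_integral_integrable integral_unique)
    also have "norm \<dots> \<le> integral ?I (\<lambda>t. k t * (e / 2))"
    proof (rule integral_norm_bound_integral)
      show "(\<lambda>t. k t *\<^sub>R z t - k t *\<^sub>R z r) integrable_on ?I"
        using kz kr by (intro integrable_diff) (auto simp: has_integral_integrable)
      show "(\<lambda>t. k t * (e / 2)) integrable_on ?I"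
        using k1 by (intro integrable_on_mult_left) (auto simp: has_integral_integrable)
      fix t assume t: "t \<in> ?I"
      have "norm (z t - z r) \<le> e / 2"
        using d(2)[of t] t n0[OF that] by (auto simp: dist_norm)
      then show "norm (k t *\<^sub>R z t - k t *\<^sub>R z r) \<le> k t * (e / 2)"
        using mult_left_mono[OF \<open>norm (z t - z r) \<le> e / 2\<close> knn[of t]] knn[of t]
          by (simp only: scaleR_diff_right[symmetric] norm_scaleR abs_of_nonneg)
    qed
    also have "\<dots> = e / 2" using k1 by (simp add: integral_unique)
    finally show ?thesis using e unfolding k_def by simp
  qed
  then show "\<exists>no. \<forall>n\<ge>no. norm (integral {r..r + 1 / Suc n} (\<lambda>t. (Suc n * \<beta> (Suc n * (t - r))) *\<^sub>R z t) - z r) < e"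
    by blast
qed

text \<open>The test functions are smooth versions of the indicator of (r, s]: a step up at r minus
  a step up at s, each of width 1 / Suc n. Their derivatives are two averaging kernels, so the side
  with \<open>z\<close> tends to z r - z s, while dominated convergence turns the other side into
  minus the integral of \<open>z'\<close>.\<close>

lemma weak_deriv_increment:
  fixes z z' :: "real \<Rightarrow> 'b::euclidean_space"
  assumes wd: "weak_deriv_on 0 T z z'"
    and cont: "continuous_on {0<..<T} z"
    and int: "\<And>\<epsilon>. 0 < \<epsilon> \<Longrightarrow> integrable (lebesgue_on {\<epsilon>..<T}) z'"
    and rs: "0 < r" "r < s" "s < T"
  shows "z s - z r = integral {r..s} z'"
proof -
  obtain step \<beta> :: "real \<Rightarrow> real" where st: "smooth step" "\<And>x. x \<le> 0 \<Longrightarrow> step x = 0" "\<And>x. 1 \<le> x \<Longrightarrow> step x = 1"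
    "\<And>x. 0 \<le> step x" "\<And>x. step x \<le> 1" "\<And>x. (step has_real_derivative \<beta> x) (at x)"
    "\<And>x. 0 \<le> \<beta> x" "\<And>x. x \<le> 0 \<or> 1 \<le> x \<Longrightarrow> \<beta> x = 0" "continuous_on UNIV \<beta>"
    using smooth_step by metis
  define \<phi> where "\<phi> n t = step (real (Suc n) * (t - r)) - step (real (Suc n) * (t - s))" for n t
  define \<phi>' where "\<phi>' n t = real (Suc n) * \<beta> (real (Suc n) * (t - r)) - real (Suc n) * \<beta> (real (Suc n) * (t - s))" for n t
  have D: "(\<phi> n has_real_derivative \<phi>' n t) (at t)" for n t
    unfolding \<phi>_def \<phi>'_def mult.commute[of "real (Suc n)" "\<beta> _"]
    by (intro DERIV_diff DERIV_chain2[OF st(6)]) (auto intro!: derivative_eq_intros)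
  have sm: "smooth (\<phi> n)" for n
    unfolding smooth_def
  proof
    fix k
    have "Ck k step" using st(1) by (simp add: smooth_def)
    from Ck_compose_affine[OF this, of "real (Suc n)" "- (real (Suc n) * r)"]
      Ck_mult[OF Ck_const[of k "-1"] Ck_compose_affine[OF this, of "real (Suc n)" "- (real (Suc n) * s)"]]
    show "Ck k (\<phi> n)"
      unfolding \<phi>_def using Ck_add by (fastforce simp: right_diff_distrib)
  qed
  \<comment> \<open>The second step is completed only after s, so the support needs room up to some
    T1 < T; \<open>large n\<close> says that the transition width fits between s and T1 and between
    r and s.\<close>
  define T1 where "T1 = (s + T) / 2"
  have T1: "s < T1" "T1 < T" using rs by (auto simp: T1_def)
  have "(\<lambda>n. 1 / real (Suc n)) \<longlonglongrightarrow> 0" using LIMSEQ_inverse_real_of_nat by (simp add: inverse_eq_divide)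
  then have "\<forall>\<^sub>F n in sequentially. 1 / real (Suc n) < min (T1 - s) (s - r)"
    using T1 rs by (intro order_tendstoD) auto
  moreover define large where "large n \<longleftrightarrow> 1 / real (Suc n) < min (T1 - s) (s - r)" for n
  ultimately have large: "\<forall>\<^sub>F n in sequentially. large n" by simp
  have supp: "\<phi> n t = 0" "\<phi>' n t = 0" if n: "large n" and t: "t \<notin> {r..T1}" for n t
  proof -
    have "t \<le> r \<and> t \<le> s \<or> 1 \<le> real (Suc n) * (t - r) \<and> 1 \<le> real (Suc n) * (t - s)"
    proof (cases "t < r")
      case False
      then have "1 / real (Suc n) \<le> t - s" using n t by (auto simp: large_def)
      then have "1 \<le> real (Suc n) * (t - s)" by (simp add: field_simps)
      moreover have "real (Suc n) * (t - s) \<le> real (Suc n) * (t - r)"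
        using rs by (intro mult_left_mono) auto
      ultimately show ?thesis by linarith
    qed (use rs in auto)
    then show "\<phi> n t = 0" "\<phi>' n t = 0"
      unfolding \<phi>_def \<phi>'_def
      by (auto simp: st(2,3,8) mult_nonneg_nonpos)
  qed
  have tf: "\<phi> n \<in> test_functions {0<..<T}" if "large n" for n
  proof -
    have "closure {t. \<phi> n t \<noteq> 0} \<subseteq> {r..T1}"
      by (rule closure_minimal) (use supp(1)[OF that] in blast, simp)
    moreover from this have "compact (closure {t. \<phi> n t \<noteq> 0})"
      by (meson bounded_closed_interval bounded_subset closed_closure compact_eq_bounded_closed)
    moreover have "{r..T1} \<subseteq> {0<..<T}" using T1 rs by auto
    ultimately show ?thesis using sm unfolding test_functions_def by blast
  qed
  let ?I = "\<lambda>a n. integral {a..a + 1 / Suc n} (\<lambda>t. (Suc n * \<beta> (Suc n * (t - a))) *\<^sub>R z t)"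
  have lhs: "(LINT t|lebesgue_on {0<..<T}. deriv (\<phi> n) t *\<^sub>R z t) = ?I r n - ?I s n" if n: "large n" for n
  proof -
    have part: "has_bochner_integral (lebesgue_on {0<..<T}) (\<lambda>t. (Suc n * \<beta> (Suc n * (t - a))) *\<^sub>R z t) (?I a n)"
      if a: "a = r \<or> a = s" for a
    proof -
      let ?k = "\<lambda>t. (Suc n * \<beta> (Suc n * (t - a))) *\<^sub>R z t"
      have sub: "{a..a + 1 / Suc n} \<subseteq> {0<..<T}" using a n rs T1 by (auto simp: large_def)
      have "continuous_on {a..a + 1 / Suc n} ?k"
        by (intro continuous_intros continuous_on_compose2[OF st(9)] continuous_on_subset[OF cont sub]) auto
      then have i: "integrable (lebesgue_on {a..a + 1 / Suc n}) ?k"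
        by (rule continuous_imp_integrable_real)
      have z: "?k t = 0" if "t \<notin> {a..a + 1 / Suc n}" for t
      proof -
        have "real (Suc n) * (t - a) \<le> 0 \<or> 1 \<le> real (Suc n) * (t - a)"
        proof (cases "t < a")
          case False
          then have "1 / real (Suc n) \<le> t - a" using that by auto
          then show ?thesis by (simp add: field_simps)
        qed (simp add: mult_nonneg_nonpos)
        then show ?thesis using st(8) by simp
      qed
      have "integrable (lebesgue_on {0<..<T}) ?k"
      proof -
        have "(\<lambda>t. indicat_real {a..a + 1 / Suc n} t *\<^sub>R ?k t) = (\<lambda>t. indicat_real {0<..<T} t *\<^sub>R ?k t)"
          using sub z by (auto simp: indicator_def fun_eq_iff)
        then show ?thesis using i by (simp add: integrable_restrict_space del: scaleR_scaleR)
      qed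
      moreover have "integral\<^sup>L (lebesgue_on {0<..<T}) ?k = ?I a n"
        using integral_lebesgue_on_support[OF sub, of ?k] z i
        by (simp add: lebesgue_integral_eq_integral)
      ultimately show ?thesis by (simp add: has_bochner_integral_iff)
    qed
    have "deriv (\<phi> n) t *\<^sub>R z t = (Suc n * \<beta> (Suc n * (t - r))) *\<^sub>R z t - (Suc n * \<beta> (Suc n * (t - s))) *\<^sub>R z t" for t
      using DERIV_imp_deriv[OF D, of n t] by (simp add: \<phi>'_def scaleR_diff_left)
    then show ?thesis
      using has_bochner_integral_diff[OF part[of r] part[of s]] by (simp add: has_bochner_integral_iff)
  qed
  have c1: "continuous_on {a..a + (T1 - s)} z" if "a = r \<or> a = s" for a
    by (rule continuous_on_subset[OF cont]) (use that rs T1 in auto)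
  have "(\<lambda>n. ?I r n - ?I s n) \<longlonglongrightarrow> z r - z s"
    by (intro tendsto_diff tendsto_average_kernel[where step=step and \<delta>="T1 - s"] c1)
      (use st T1 in auto)
  then have L: "(\<lambda>n. LINT t|lebesgue_on {0<..<T}. deriv (\<phi> n) t *\<^sub>R z t) \<longlonglongrightarrow> z r - z s"
    by (rule Lim_transform_eventually) (use large lhs in \<open>auto elim: eventually_mono\<close>)
  have z'i: "integrable (lebesgue_on {r..T1}) z'"
  proof -
    have "integrable (lebesgue_on {r..<T}) z'" using int rs by simp
    then have "set_integrable lebesgue {r..<T} z'" by (simp add: integrable_restrict_space set_integrable_def)
    then have "set_integrable lebesgue {r..T1} z'" by (rule set_integrable_subset) (use T1 in auto)
    then show ?thesis by (simp add: integrable_restrict_space set_integrable_def)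
  qed
  have rhs: "(LINT t|lebesgue_on {0<..<T}. \<phi> n t *\<^sub>R z' t) = (LINT t|lebesgue_on {r..T1}. \<phi> n t *\<^sub>R z' t)"
    if n: "large n" for n
    by (rule integral_lebesgue_on_support) (use supp(1)[OF n] rs T1 in auto)
  have "(\<lambda>n. LINT t|lebesgue_on {r..T1}. \<phi> n t *\<^sub>R z' t) \<longlonglongrightarrow> (LINT t|lebesgue_on {r..T1}. indicat_real {r<..s} t *\<^sub>R z' t)"
  proof (rule integral_dominated_convergence[where w="\<lambda>t. norm (z' t)"])
    have "continuous_on UNIV (\<phi> n)" for n using sm[of n] Ck_continuous_on unfolding smooth_def by blast
    then have "\<phi> n \<in> borel_measurable (lebesgue_on {r..T1})" for n
      by (intro continuous_imp_measurable_on_sets_lebesgue) (auto intro: continuous_on_subset)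
    then show "(\<lambda>t. \<phi> n t *\<^sub>R z' t) \<in> borel_measurable (lebesgue_on {r..T1})" for n
      using z'i by (intro borel_measurable_scaleR) auto
    show "(\<lambda>t. indicat_real {r<..s} t *\<^sub>R z' t) \<in> borel_measurable (lebesgue_on {r..T1})"
      using z'i by (intro borel_measurable_scaleR borel_measurable_indicator) (use T1 in \<open>auto simp: sets_restrict_space_iff\<close>)
    show "AE t in lebesgue_on {r..T1}. norm (\<phi> n t *\<^sub>R z' t) \<le> norm (z' t)" for n
    proof (rule AE_I2)
      fix t
      have "\<bar>\<phi> n t\<bar> \<le> 1" unfolding \<phi>_def
        using st(4)[of "real (Suc n) * (t - r)"] st(5)[of "real (Suc n) * (t - r)"]
          st(4)[of "real (Suc n) * (t - s)"] st(5)[of "real (Suc n) * (t - s)"] by linarith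
      then show "norm (\<phi> n t *\<^sub>R z' t) \<le> norm (z' t)" by (simp add: mult_left_le_one_le)
    qed
    show "AE t in lebesgue_on {r..T1}. (\<lambda>n. \<phi> n t *\<^sub>R z' t) \<longlonglongrightarrow> indicat_real {r<..s} t *\<^sub>R z' t"
    proof (rule AE_I2, intro tendsto_scaleR tendsto_const)
      fix t
      have *: "(\<lambda>n. step (real (Suc n) * (t - a))) \<longlonglongrightarrow> indicat_real {a<..} t" for a
      proof (cases "a < t")
        case True
        have "(\<lambda>n. 1 / real (Suc n)) \<longlonglongrightarrow> 0" using LIMSEQ_inverse_real_of_nat by (simp add: inverse_eq_divide)
        then have "\<forall>\<^sub>F n in sequentially. 1 / real (Suc n) < t - a" using True by (intro order_tendstoD) auto
        then have "\<forall>\<^sub>F n in sequentially. step (real (Suc n) * (t - a)) = 1"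
          by eventually_elim (rule st(3), simp add: field_simps)
        then show ?thesis using True by (auto intro: tendsto_eventually)
      next
        case False
        then have "step (real (Suc n) * (t - a)) = 0" for n by (intro st(2)) (simp add: mult_nonneg_nonpos)
        then show ?thesis using False by simp
      qed
      have "(\<lambda>n. \<phi> n t) \<longlonglongrightarrow> indicat_real {r<..} t - indicat_real {s<..} t"
        unfolding \<phi>_def by (intro tendsto_diff *)
      moreover have "indicat_real {r<..} t - indicat_real {s<..} t = indicat_real {r<..s} t"
        using rs by (auto simp: indicator_def)
      ultimately show "(\<lambda>n. \<phi> n t) \<longlonglongrightarrow> indicat_real {r<..s} t" by simp
    qed
  qed (use z'i in auto)
  then have R: "(\<lambda>n. - (LINT t|lebesgue_on {0<..<T}. \<phi> n t *\<^sub>R z' t)) \<longlonglongrightarrow> - (LINT t|lebesgue_on {r..T1}. indicat_real {r<..s} t *\<^sub>R z' t)"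
    by (intro tendsto_minus) (rule Lim_transform_eventually, assumption, use large rhs in \<open>auto elim: eventually_mono\<close>)
  have "\<forall>\<^sub>F n in sequentially. (LINT t|lebesgue_on {0<..<T}. deriv (\<phi> n) t *\<^sub>R z t) = - (LINT t|lebesgue_on {0<..<T}. \<phi> n t *\<^sub>R z' t)"
    using large by eventually_elim (use wd tf in \<open>auto simp: weak_deriv_on_def\<close>)
  then have "(\<lambda>n. - (LINT t|lebesgue_on {0<..<T}. \<phi> n t *\<^sub>R z' t)) \<longlonglongrightarrow> z r - z s"
    using L by (rule Lim_transform_eventually[rotated])
  then have "z r - z s = - (LINT t|lebesgue_on {r..T1}. indicat_real {r<..s} t *\<^sub>R z' t)"
    using R LIMSEQ_unique by blast
  also have "(LINT t|lebesgue_on {r..T1}. indicat_real {r<..s} t *\<^sub>R z' t)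
      = (LINT t|lebesgue_on {r<..s}. indicat_real {r<..s} t *\<^sub>R z' t)"
    by (rule integral_lebesgue_on_support) (use T1 in auto)
  also have "\<dots> = (LINT t|lebesgue_on {r<..s}. z' t)"
    by (rule Bochner_Integration.integral_cong) auto
  also have "\<dots> = integral {r<..s} z'"
  proof (rule lebesgue_integral_eq_integral)
    have "set_integrable lebesgue {r..T1} z'" using z'i by (simp add: integrable_restrict_space set_integrable_def)
    then have "set_integrable lebesgue {r<..s} z'" by (rule set_integrable_subset) (use T1 in auto)
    then show "integrable (lebesgue_on {r<..s}) z'" by (simp add: integrable_restrict_space set_integrable_def)
  qed simp
  also have "\<dots> = integral {r..s} z'"
    by (rule integral_spike_set) (auto intro: negligible_subset[of "{r}"])
  finally show ?thesis by (simp add: algebra_simps)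
qed

lemma L2_restrict_integrable:
  fixes f :: "'a::euclidean_space \<Rightarrow> 'b::euclidean_space"
  assumes f: "f \<in> L2 S" and S: "S \<in> sets lebesgue"
  shows "integrable (lebesgue_on (cbox p q)) (\<lambda>x. if x \<in> S then f x else 0)"
proof -
  have m: "(\<lambda>x. if x \<in> S then f x else 0) \<in> borel_measurable lebesgue"
    using f S by (simp add: L2_def borel_measurable_if)
  have "integrable lebesgue (\<lambda>x. indicat_real S x *\<^sub>R (norm (f x))\<^sup>2)"
    using f S by (simp add: L2_def integrable_restrict_space)
  then have sq: "integrable lebesgue (\<lambda>x. indicat_real (cbox p q) x * (indicat_real S x * (norm (f x))\<^sup>2))"
    using integrable_mult_indicator[of "cbox p q" lebesgue "\<lambda>x. indicat_real S x * (norm (f x))\<^sup>2"] by simp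
  show ?thesis
  proof (rule Bochner_Integration.integrable_bound)
    show "integrable (lebesgue_on (cbox p q)) (\<lambda>x. 1 + indicat_real S x * (norm (f x))\<^sup>2)"
      using sq continuous_imp_integrable[of p q "\<lambda>_. 1::real"]
      by (intro Bochner_Integration.integrable_add) (auto simp: integrable_restrict_space)
    show "(\<lambda>x. if x \<in> S then f x else 0) \<in> borel_measurable (lebesgue_on (cbox p q))"
      using m by (rule measurable_restrict_space1)
    show "AE x in lebesgue_on (cbox p q). norm (if x \<in> S then f x else 0) \<le> norm (1 + indicat_real S x * (norm (f x))\<^sup>2)"
    proof (rule AE_I2)
      fix x show "norm (if x \<in> S then f x else 0) \<le> norm (1 + indicat_real S x * (norm (f x))\<^sup>2)"
        using zero_le_power2[of "norm (f x) - 1"] by (simp add: power2_diff) (use norm_ge_zero[of "f x"] in linarith)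
    qed
  qed
qed

text \<open>The fundamental lemma of the calculus of variations. Products of smooth steps in the
  coordinates converge boundedly to the indicator of an open box, so \<open>f\<close> has integral
  zero over every closed box inside \<Omega>; Lebesgue differentiation along small cubes then gives
  f = 0 almost everywhere.\<close>

lemma test_functions_separate_points:
  fixes f :: "real^'n \<Rightarrow> 'b::euclidean_space"
  assumes f: "f \<in> L2 \<Omega>" and \<Omega>: "open \<Omega>"
    and orth: "\<And>\<Phi>. \<Phi> \<in> test_functions \<Omega> \<Longrightarrow> l2_inner \<Omega> f \<Phi> = 0"
  shows "AE x in lebesgue_on \<Omega>. f x = 0"
proof -
  have \<Omega>m: "\<Omega> \<in> sets lebesgue" using \<Omega> by auto
  define f0 where "f0 x = (if x \<in> \<Omega> then f x else 0)" for x
  have f0i: "integrable (lebesgue_on (cbox p q)) f0" for p q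
    unfolding f0_def[abs_def] by (rule L2_restrict_integrable[OF f \<Omega>m])
  have f0i': "f0 integrable_on cbox p q" for p q
    using f0i[of p q] by (rule integrable_on_lebesgue_on) simp
  obtain step \<beta> :: "real \<Rightarrow> real" where st: "smooth step" "\<And>x. x \<le> 0 \<Longrightarrow> step x = 0" "\<And>x. 1 \<le> x \<Longrightarrow> step x = 1"
    "\<And>x. 0 \<le> step x" "\<And>x. step x \<le> 1"
    using smooth_step by metis
  have zero: "integral (cbox a c) f0 = 0" if sub: "cbox a c \<subseteq> \<Omega>" for a c
  proof -
    define \<phi> where "\<phi> n x = (\<Prod>i\<in>UNIV. step (real (Suc n) * (x $ i - a $ i)) * step (real (Suc n) * (c $ i - x $ i)))" for n x
    have sm: "smooth (\<phi> n)" for n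
      unfolding smooth_def
    proof
      fix k
      have "Ck k step" using st(1) by (simp add: smooth_def)
      from Ck_compose_nth[OF Ck_compose_affine[OF this, of "real (Suc n)" "- (real (Suc n) * (a $ i))" for i]]
        Ck_compose_nth[OF Ck_compose_affine[OF this, of "- real (Suc n)" "(real (Suc n) * (c $ i))" for i]]
      have "Ck k (\<lambda>x::real^'n. step (real (Suc n) * (x $ i - a $ i)))"
        "Ck k (\<lambda>x::real^'n. step (real (Suc n) * (c $ i - x $ i)))" for i
        by (simp_all add: algebra_simps)
      then show "Ck k (\<phi> n)" unfolding \<phi>_def by (intro Ck_prod Ck_mult) auto
    qed
    have supp: "\<phi> n x = 0" if "x \<notin> cbox a c" for n x
    proof -
      have "\<exists>i. x $ i < a $ i \<or> c $ i < x $ i" using that by (auto simp: mem_box_cart not_le)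
      then obtain i where "x $ i < a $ i \<or> c $ i < x $ i" by blast
      then have "step (real (Suc n) * (x $ i - a $ i)) * step (real (Suc n) * (c $ i - x $ i)) = 0"
        using st(2) by (auto simp: mult_nonneg_nonpos)
      then show ?thesis unfolding \<phi>_def by (intro prod_zero) auto
    qed
    have bd: "\<bar>\<phi> n x\<bar> \<le> 1" for n x
      unfolding \<phi>_def abs_prod using st(4,5) by (intro prod_le_1) (auto simp: abs_mult intro!: mult_le_one)
    have lim: "(\<lambda>n. \<phi> n x) \<longlonglongrightarrow> indicat_real (box a c) x" for x
    proof (cases "x \<in> box a c")
      case True
      have one: "(\<lambda>n. step (real (Suc n) * t)) \<longlonglongrightarrow> 1" if "0 < t" for t
      proof -
        have "(\<lambda>n. 1 / real (Suc n)) \<longlonglongrightarrow> 0" using LIMSEQ_inverse_real_of_nat by (simp add: inverse_eq_divide)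
        then have "\<forall>\<^sub>F n in sequentially. 1 / real (Suc n) < t" using that by (intro order_tendstoD) auto
        then have "\<forall>\<^sub>F n in sequentially. step (real (Suc n) * t) = 1"
          by eventually_elim (rule st(3), simp add: field_simps)
        then show ?thesis by (rule tendsto_eventually)
      qed
      have "(\<lambda>n. \<phi> n x) \<longlonglongrightarrow> (\<Prod>i\<in>(UNIV::'n set). 1 * 1)"
        unfolding \<phi>_def using True by (intro tendsto_prod tendsto_mult one) (auto simp: mem_box_cart)
      then show ?thesis using True by simp
    next
      case False
      then have "\<exists>i. x $ i \<le> a $ i \<or> c $ i \<le> x $ i" by (auto simp: mem_box_cart not_less)
      then obtain i where "x $ i \<le> a $ i \<or> c $ i \<le> x $ i" by blast
      then have "step (real (Suc n) * (x $ i - a $ i)) * step (real (Suc n) * (c $ i - x $ i)) = 0" for n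
        using st(2) by (auto simp: mult_nonneg_nonpos)
      then have "\<phi> n x = 0" for n unfolding \<phi>_def by (intro prod_zero) auto
      then show ?thesis using False by simp
    qed
    have "integral (cbox a c) f0 \<bullet> b = 0" if b: "b \<in> Basis" for b
    proof -
      have "(\<lambda>x. \<phi> n x *\<^sub>R b) \<in> test_functions \<Omega>" for n
      proof -
        have "closure {x. \<phi> n x *\<^sub>R b \<noteq> 0} \<subseteq> cbox a c"
          by (rule closure_minimal) (use supp in auto)
        moreover from this have "compact (closure {x. \<phi> n x *\<^sub>R b \<noteq> 0})"
          by (meson bounded_cbox bounded_subset closed_closure compact_eq_bounded_closed)
        moreover have "smooth (\<lambda>x. \<phi> n x *\<^sub>R b)"
          by (rule smooth_scaleR[OF sm]) (simp add: smooth_def)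
        ultimately show ?thesis using sub unfolding test_functions_def by blast
      qed
      from orth[OF this] have 0: "(LINT x|lebesgue_on \<Omega>. f x \<bullet> (\<phi> n x *\<^sub>R b)) = 0" for n
        by (simp add: l2_inner_def)
      have 1: "(LINT x|lebesgue_on (cbox a c). \<phi> n x *\<^sub>R (f0 x \<bullet> b)) = 0" for n
      proof -
        have "(LINT x|lebesgue_on \<Omega>. f x \<bullet> (\<phi> n x *\<^sub>R b)) = (LINT x|lebesgue_on (cbox a c). f x \<bullet> (\<phi> n x *\<^sub>R b))"
          by (rule integral_lebesgue_on_support[OF sub]) (use \<Omega>m supp in auto)
        also have "\<dots> = (LINT x|lebesgue_on (cbox a c). \<phi> n x *\<^sub>R (f0 x \<bullet> b))"
          by (rule Bochner_Integration.integral_cong) (use sub in \<open>auto simp: f0_def\<close>)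
        finally show ?thesis using 0 by simp
      qed
      have fb: "integrable (lebesgue_on (cbox a c)) (\<lambda>x. f0 x \<bullet> b)" using f0i by simp
      have "(\<lambda>n. LINT x|lebesgue_on (cbox a c). \<phi> n x *\<^sub>R (f0 x \<bullet> b))
        \<longlonglongrightarrow> (LINT x|lebesgue_on (cbox a c). indicat_real (box a c) x *\<^sub>R (f0 x \<bullet> b))"
      proof (rule integral_dominated_convergence[where w="\<lambda>x. norm (f0 x \<bullet> b)"])
        have "continuous_on UNIV (\<phi> n)" for n using sm[of n] Ck_continuous_on unfolding smooth_def by blast
        then have "\<phi> n \<in> borel_measurable (lebesgue_on (cbox a c))" for n
          by (intro continuous_imp_measurable_on_sets_lebesgue) (auto intro: continuous_on_subset)
        then show "(\<lambda>x. \<phi> n x *\<^sub>R (f0 x \<bullet> b)) \<in> borel_measurable (lebesgue_on (cbox a c))" for n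
          using fb by (intro borel_measurable_scaleR) auto
        show "(\<lambda>x. indicat_real (box a c) x *\<^sub>R (f0 x \<bullet> b)) \<in> borel_measurable (lebesgue_on (cbox a c))"
          using fb by (intro borel_measurable_scaleR borel_measurable_indicator)
            (use box_subset_cbox[of a c] in \<open>auto simp: sets_restrict_space_iff\<close>)
        show "AE x in lebesgue_on (cbox a c). (\<lambda>n. \<phi> n x *\<^sub>R (f0 x \<bullet> b)) \<longlonglongrightarrow> indicat_real (box a c) x *\<^sub>R (f0 x \<bullet> b)"
          by (intro AE_I2 tendsto_scaleR tendsto_const lim)
        show "AE x in lebesgue_on (cbox a c). norm (\<phi> n x *\<^sub>R (f0 x \<bullet> b)) \<le> norm (f0 x \<bullet> b)" for n
          using bd by (intro AE_I2) (auto simp: abs_mult mult_left_le_one_le)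
      qed (use fb in auto)
      then have "(LINT x|lebesgue_on (cbox a c). indicat_real (box a c) x *\<^sub>R (f0 x \<bullet> b)) = 0"
        unfolding 1 using LIMSEQ_unique by blast
      moreover have "(LINT x|lebesgue_on (cbox a c). indicat_real (box a c) x *\<^sub>R (f0 x \<bullet> b))
          = (LINT x|lebesgue_on (box a c). indicat_real (box a c) x *\<^sub>R (f0 x \<bullet> b))"
        by (rule integral_lebesgue_on_support) (use box_subset_cbox in auto)
      moreover have "\<dots> = (LINT x|lebesgue_on (box a c). f0 x \<bullet> b)"
        by (rule Bochner_Integration.integral_cong) auto
      moreover have "\<dots> = integral (box a c) (\<lambda>x. f0 x \<bullet> b)"
      proof (rule lebesgue_integral_eq_integral)
        have "set_integrable lebesgue (cbox a c) (\<lambda>x. f0 x \<bullet> b)" using fb by (simp add: integrable_restrict_space set_integrable_def)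
        then have "set_integrable lebesgue (box a c) (\<lambda>x. f0 x \<bullet> b)" by (rule set_integrable_subset) (use box_subset_cbox in auto)
        then show "integrable (lebesgue_on (box a c)) (\<lambda>x. f0 x \<bullet> b)" by (simp add: integrable_restrict_space set_integrable_def)
      qed simp
      moreover have "\<dots> = integral (cbox a c) (\<lambda>x. f0 x \<bullet> b)"
        by (rule integral_open_interval)
      moreover have "integral (cbox a c) (\<lambda>x. f0 x \<bullet> b) = integral (cbox a c) f0 \<bullet> b"
        using integral_linear[OF f0i' bounded_linear_inner_left[of b], of a c] by (simp add: o_def)
      ultimately show ?thesis by simp
    qed
    then show ?thesis using euclidean_all_zero_iff by blast
  qed
  obtain N where N: "negligible N" "\<And>x e. \<lbrakk>x \<notin> N; 0 < e\<rbrakk> \<Longrightarrow>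
     \<exists>d>0. \<forall>h. 0 < h \<and> h < d \<longrightarrow> norm(integral (cbox x (x + h *\<^sub>R One)) f0 /\<^sub>R h ^ DIM(real^'n) - f0 x) < e"
    using integrable_ccontinuous_explicit[of f0] f0i' by metis
  have "f x = 0" if x: "x \<in> \<Omega> - N" for x
  proof (rule ccontr)
    assume "f x \<noteq> 0"
    then have "0 < norm (f0 x)" using x by (simp add: f0_def)
    then obtain d where d: "0 < d" "\<And>h. \<lbrakk>0 < h; h < d\<rbrakk> \<Longrightarrow> norm(integral (cbox x (x + h *\<^sub>R One)) f0 /\<^sub>R h ^ DIM(real^'n) - f0 x) < norm (f0 x)"
      using N(2)[of x "norm (f0 x)"] x by blast
    obtain r where r: "0 < r" "cball x r \<subseteq> \<Omega>" using \<Omega> x open_contains_cball by blast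
    \<comment> \<open>The cube has its corner at x and its points have l1 distance at most the
      dimension times h from x; dividing r by the dimension keeps the cube inside the ball.\<close>
    define h where "h = min (d / 2) (r / DIM(real^'n))"
    have "0 < real DIM(real^'n)" by (simp only: of_nat_0_less_iff DIM_positive)
    then have h: "0 < h" "h < d" "h * DIM(real^'n) \<le> r" using d(1) r(1)
      by (auto simp: h_def min_def field_simps)
    have "cbox x (x + h *\<^sub>R One) \<subseteq> cball x r"
    proof
      fix y assume y: "y \<in> cbox x (x + h *\<^sub>R One)"
      have "norm (y - x) \<le> (\<Sum>b\<in>Basis. \<bar>(y - x) \<bullet> b\<bar>)" by (rule norm_le_l1)
      also have "\<dots> \<le> (\<Sum>b\<in>(Basis::(real^'n) set). h)"
      proof (rule sum_mono)
        fix b :: "real^'n" assume b: "b \<in> Basis"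
        have "x \<bullet> b \<le> y \<bullet> b" "y \<bullet> b \<le> (x + h *\<^sub>R One) \<bullet> b" using y b unfolding mem_box by blast+
        moreover have "One \<bullet> b = 1" using b by (rule inner_sum_Basis)
        ultimately show "\<bar>(y - x) \<bullet> b\<bar> \<le> h" by (simp add: inner_simps)
      qed
      finally show "y \<in> cball x r" using h(3) by (simp add: dist_norm norm_minus_commute mult.commute)
    qed
    then have "integral (cbox x (x + h *\<^sub>R One)) f0 = 0" using r(2) by (intro zero) blast
    then show False using d(2)[OF h(1,2)] by simp
  qed
  then have "AE x in lebesgue. x \<in> \<Omega> \<longrightarrow> f x = 0"
    using N(1) by (intro AE_I'[of N]) (auto simp: negligible_iff_null_sets)
  then show ?thesis using \<Omega>m by (simp add: AE_restrict_space_iff)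
qed

section \<open>Square-integrable fields\<close>

lemma L2_measurable [measurable_dest]: "f \<in> L2 S \<Longrightarrow> f \<in> borel_measurable (lebesgue_on S)"
  by (simp add: L2_def)

lemma L2_integrable_inner:
  assumes "f \<in> L2 S" "g \<in> L2 S"
  shows "integrable (lebesgue_on S) (\<lambda>x. f x \<bullet> g x)"
proof (rule Bochner_Integration.integrable_bound)
  show "integrable (lebesgue_on S) (\<lambda>x. (norm (f x))\<^sup>2 + (norm (g x))\<^sup>2)"
    using assms by (simp add: L2_def)
  show "AE x in lebesgue_on S. norm (f x \<bullet> g x) \<le> norm ((norm (f x))\<^sup>2 + (norm (g x))\<^sup>2)"
  proof (rule AE_I2)
    fix x
    have "\<bar>f x \<bullet> g x\<bar> \<le> norm (f x) * norm (g x)" by (rule Cauchy_Schwarz_ineq2)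
    also have "\<dots> \<le> (norm (f x))\<^sup>2 + (norm (g x))\<^sup>2"
      using sum_squares_bound[of "norm (f x)" "norm (g x)"] mult_nonneg_nonneg[OF norm_ge_zero[of "f x"] norm_ge_zero[of "g x"]] by linarith
    finally show "norm (f x \<bullet> g x) \<le> norm ((norm (f x))\<^sup>2 + (norm (g x))\<^sup>2)" by simp
  qed
qed (use assms in measurable)

lemma L2_bound:
  assumes "f \<in> borel_measurable (lebesgue_on S)" "g \<in> L2 S"
    and le: "\<And>x. x \<in> S \<Longrightarrow> norm (f x) \<le> c * norm (g x)"
  shows "f \<in> L2 S"
proof -
  have "integrable (lebesgue_on S) (\<lambda>x. (norm (f x))\<^sup>2)"
  proof (rule Bochner_Integration.integrable_bound)
    show "integrable (lebesgue_on S) (\<lambda>x. c\<^sup>2 * (norm (g x))\<^sup>2)" using assms by (simp add: L2_def)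
    show "AE x in lebesgue_on S. norm ((norm (f x))\<^sup>2) \<le> norm (c\<^sup>2 * (norm (g x))\<^sup>2)"
    proof (rule AE_I2)
      fix x assume "x \<in> space (lebesgue_on S)"
      then have "(norm (f x))\<^sup>2 \<le> (c * norm (g x))\<^sup>2" by (intro power_mono le) auto
      then show "norm ((norm (f x))\<^sup>2) \<le> norm (c\<^sup>2 * (norm (g x))\<^sup>2)" by (simp add: power_mult_distrib)
    qed
  qed (use assms in measurable)
  then show ?thesis using assms by (simp add: L2_def)
qed

lemma L2_add [intro]:
  assumes "f \<in> L2 S" "g \<in> L2 S" shows "(\<lambda>x. f x + g x) \<in> L2 S"
proof -
  have "integrable (lebesgue_on S) (\<lambda>x. (norm (f x))\<^sup>2 + 2 * (f x \<bullet> g x) + (norm (g x))\<^sup>2)"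
    using assms L2_integrable_inner[OF assms] by (simp add: L2_def)
  moreover have "(norm (f x + g x))\<^sup>2 = (norm (f x))\<^sup>2 + 2 * (f x \<bullet> g x) + (norm (g x))\<^sup>2" for x
    by (simp add: power2_norm_eq_inner inner_simps inner_commute)
  ultimately show ?thesis using assms by (simp add: L2_def borel_measurable_add)
qed

lemma L2_scaleR [intro]: "f \<in> L2 S \<Longrightarrow> (\<lambda>x. c *\<^sub>R f x) \<in> L2 S"
  by (simp add: L2_def power_mult_distrib borel_measurable_scaleR)

lemma L2_diff [intro]:
  assumes "f \<in> L2 S" "g \<in> L2 S" shows "(\<lambda>x. f x - g x) \<in> L2 S"
proof -
  have "(\<lambda>x. f x + (-1) *\<^sub>R g x) \<in> L2 S" by (intro L2_add L2_scaleR assms)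
  then show ?thesis by simp
qed

lemma L2_zero [simp]: "(\<lambda>x. 0) \<in> L2 S" by (simp add: L2_def)

lemma L2_integrable_Icc:
  fixes f :: "real \<Rightarrow> 'b::euclidean_space"
  assumes "f \<in> L2 {a..b}"
  shows "integrable (lebesgue_on {a..b}) f"
proof -
  have "integrable (lebesgue_on {a..b}) (\<lambda>_. 1::real)"
    by (rule continuous_imp_integrable_real) simp
  then have i: "integrable (lebesgue_on {a..b}) (\<lambda>s. 1 + (norm (f s))\<^sup>2)"
    using assms by (simp add: L2_def)
  show ?thesis
  proof (rule Bochner_Integration.integrable_bound[OF i])
    show "AE x in lebesgue_on {a..b}. norm (f x) \<le> norm (1 + (norm (f x))\<^sup>2)"
    proof (rule AE_I2)
      fix x show "norm (f x) \<le> norm (1 + (norm (f x))\<^sup>2)"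
        using zero_le_power2[of "norm (f x) - 1"] by (simp add: power2_diff) (use norm_ge_zero[of "f x"] in linarith)
    qed
  qed (rule L2_measurable[OF assms])
qed

lemma l2_inner_commute: "l2_inner S f g = l2_inner S g f"
  by (simp add: l2_inner_def inner_commute)

lemma l2_inner_add_left:
  "f \<in> L2 S \<Longrightarrow> g \<in> L2 S \<Longrightarrow> h \<in> L2 S \<Longrightarrow> l2_inner S (\<lambda>x. f x + g x) h = l2_inner S f h + l2_inner S g h"
  unfolding l2_inner_def by (simp add: inner_add_left L2_integrable_inner)

lemma l2_inner_diff_left:
  "f \<in> L2 S \<Longrightarrow> g \<in> L2 S \<Longrightarrow> h \<in> L2 S \<Longrightarrow> l2_inner S (\<lambda>x. f x - g x) h = l2_inner S f h - l2_inner S g h"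
  unfolding l2_inner_def by (simp add: inner_diff_left L2_integrable_inner)

lemma l2_inner_scaleR_left: "l2_inner S (\<lambda>x. c *\<^sub>R f x) h = c * l2_inner S f h"
  by (simp add: l2_inner_def)

lemma l2_inner_diff_right:
  "f \<in> L2 S \<Longrightarrow> g \<in> L2 S \<Longrightarrow> h \<in> L2 S \<Longrightarrow> l2_inner S h (\<lambda>x. f x - g x) = l2_inner S h f - l2_inner S h g"
  by (simp add: l2_inner_commute[of S h] l2_inner_diff_left)

lemma l2_norm_nonneg [simp]: "0 \<le> l2_norm S f"
  by (simp add: l2_norm_def)

lemma l2_norm_power2: "(l2_norm S f)\<^sup>2 = l2_inner S f f"
  by (simp add: l2_norm_def l2_inner_def power2_norm_eq_inner)

lemma l2_norm_zero [simp]: "l2_norm S (\<lambda>x. 0) = 0" by (simp add: l2_norm_def)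

lemma l2_norm_scaleR: "l2_norm S (\<lambda>x. c *\<^sub>R f x) = \<bar>c\<bar> * l2_norm S f"
  by (simp add: l2_norm_def power_mult_distrib real_sqrt_mult)

lemma l2_norm_minus_commute: "l2_norm S (\<lambda>x. f x - g x) = l2_norm S (\<lambda>x. g x - f x)"
  by (simp add: l2_norm_def norm_minus_commute)

lemma l2_norm_cong_AE:
  assumes "AE x in lebesgue_on S. f x = g x" "f \<in> L2 S" "g \<in> L2 S"
  shows "l2_norm S f = l2_norm S g"
proof -
  note [measurable] = L2_measurable[OF assms(2)] L2_measurable[OF assms(3)]
  have "(LINT x|lebesgue_on S. (norm (f x))\<^sup>2) = (LINT x|lebesgue_on S. (norm (g x))\<^sup>2)"
    by (rule integral_cong_AE, measurable) (use assms(1) in \<open>eventually_elim, simp\<close>)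
  then show ?thesis by (simp add: l2_norm_def)
qed

lemma l2_Cauchy_Schwarz:
  assumes f: "f \<in> L2 S" and g: "g \<in> L2 S"
  shows "\<bar>l2_inner S f g\<bar> \<le> l2_norm S f * l2_norm S g"
proof -
  have q: "0 \<le> (l2_norm S f)\<^sup>2 + 2 * t * l2_inner S f g + t\<^sup>2 * (l2_norm S g)\<^sup>2" for t
  proof -
    let ?h = "\<lambda>x. f x + t *\<^sub>R g x"
    have h: "?h \<in> L2 S" using f g by auto
    have "0 \<le> (l2_norm S ?h)\<^sup>2" by simp
    also have "\<dots> = l2_inner S f ?h + t * l2_inner S g ?h"
      unfolding l2_norm_power2 using f g h by (subst l2_inner_add_left) (auto simp: l2_inner_scaleR_left)
    also have "l2_inner S f ?h = l2_inner S f f + t * l2_inner S f g"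
      using f g by (subst (1 2 3) l2_inner_commute[of S f]) (simp add: l2_inner_add_left l2_inner_scaleR_left L2_scaleR)
    also have "l2_inner S g ?h = l2_inner S f g + t * l2_inner S g g"
      using f g by (subst l2_inner_commute) (simp add: l2_inner_add_left l2_inner_scaleR_left L2_scaleR)
    finally show ?thesis unfolding l2_norm_power2 by (simp add: power2_eq_square algebra_simps)
  qed
  define a b c where "a = (l2_norm S f)\<^sup>2" and "b = l2_inner S f g" and "c = (l2_norm S g)\<^sup>2"
  have "b\<^sup>2 \<le> a * c"
  proof (cases "c = 0")
    case True
    have "b = 0"
    proof (rule ccontr)
      assume "b \<noteq> 0"
      \<comment> \<open>For c = 0 the quadratic in t is affine, and this t would give it the value
        -1.\<close>
      have "0 \<le> a + 2 * (- (a + 1) / (2 * b)) * b" using q[of "- (a + 1) / (2 * b)"] True unfolding a_def b_def c_def by simp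
      then show False using \<open>b \<noteq> 0\<close> by (simp add: field_simps)
    qed
    then show ?thesis using True by simp
  next
    case False
    then have "0 < c" by (simp add: c_def)
    have "0 \<le> a + 2 * (- b / c) * b + (- b / c)\<^sup>2 * c" using q unfolding a_def b_def c_def by blast
    also have "\<dots> = a - b\<^sup>2 / c" using False by (simp add: field_simps power2_eq_square)
    finally show ?thesis using \<open>0 < c\<close> by (simp add: field_simps)
  qed
  then have "sqrt (b\<^sup>2) \<le> sqrt (a * c)" by (rule real_sqrt_le_mono)
  then show ?thesis by (simp add: a_def b_def c_def real_sqrt_mult)
qed

lemma l2_norm_triangle:
  assumes f: "f \<in> L2 S" and g: "g \<in> L2 S"
  shows "l2_norm S (\<lambda>x. f x + g x) \<le> l2_norm S f + l2_norm S g"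
proof (rule power2_le_imp_le)
  have h: "(\<lambda>x. f x + g x) \<in> L2 S" using f g by auto
  have "(l2_norm S (\<lambda>x. f x + g x))\<^sup>2 = l2_inner S f (\<lambda>x. f x + g x) + l2_inner S g (\<lambda>x. f x + g x)"
    unfolding l2_norm_power2 using f g h by (subst l2_inner_add_left) auto
  also have "\<dots> = (l2_norm S f)\<^sup>2 + 2 * l2_inner S f g + (l2_norm S g)\<^sup>2"
    unfolding l2_norm_power2 l2_inner_commute[of S _ "\<lambda>x. f x + g x"]
    using f g by (simp add: l2_inner_add_left l2_inner_commute[of S g f])
  also have "\<dots> \<le> (l2_norm S f + l2_norm S g)\<^sup>2"
    using l2_Cauchy_Schwarz[OF f g] by (simp add: power2_sum)
  finally show "(l2_norm S (\<lambda>x. f x + g x))\<^sup>2 \<le> (l2_norm S f + l2_norm S g)\<^sup>2" .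
qed simp

lemma l2_norm_triangle_diff:
  assumes "f \<in> L2 S" "g \<in> L2 S" "h \<in> L2 S"
  shows "l2_norm S (\<lambda>x. f x - h x) \<le> l2_norm S (\<lambda>x. f x - g x) + l2_norm S (\<lambda>x. g x - h x)"
  using l2_norm_triangle[of "\<lambda>x. f x - g x" S "\<lambda>x. g x - h x"] assms by (simp add: L2_diff)

lemma l2_norm_diff_abs:
  assumes "f \<in> L2 S" "g \<in> L2 S"
  shows "\<bar>l2_norm S f - l2_norm S g\<bar> \<le> l2_norm S (\<lambda>x. f x - g x)"
  using l2_norm_triangle[of "\<lambda>x. f x - g x" S g] l2_norm_triangle[of "\<lambda>x. g x - f x" S f] assms
    l2_norm_minus_commute[of S f g] by (simp add: L2_diff abs_le_iff)

lemma l2_norm_zero_AE: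
  assumes "f \<in> L2 S" "l2_norm S f = 0"
  shows "AE x in lebesgue_on S. f x = 0"
proof -
  have "AE x in lebesgue_on S. (norm (f x))\<^sup>2 = 0"
    using assms by (subst integral_nonneg_eq_0_iff_AE[symmetric]) (auto simp: L2_def l2_norm_def)
  then show ?thesis by simp
qed

lemma l2_norm_tendsto:
  assumes "\<And>n. f n \<in> L2 S" "g \<in> L2 S" "(\<lambda>n. l2_norm S (\<lambda>x. f n x - g x)) \<longlonglongrightarrow> 0"
  shows "(\<lambda>n. l2_norm S (f n)) \<longlonglongrightarrow> l2_norm S g"
proof -
  have "(\<lambda>n. l2_norm S (f n) - l2_norm S g) \<longlonglongrightarrow> 0"
    by (rule Lim_null_comparison[OF _ assms(3)]) (simp add: l2_norm_diff_abs assms(1,2))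
  then show ?thesis by (simp add: LIM_zero_iff)
qed

lemma l2_inner_tendsto:
  assumes "\<And>n. f n \<in> L2 S" "g \<in> L2 S" "h \<in> L2 S" "(\<lambda>n. l2_norm S (\<lambda>x. f n x - g x)) \<longlonglongrightarrow> 0"
  shows "(\<lambda>n. l2_inner S h (f n)) \<longlonglongrightarrow> l2_inner S h g"
proof -
  have "(\<lambda>n. l2_inner S h (f n) - l2_inner S h g) \<longlonglongrightarrow> 0"
  proof (rule Lim_null_comparison)
    show "(\<lambda>n. l2_norm S h * l2_norm S (\<lambda>x. f n x - g x)) \<longlonglongrightarrow> 0"
      using tendsto_mult[OF tendsto_const assms(4), of "l2_norm S h"] by simp
    show "\<forall>\<^sub>F n in sequentially. norm (l2_inner S h (f n) - l2_inner S h g) \<le> l2_norm S h * l2_norm S (\<lambda>x. f n x - g x)"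
    proof (intro always_eventually allI)
      fix n
      have "l2_inner S h (f n) - l2_inner S h g = l2_inner S h (\<lambda>x. f n x - g x)"
        using assms by (simp add: l2_inner_diff_right)
      then show "norm (l2_inner S h (f n) - l2_inner S h g) \<le> l2_norm S h * l2_norm S (\<lambda>x. f n x - g x)"
        using l2_Cauchy_Schwarz[of h S "\<lambda>x. f n x - g x"] assms by (simp add: L2_diff)
    qed
  qed
  then show ?thesis by (simp add: LIM_zero_iff)
qed

lemma XS_L2: "F \<in> XS \<Omega> \<Omega>C \<Longrightarrow> F \<in> L2 \<Omega>"
  by (simp add: XS_def)

lemma weak_grad_L2:
  assumes "\<psi> \<in> H10 \<Omega>" shows "weak_grad \<Omega> \<psi> \<in> L2 \<Omega>"
proof -
  have "\<exists>g. is_weak_grad \<Omega> \<psi> g" using assms by (simp add: H10_def)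
  then have "is_weak_grad \<Omega> \<psi> (weak_grad \<Omega> \<psi>)" unfolding weak_grad_def by (rule someI_ex)
  then show ?thesis by (simp add: is_weak_grad_def)
qed

lemma XS_diff [intro]: "F \<in> XS \<Omega> \<Omega>C \<Longrightarrow> G \<in> XS \<Omega> \<Omega>C \<Longrightarrow> (\<lambda>x. F x - G x) \<in> XS \<Omega> \<Omega>C"
  unfolding XS_def by (simp add: L2_diff l2_inner_diff_left weak_grad_L2)

lemma XS_scaleR [intro]: "F \<in> XS \<Omega> \<Omega>C \<Longrightarrow> (\<lambda>x. c *\<^sub>R F x) \<in> XS \<Omega> \<Omega>C"
  unfolding XS_def by (simp add: L2_scaleR l2_inner_scaleR_left)

lemma XS_zero [simp]: "(\<lambda>x. 0) \<in> XS \<Omega> \<Omega>C"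
  unfolding XS_def by (simp add: l2_inner_def)

text \<open>Setting everything to zero on the exceptional null set makes the convergence pointwise;
  completeness of Lebesgue measure then allows the values of \<open>g\<close> there to be
  restored.\<close>

lemma borel_measurable_AE_limit:
  fixes u :: "nat \<Rightarrow> 'a::euclidean_space \<Rightarrow> 'b::euclidean_space"
  assumes u: "\<And>n. u n \<in> borel_measurable (lebesgue_on J)" and J: "J \<in> sets lebesgue"
    and lim: "AE t in lebesgue_on J. (\<lambda>n. u n t) \<longlonglongrightarrow> g t"
  shows "g \<in> borel_measurable (lebesgue_on J)"
proof -
  obtain N where N: "negligible N" "\<And>t. t \<in> J - N \<Longrightarrow> (\<lambda>n. u n t) \<longlonglongrightarrow> g t"
    using AE_lebesgue_on_negligible[OF lim J] by blast
  have Nm: "N \<in> sets lebesgue" using N(1) by (simp add: negligible_imp_sets)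
  have "(\<lambda>t. indicat_real (J - N) t *\<^sub>R g t) \<in> borel_measurable lebesgue"
  proof (rule borel_measurable_LIMSEQ_metric)
    fix n
    have "(\<lambda>t. indicat_real J t *\<^sub>R u n t) \<in> borel_measurable lebesgue"
      using u[of n] J by (simp add: borel_measurable_restrict_space_iff)
    then have "(\<lambda>t. indicat_real (- N) t *\<^sub>R (indicat_real J t *\<^sub>R u n t)) \<in> borel_measurable lebesgue"
      using Nm by (intro borel_measurable_scaleR[of "indicat_real (- N)"] borel_measurable_indicator) (auto simp: Compl_in_sets_lebesgue)
    moreover have "(\<lambda>t. indicat_real (- N) t *\<^sub>R (indicat_real J t *\<^sub>R u n t)) = (\<lambda>t. indicat_real (J - N) t *\<^sub>R u n t)"
      by (auto simp: indicator_def fun_eq_iff)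
    ultimately show "(\<lambda>t. indicat_real (J - N) t *\<^sub>R u n t) \<in> borel_measurable lebesgue" by simp
  next
    fix t show "(\<lambda>n. indicat_real (J - N) t *\<^sub>R u n t) \<longlonglongrightarrow> indicat_real (J - N) t *\<^sub>R g t"
      using N(2)[of t] by (cases "t \<in> J - N") auto
  qed
  then have "(\<lambda>t. indicat_real J t *\<^sub>R g t) \<in> borel_measurable lebesgue"
  proof (rule borel_measurable_AE)
    have "AE t in lebesgue. t \<notin> N" using N(1) by (intro AE_not_in) (simp add: negligible_iff_null_sets)
    then show "AE t in lebesgue. indicat_real (J - N) t *\<^sub>R g t = indicat_real J t *\<^sub>R g t"
      by eventually_elim (simp add: indicator_def)
  qed
  then show ?thesis using J by (simp add: borel_measurable_restrict_space_iff)
qed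

text \<open>Along the approximating simple functions \<Phi> takes finitely many values, and
  sequential continuity with respect to \<open>N\<close> passes measurability to the limit. Norms,
  pairings and energies all become measurable functions of time in this way.\<close>

lemma bochner_measurable_compose:
  fixes \<Phi> :: "('a \<Rightarrow> 'b::real_normed_vector) \<Rightarrow> 'c::euclidean_space"
  assumes f: "bochner_measurable J V N f" and J: "J \<in> sets lebesgue"
    and cont: "\<And>s g. \<lbrakk>\<And>n. s n \<in> V; g \<in> V; (\<lambda>n. N (\<lambda>x. s n x - g x)) \<longlonglongrightarrow> 0\<rbrakk> \<Longrightarrow> (\<lambda>n. \<Phi> (s n)) \<longlonglongrightarrow> \<Phi> g"
  shows "(\<lambda>t. \<Phi> (f t)) \<in> borel_measurable (lebesgue_on J)"
proof -
  obtain s where s: "\<And>n. simple_function (lebesgue_on J) (s n)" "\<And>n. s n ` J \<subseteq> V"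
      "AE t in lebesgue_on J. (\<lambda>n. N (\<lambda>x. s n t x - f t x)) \<longlonglongrightarrow> 0" and fV: "AE t in lebesgue_on J. f t \<in> V"
    using f unfolding bochner_measurable_def by blast
  show ?thesis
  proof (rule borel_measurable_AE_limit[OF _ J])
    show "(\<lambda>t. \<Phi> (s n t)) \<in> borel_measurable (lebesgue_on J)" for n
      using simple_function_compose1[OF s(1)] by (rule borel_measurable_simple_function)
    have "AE t in lebesgue_on J. t \<in> J" using AE_space[of "lebesgue_on J"] by simp
    with s(3) fV show "AE t in lebesgue_on J. (\<lambda>n. \<Phi> (s n t)) \<longlonglongrightarrow> \<Phi> (f t)"
      by eventually_elim (rule cont, use s(2) in auto)
  qed
qed

section \<open>Weak curl and flux\<close>

lemma continuous_compact_support_L2: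
  fixes f :: "'a::euclidean_space \<Rightarrow> 'b::euclidean_space"
  assumes f: "continuous_on UNIV f" and K: "compact K" "\<And>x. x \<notin> K \<Longrightarrow> f x = 0" and S: "S \<in> sets lebesgue"
  shows "f \<in> L2 S"
proof -
  obtain a b where ab: "K \<subseteq> cbox a b"
    using K(1) bounded_subset_cbox_symmetric compact_imp_bounded by metis
  have "continuous_on (cbox a b) (\<lambda>x. (norm (f x))\<^sup>2)"
    by (intro continuous_intros continuous_on_subset[OF f]) auto
  then have "integrable (lebesgue_on (cbox a b)) (\<lambda>x. (norm (f x))\<^sup>2)"
    by (rule continuous_imp_integrable)
  then have "integrable lebesgue (\<lambda>x. indicat_real (cbox a b) x *\<^sub>R (norm (f x))\<^sup>2)"
    by (simp add: integrable_restrict_space)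
  moreover have "(\<lambda>x. indicat_real (cbox a b) x *\<^sub>R (norm (f x))\<^sup>2) = (\<lambda>x. (norm (f x))\<^sup>2)"
    using ab K(2) by (intro ext) (auto split: split_indicator)
  ultimately have "integrable lebesgue (\<lambda>x. (norm (f x))\<^sup>2)" by simp
  then have "integrable (lebesgue_on S) (\<lambda>x. (norm (f x))\<^sup>2)"
    using integrable_mult_indicator[of S lebesgue "\<lambda>x. (norm (f x))\<^sup>2"] S by (simp add: integrable_restrict_space)
  moreover have "f \<in> borel_measurable (lebesgue_on S)"
    using continuous_on_subset[OF f] S by (intro continuous_imp_measurable_on_sets_lebesgue) auto
  ultimately show ?thesis by (simp add: L2_def)
qed

lemma test_functions_L2:
  fixes \<Phi> :: "'a::euclidean_space \<Rightarrow> 'b::euclidean_space"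
  assumes "\<Phi> \<in> test_functions \<Omega>" "S \<in> sets lebesgue"
  shows "\<Phi> \<in> L2 S"
proof (rule continuous_compact_support_L2[of _ "closure {x. \<Phi> x \<noteq> 0}"])
  have "Ck 0 \<Phi>" using assms by (simp add: test_functions_def smooth_def del: Ck.simps)
  then show "continuous_on UNIV \<Phi>" by simp
  show "\<Phi> x = 0" if "x \<notin> closure {x. \<Phi> x \<noteq> 0}" for x
    using that closure_subset[of "{x. \<Phi> x \<noteq> 0}"] by auto
qed (use assms in \<open>auto simp: test_functions_def\<close>)

text \<open>Square integrability of \<open>curl \<Phi>\<close> makes pairing with it additive on
  \<open>L2\<close>, as needed when weak curls are subtracted.\<close>

lemma curl_test_functions_L2:
  assumes "\<Phi> \<in> test_functions \<Omega>" "S \<in> sets lebesgue"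
  shows "curl \<Phi> \<in> L2 S"
proof (rule continuous_compact_support_L2[of _ "closure {x. \<Phi> x \<noteq> 0}"])
  have "Ck (Suc 0) \<Phi>" using assms by (simp add: test_functions_def smooth_def del: Ck.simps)
  then have c: "continuous_on UNIV (\<lambda>x. frechet_derivative \<Phi> (at x) (axis i 1))" for i
    by (simp add: axis_in_Basis_iff)
  show "continuous_on UNIV (curl \<Phi>)"
  proof (subst continuous_on_componentwise, intro ballI)
    fix b :: "real^3" assume "b \<in> Basis"
    then obtain i where b: "b = axis i 1" by (auto simp: Basis_vec_def)
    have cc: "continuous_on UNIV (\<lambda>x. frechet_derivative \<Phi> (at x) (axis i 1) $ j)" for i j
      by (intro continuous_intros c)
    have "\<forall>i. continuous_on UNIV (\<lambda>x. curl \<Phi> x $ i)"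
      unfolding forall_3 curl_def Let_def vector_3 by (intro conjI continuous_intros cc)
    then show "continuous_on UNIV (\<lambda>x. curl \<Phi> x \<bullet> b)" by (simp add: b inner_axis)
  qed
  show "curl \<Phi> x = 0" if x: "x \<notin> closure {x. \<Phi> x \<noteq> 0}" for x
  proof -
    have "(\<Phi> has_derivative (\<lambda>_. 0)) (at x)"
    proof (rule has_derivative_transform_within_open[of "\<lambda>_. 0" "\<lambda>_. 0" x UNIV "- closure {x. \<Phi> x \<noteq> 0}"])
      show "0 = \<Phi> z" if "z \<in> - closure {x. \<Phi> x \<noteq> 0}" for z
        using that closure_subset[of "{x. \<Phi> x \<noteq> 0}"] by auto
    qed (use x in auto)
    then have "frechet_derivative \<Phi> (at x) = (\<lambda>_. 0)" by (metis frechet_derivative_at)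
    then show ?thesis by (simp add: curl_def vec_eq_iff forall_3)
  qed
qed (use assms in \<open>auto simp: test_functions_def\<close>)

lemma is_weak_curl_weak_curl: "F \<in> Hcurl \<Omega> \<Longrightarrow> is_weak_curl \<Omega> F (weak_curl \<Omega> F)"
  using someI_ex[of "is_weak_curl \<Omega> F"] by (simp add: Hcurl_def weak_curl_def)

lemma weak_curl_L2: "F \<in> Hcurl \<Omega> \<Longrightarrow> weak_curl \<Omega> F \<in> L2 \<Omega>"
  using is_weak_curl_weak_curl by (auto simp: is_weak_curl_def)

lemma Hcurl_L2: "F \<in> Hcurl \<Omega> \<Longrightarrow> F \<in> L2 \<Omega>"
  by (auto simp: is_weak_curl_def Hcurl_def)

text \<open>The difference of two weak curls is orthogonal to all test fields and hence vanishes
  almost everywhere. This renders the arbitrary choice in \<open>weak_curl\<close> harmless.\<close>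

lemma is_weak_curl_unique:
  assumes \<Omega>: "open \<Omega>" and G: "is_weak_curl \<Omega> F G" and G': "is_weak_curl \<Omega> F G'"
  shows "AE x in lebesgue_on \<Omega>. G x = G' x"
proof -
  have L2: "G \<in> L2 \<Omega>" "G' \<in> L2 \<Omega>" using G G' by (auto simp: is_weak_curl_def)
  have "AE x in lebesgue_on \<Omega>. G x - G' x = 0"
  proof (rule test_functions_separate_points[OF L2_diff[OF L2] \<Omega>])
    fix \<Phi> :: "real^3 \<Rightarrow> real^3" assume \<Phi>: "\<Phi> \<in> test_functions \<Omega>"
    then have "\<Phi> \<in> L2 \<Omega>" using \<Omega> by (intro test_functions_L2) auto
    then show "l2_inner \<Omega> (\<lambda>x. G x - G' x) \<Phi> = 0"
      using G G' \<Phi> L2 by (simp add: l2_inner_diff_left is_weak_curl_def)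
  qed
  then show ?thesis by simp
qed

text \<open>Each \<open>weak_curl\<close> is a separate choice, so linearity holds only almost
  everywhere; the norm does not see the difference, and later limits are formulated through
  norms.\<close>

lemma weak_curl_diff:
  assumes \<Omega>: "open \<Omega>" and F: "F \<in> Hcurl \<Omega>" and G: "G \<in> Hcurl \<Omega>"
  shows "l2_norm \<Omega> (weak_curl \<Omega> (\<lambda>x. F x - G x)) = l2_norm \<Omega> (\<lambda>x. weak_curl \<Omega> F x - weak_curl \<Omega> G x)"
proof -
  note FC = is_weak_curl_weak_curl[OF F] and GC = is_weak_curl_weak_curl[OF G]
  have D: "is_weak_curl \<Omega> (\<lambda>x. F x - G x) (\<lambda>x. weak_curl \<Omega> F x - weak_curl \<Omega> G x)"
    unfolding is_weak_curl_def
  proof (intro conjI ballI)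
    fix \<Phi> :: "real^3 \<Rightarrow> real^3" assume \<Phi>: "\<Phi> \<in> test_functions \<Omega>"
    then have "\<Phi> \<in> L2 \<Omega>" "curl \<Phi> \<in> L2 \<Omega>"
      using \<Omega> by (auto intro!: test_functions_L2 curl_test_functions_L2)
    then show "l2_inner \<Omega> (\<lambda>x. F x - G x) (curl \<Phi>) = l2_inner \<Omega> (\<lambda>x. weak_curl \<Omega> F x - weak_curl \<Omega> G x) \<Phi>"
      using FC GC \<Phi> by (simp add: l2_inner_diff_left is_weak_curl_def)
  qed (use FC GC in \<open>auto simp: is_weak_curl_def\<close>)
  then have H: "(\<lambda>x. F x - G x) \<in> Hcurl \<Omega>" by (auto simp: Hcurl_def)
  show ?thesis
    by (rule l2_norm_cong_AE[OF is_weak_curl_unique[OF \<Omega> is_weak_curl_weak_curl[OF H] D] weak_curl_L2[OF H]])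
      (use D in \<open>simp add: is_weak_curl_def\<close>)
qed

lemma X0curl_Hcurl: "F \<in> X0curl \<Omega> \<Omega>C \<Longrightarrow> F \<in> Hcurl \<Omega>"
  by (simp add: X0curl_def H0curl_def)

lemma hcurl_norm_bounds:
  "l2_norm \<Omega> F \<le> hcurl_norm \<Omega> F" "l2_norm \<Omega> (weak_curl \<Omega> F) \<le> hcurl_norm \<Omega> F"
  by (simp_all add: hcurl_norm_def real_le_rsqrt)

lemma hcurl_norm_tendsto:
  assumes \<Omega>: "open \<Omega>" and F: "\<And>n. F n \<in> X0curl \<Omega> \<Omega>C" and G: "G \<in> X0curl \<Omega> \<Omega>C"
    and lim: "(\<lambda>n. hcurl_norm \<Omega> (\<lambda>x. F n x - G x)) \<longlonglongrightarrow> 0"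
  shows "(\<lambda>n. l2_norm \<Omega> (\<lambda>x. F n x - G x)) \<longlonglongrightarrow> 0"
    "(\<lambda>n. l2_norm \<Omega> (\<lambda>x. weak_curl \<Omega> (F n) x - weak_curl \<Omega> G x)) \<longlonglongrightarrow> 0"
proof -
  show "(\<lambda>n. l2_norm \<Omega> (\<lambda>x. F n x - G x)) \<longlonglongrightarrow> 0"
    by (rule Lim_null_comparison[OF _ lim]) (simp add: hcurl_norm_bounds)
  have "(\<lambda>n. l2_norm \<Omega> (weak_curl \<Omega> (\<lambda>x. F n x - G x))) \<longlonglongrightarrow> 0"
    by (rule Lim_null_comparison[OF _ lim]) (simp add: hcurl_norm_bounds)
  then show "(\<lambda>n. l2_norm \<Omega> (\<lambda>x. weak_curl \<Omega> (F n) x - weak_curl \<Omega> G x)) \<longlonglongrightarrow> 0"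
    using weak_curl_diff[OF \<Omega> X0curl_Hcurl[OF F] X0curl_Hcurl[OF G]] by simp
qed

lemma flux_eq_sum:
  fixes chi :: "real^3 \<Rightarrow> real^'m^3"
  assumes chi: "\<And>j. (\<lambda>\<xi>. column j (chi \<xi>)) \<in> L2 \<Omega>" and F: "F \<in> L2 \<Omega>"
  shows "flux \<Omega> chi F = (\<Sum>j\<in>UNIV. l2_inner \<Omega> (\<lambda>\<xi>. column j (chi \<xi>)) F *\<^sub>R axis j 1)"
proof -
  have "transpose (chi \<xi>) *v F \<xi> = (\<Sum>j\<in>UNIV. (column j (chi \<xi>) \<bullet> F \<xi>) *\<^sub>R axis j 1)" for \<xi>
    by (simp add: vec_eq_iff matrix_vector_mult_def transpose_def column_def inner_vec_def axis_def
        if_distrib sum.delta cong: if_cong)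
  then show ?thesis
    using L2_integrable_inner[OF chi F] by (simp add: flux_def l2_inner_def)
qed

text \<open>Moving \<open>chi\<close> to the other factor turns the source term of the field
  equation into a pairing of the current with the flux, the quantity whose derivative enters the
  circuit equation.\<close>

lemma inner_flux:
  fixes chi :: "real^3 \<Rightarrow> real^'m^3"
  assumes chi: "\<And>j. (\<lambda>\<xi>. column j (chi \<xi>)) \<in> L2 \<Omega>" and F: "F \<in> L2 \<Omega>"
  shows "(LINT \<xi>|lebesgue_on \<Omega>. (chi \<xi> *v c) \<bullet> F \<xi>) = c \<bullet> flux \<Omega> chi F"
proof -
  have "(chi \<xi> *v c) \<bullet> F \<xi> = (\<Sum>j\<in>UNIV. c $ j * (column j (chi \<xi>) \<bullet> F \<xi>))" for \<xi>
    by (simp add: matrix_mult_sum inner_sum_left scalar_mult_eq_scaleR)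
  then have "(LINT \<xi>|lebesgue_on \<Omega>. (chi \<xi> *v c) \<bullet> F \<xi>) = (\<Sum>j\<in>UNIV. c $ j * l2_inner \<Omega> (\<lambda>\<xi>. column j (chi \<xi>)) F)"
    using L2_integrable_inner[OF chi F] by (simp add: l2_inner_def)
  also have "\<dots> = c \<bullet> flux \<Omega> chi F"
    unfolding flux_eq_sum[OF chi F] by (simp add: inner_sum_right inner_axis mult.commute)
  finally show ?thesis .
qed

lemma flux_tendsto:
  fixes chi :: "real^3 \<Rightarrow> real^'m^3"
  assumes chi: "\<And>j. (\<lambda>\<xi>. column j (chi \<xi>)) \<in> L2 \<Omega>" and F: "\<And>n. F n \<in> L2 \<Omega>" and G: "G \<in> L2 \<Omega>"
    and lim: "(\<lambda>n. l2_norm \<Omega> (\<lambda>x. F n x - G x)) \<longlonglongrightarrow> 0"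
  shows "(\<lambda>n. flux \<Omega> chi (F n)) \<longlonglongrightarrow> flux \<Omega> chi G"
  unfolding flux_eq_sum[OF chi F] flux_eq_sum[OF chi G]
  by (intro tendsto_sum tendsto_scaleR tendsto_const l2_inner_tendsto[OF F G chi lim])

section \<open>Left derivatives of vector functions and a short-time growth estimate\<close>

lemma increment_left_derivative:
  fixes z z' :: "real \<Rightarrow> 'b::euclidean_space"
  assumes int: "\<And>\<epsilon>. \<epsilon> \<in> {0<..<T} \<Longrightarrow> integrable (lebesgue_on {\<epsilon>..T}) z'"
    and inc: "\<And>r s. \<lbrakk>0 < r; r < s; s < T\<rbrakk> \<Longrightarrow> z s - z r = integral {r..s} z'"
  obtains N where "negligible N"
    "\<And>s e. \<lbrakk>s \<in> {0<..<T} - N; 0 < e\<rbrakk> \<Longrightarrow>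
       \<exists>d>0. \<forall>r. 0 < r \<and> s - d < r \<and> r < s \<longrightarrow> norm (z s - z r - (s - r) *\<^sub>R z' s) \<le> e * (s - r)"
proof -
  have "\<forall>\<epsilon>\<in>{0<..<T}. \<exists>M. negligible M \<and>
      (\<forall>x\<in>{\<epsilon><..T} - M. ((\<lambda>h. integral {x-h..x} z' /\<^sub>R h) \<longlongrightarrow> z' x) (at_right 0))"
    by (intro ballI, rule lebesgue_left_differentiation[OF int]) blast+
  from negligible_exhaustion[OF this] obtain N where N: "negligible N"
    "\<forall>t\<in>{0<..<T}. \<exists>\<epsilon> M. \<epsilon> \<in> {0<..<t} \<and> M \<subseteq> N \<and>
      (\<forall>x\<in>{\<epsilon><..T} - M. ((\<lambda>h. integral {x-h..x} z' /\<^sub>R h) \<longlongrightarrow> z' x) (at_right 0))"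
    by (elim exE conjE) (rule that)
  show ?thesis
  proof (rule that[OF N(1)])
    fix s e assume s: "s \<in> {0<..<T} - N" and e: "0 < (e::real)"
    obtain \<epsilon> M where \<epsilon>: "\<epsilon> \<in> {0<..<s}" "M \<subseteq> N"
      "\<forall>x\<in>{\<epsilon><..T} - M. ((\<lambda>h. integral {x-h..x} z' /\<^sub>R h) \<longlongrightarrow> z' x) (at_right 0)"
      using bspec[OF N(2), of s] s by auto
    have "((\<lambda>h. integral {s-h..s} z' /\<^sub>R h) \<longlongrightarrow> z' s) (at_right 0)"
      by (rule \<epsilon>(3)[rule_format]) (use s \<epsilon>(1,2) in auto)
    then have "\<forall>\<^sub>F h in at_right 0. dist (integral {s-h..s} z' /\<^sub>R h) (z' s) < e"
      using e by (rule tendstoD)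
    then obtain d where d: "0 < d" "\<And>h. \<lbrakk>0 < h; h < d\<rbrakk> \<Longrightarrow> dist (integral {s-h..s} z' /\<^sub>R h) (z' s) < e"
      unfolding eventually_at_right_field by auto
    have "norm (z s - z r - (s - r) *\<^sub>R z' s) \<le> e * (s - r)" if r: "0 < r" "s - d < r" "r < s" for r
    proof -
      have "dist (integral {r..s} z' /\<^sub>R (s - r)) (z' s) < e" using d(2)[of "s - r"] r by simp
      moreover have "z s - z r - (s - r) *\<^sub>R z' s = (s - r) *\<^sub>R (integral {r..s} z' /\<^sub>R (s - r) - z' s)"
        using r s inc[of r s] by (simp add: scaleR_diff_right)
      ultimately show ?thesis using r by (simp add: dist_norm mult.commute)
    qed
    then show "\<exists>d>0. \<forall>r. 0 < r \<and> s - d < r \<and> r < s \<longrightarrow> norm (z s - z r - (s - r) *\<^sub>R z' s) \<le> e * (s - r)"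
      using d(1) by blast
  qed
qed

text \<open>An argument of Gronwall type on [0, h]. Let M be the maximum of \<open>q\<close> there
  and J the integral of \<open>g\<close>. Evaluating \<open>bd\<close> where the maximum is attained
  and absorbing b J M into M^2 / 2 gives M^2 \<le> 2 a h + b^2 J^2, while J^2 \<le> h V(h) with V(h)
  the integral of g^2. Hence M^2 \<le> C h and J M \<le> h \<surd>(C V(h)), where V(h) tends to 0
  with h.\<close>

lemma square_root_growth:
  fixes q g :: "real \<Rightarrow> real"
  assumes T: "0 < T" and q: "continuous_on {0..T} q" "\<And>t. 0 \<le> q t"
    and g: "g \<in> L2 {0..T}" "\<And>t. 0 \<le> g t" and ab: "0 \<le> a" "0 \<le> b"
    and bd: "\<And>t. \<lbrakk>0 < t; t < T\<rbrakk> \<Longrightarrow> (q t)\<^sup>2 \<le> a * t + b * integral {0..t} (\<lambda>s. g s * q s)"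
    and q0: "q 0 = 0" and \<eta>: "0 < \<eta>"
  obtains h0 where "0 < h0" "h0 \<le> T" "\<And>h. \<lbrakk>0 < h; h < h0\<rbrakk> \<Longrightarrow> integral {0..h} (\<lambda>s. g s * q s) \<le> \<eta> * h"
proof -
  have g2: "integrable (lebesgue_on {0..T}) (\<lambda>s. (g s)\<^sup>2)" using g by (simp add: L2_def)
  have gm: "g \<in> borel_measurable (lebesgue_on {0..T})" using g by (simp add: L2_def)
  have g1: "integrable (lebesgue_on {0..T}) g" by (rule L2_integrable_Icc[OF g(1)])
  have gi: "g integrable_on {0..T}" "(\<lambda>s. (g s)\<^sup>2) integrable_on {0..T}"
    using g1 g2 by (auto intro!: integrable_on_lebesgue_on)
  have gqi: "(\<lambda>s. g s * q s) integrable_on {0..T}"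
  proof -
    have "\<exists>B. \<forall>t\<in>{0..T}. norm (q t) \<le> B"
      using compact_imp_bounded[OF compact_continuous_image[OF q(1)]] by (auto simp: bounded_iff)
    then obtain B where B: "\<And>t. t \<in> {0..T} \<Longrightarrow> norm (q t) \<le> B" by blast
    have "integrable (lebesgue_on {0..T}) (\<lambda>s. g s * q s)"
    proof (rule Bochner_Integration.integrable_bound)
      show "integrable (lebesgue_on {0..T}) (\<lambda>s. B * g s)" using g1 by simp
      have "q \<in> borel_measurable (lebesgue_on {0..T})"
        using q(1) by (rule continuous_imp_measurable_on_sets_lebesgue) simp
      then show "(\<lambda>s. g s * q s) \<in> borel_measurable (lebesgue_on {0..T})" using gm by simp
      show "AE s in lebesgue_on {0..T}. norm (g s * q s) \<le> norm (B * g s)"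
      proof (rule AE_I2)
        fix s assume "s \<in> space (lebesgue_on {0..T})"
        then have "\<bar>q s\<bar> \<le> \<bar>B\<bar>" using B[of s] by auto
        then show "norm (g s * q s) \<le> norm (B * g s)" by (simp add: abs_mult mult.commute[of "\<bar>B\<bar>"] mult_left_mono)
      qed
    qed
    then show ?thesis by (auto intro!: integrable_on_lebesgue_on)
  qed
  define V where "V h = integral {0..h} (\<lambda>s. (g s)\<^sup>2)" for h
  define C where "C = 2 * a + b\<^sup>2 * V T"
  have sub: "f integrable_on {0..h}" if "f integrable_on {0..T}" "h \<le> T" for f :: "real \<Rightarrow> real" and h
    by (rule integrable_on_subinterval[OF that(1)]) (use that(2) in auto)
  have V: "0 \<le> V h" "V h \<le> V T" if "0 \<le> h" "h \<le> T" for h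
    unfolding V_def using that by (auto intro!: integral_nonneg integral_subset_le sub[OF gi(2)])
  have C: "0 \<le> C" unfolding C_def using ab V[of T] T by simp
  have "continuous_on {0..T} V" unfolding V_def using gi(2) by (rule indefinite_integral_continuous_1)
  then have "(V \<longlongrightarrow> V 0) (at 0 within {0..T})" using T by (auto simp: continuous_on_def)
  then have "((\<lambda>h. C * V h) \<longlongrightarrow> C * V 0) (at 0 within {0..T})" by (intro tendsto_intros)
  moreover have "V 0 = 0" by (simp add: V_def)
  ultimately have "\<forall>\<^sub>F h in at 0 within {0..T}. C * V h < \<eta>\<^sup>2" using \<eta> by (intro order_tendstoD) auto
  then obtain d where d: "0 < d" "\<And>h. \<lbrakk>h \<in> {0..T}; h \<noteq> 0; dist h 0 < d\<rbrakk> \<Longrightarrow> C * V h < \<eta>\<^sup>2"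
    unfolding eventually_at by blast
  show ?thesis
  proof (rule that[of "min d T"])
    fix h assume h: "0 < h" "h < min d T"
    have qc: "continuous_on {0..h} q" by (rule continuous_on_subset[OF q(1)]) (use h in auto)
    obtain t where t: "t \<in> {0..h}" "\<And>s. s \<in> {0..h} \<Longrightarrow> q s \<le> q t"
      using continuous_attains_sup[OF _ _ qc] h by auto
    define M J where "M = q t" and "J = integral {0..h} g"
    have M0: "0 \<le> M" using q(2) by (simp add: M_def)
    have J0: "0 \<le> J" unfolding J_def using g(2) h by (auto intro!: integral_nonneg sub[OF gi(1)])
    have JV: "J\<^sup>2 \<le> h * V h"
    proof -
      \<comment> \<open>The mean value of \<open>g\<close>: integrating 0 \<le> (g - x)^2 with this
        x is the Cauchy-Schwarz inequality for \<open>g\<close> and 1.\<close>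
      define x where "x = J / h"
      have "integral {0..h} (\<lambda>s. 2 * x * g s - x\<^sup>2) \<le> V h"
        unfolding V_def
      proof (rule integral_le)
        show "(\<lambda>s. 2 * x * g s - x\<^sup>2) integrable_on {0..h}"
          using sub[OF gi(1), of h] h by (intro integrable_diff integrable_on_mult_right) auto
        show "(\<lambda>s. (g s)\<^sup>2) integrable_on {0..h}" using sub[OF gi(2), of h] h by auto
        show "2 * x * g s - x\<^sup>2 \<le> (g s)\<^sup>2" for s
          using zero_le_power2[of "g s - x"] by (simp add: power2_eq_square algebra_simps)
      qed
      moreover have "integral {0..h} (\<lambda>s. 2 * x * g s - x\<^sup>2) = 2 * x * J - h * x\<^sup>2"
        using sub[OF gi(1), of h] h unfolding J_def
        by (subst Henstock_Kurzweil_Integration.integral_diff) (auto intro: integrable_on_mult_right)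
      moreover have "2 * x * J - h * x\<^sup>2 = J\<^sup>2 / h"
        using h by (simp add: x_def power2_eq_square field_simps)
      ultimately have "J\<^sup>2 / h \<le> V h" by simp
      then show ?thesis using h by (simp add: pos_divide_le_eq mult.commute)
    qed
    have gq: "integral {0..c} (\<lambda>s. g s * q s) \<le> J * M" if c: "0 \<le> c" "c \<le> h" for c
    proof -
      have "integral {0..c} (\<lambda>s. g s * q s) \<le> integral {0..h} (\<lambda>s. g s * q s)"
        using c h g(2) q(2) by (intro integral_subset_le sub[OF gqi]) auto
      also have "\<dots> \<le> integral {0..h} (\<lambda>s. g s * M)"
      proof (rule integral_le)
        show "(\<lambda>s. g s * q s) integrable_on {0..h}" using h by (intro sub[OF gqi]) auto
        show "(\<lambda>s. g s * M) integrable_on {0..h}" using h by (intro integrable_on_mult_left sub[OF gi(1)]) auto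
        show "g s * q s \<le> g s * M" if "s \<in> {0..h}" for s
          using t(2)[OF that] g(2)[of s] by (auto simp: M_def intro: mult_left_mono)
      qed
      finally show ?thesis by (simp add: J_def)
    qed
    have "M\<^sup>2 \<le> a * h + b * (J * M)"
    proof (cases "t = 0")
      case True
      \<comment> \<open>\<open>bd\<close> speaks about positive times only; if the maximum sits at
        0, the initial value of \<open>q\<close> takes over.\<close>
      then show ?thesis using q0 ab h J0 by (simp add: M_def)
    next
      case False
      then have "M\<^sup>2 \<le> a * t + b * integral {0..t} (\<lambda>s. g s * q s)"
        using bd[of t] t h by (simp add: M_def)
      also have "\<dots> \<le> a * h + b * (J * M)"
        using t ab gq[of t] by (intro add_mono mult_left_mono) auto
      finally show ?thesis .
    qed
    moreover have "b * (J * M) \<le> M\<^sup>2 / 2 + b\<^sup>2 * J\<^sup>2 / 2"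
      using zero_le_power2[of "M - b * J"] by (simp add: power2_diff power_mult_distrib algebra_simps)
    ultimately have "M\<^sup>2 \<le> 2 * a * h + b\<^sup>2 * J\<^sup>2" by simp
    also have "\<dots> \<le> 2 * a * h + b\<^sup>2 * (h * V T)"
    proof -
      have "J\<^sup>2 \<le> h * V T" using JV mult_left_mono[of "V h" "V T" h] V(2)[of h] h by linarith
      then show ?thesis by (simp add: mult_left_mono)
    qed
    also have "\<dots> = h * C" by (simp add: C_def algebra_simps)
    finally have "M\<^sup>2 * J\<^sup>2 \<le> (h * C) * (h * V h)"
      using JV C h by (intro mult_mono) auto
    also have "\<dots> = h\<^sup>2 * (C * V h)" by (simp add: power2_eq_square)
    also have "\<dots> \<le> h\<^sup>2 * \<eta>\<^sup>2" using d(2)[of h] h by (intro mult_left_mono) (auto simp: less_imp_le)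
    finally have "(J * M)\<^sup>2 \<le> (\<eta> * h)\<^sup>2" by (simp add: power_mult_distrib mult.commute)
    then have "J * M \<le> \<eta> * h" using \<eta> h by (auto intro: power2_le_imp_le)
    then show "integral {0..h} (\<lambda>s. g s * q s) \<le> \<eta> * h" using gq[of h] h by linarith
  qed (use d T in auto)
qed

section \<open>Left derivatives of Bochner functions\<close>

lemma bochner_measurable_cong:
  assumes f: "bochner_measurable J V N f" and eq: "AE t in lebesgue_on J. f t = g t"
  shows "bochner_measurable J V N g"
proof -
  obtain s where s: "\<And>n. simple_function (lebesgue_on J) (s n)" "\<And>n. s n ` J \<subseteq> V"
      "AE t in lebesgue_on J. (\<lambda>n. N (\<lambda>x. s n t x - f t x)) \<longlonglongrightarrow> 0" and fV: "AE t in lebesgue_on J. f t \<in> V"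
    using f unfolding bochner_measurable_def by blast
  have "AE t in lebesgue_on J. g t \<in> V" using fV eq by eventually_elim simp
  moreover have "AE t in lebesgue_on J. (\<lambda>n. N (\<lambda>x. s n t x - g t x)) \<longlonglongrightarrow> 0"
    using s(3) eq by eventually_elim simp
  ultimately show ?thesis using s(1,2) unfolding bochner_measurable_def by blast
qed

text \<open>\<open>D\<close> consists of the values of the approximating simple functions, finitely
  many for each. It replaces uncountable families in two places: the reference values used for left
  derivatives, and the test fields of the weak formulation.\<close>

lemma bochner_measurable_separable:
  assumes f: "bochner_measurable J V N f"
  obtains D where "countable D" "D \<subseteq> V"
    "AE t in lebesgue_on J. \<exists>d. (\<forall>n. d n \<in> D) \<and> (\<lambda>n. N (\<lambda>x. d n x - f t x)) \<longlonglongrightarrow> (0::real)"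
proof -
  obtain s where s: "\<And>n. simple_function (lebesgue_on J) (s n)" "\<And>n. s n ` J \<subseteq> V"
      "AE t in lebesgue_on J. (\<lambda>n. N (\<lambda>x. s n t x - f t x)) \<longlonglongrightarrow> 0"
    using f unfolding bochner_measurable_def by blast
  have fin: "finite (s n ` J)" for n using simple_functionD(1)[OF s(1), of n] by simp
  show ?thesis
  proof (rule that[of "\<Union>n. s n ` J"])
    show "(\<Union>n. s n ` J) \<subseteq> V" by (intro UN_least s(2))
    show "countable (\<Union>n. s n ` J)" using fin by (intro countable_UN) (auto intro: countable_finite)
    have "AE t in lebesgue_on J. t \<in> J" using AE_space[of "lebesgue_on J"] by simp
    with s(3) show "AE t in lebesgue_on J. \<exists>d. (\<forall>n. d n \<in> (\<Union>n. s n ` J)) \<and> (\<lambda>n. N (\<lambda>x. d n x - f t x)) \<longlonglongrightarrow> 0"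
    proof eventually_elim
      case (elim t)
      then show ?case by (intro exI[of _ "\<lambda>n. s n t"]) auto
    qed
  qed
qed

lemma continuous_on_l2_inner:
  assumes w: "w \<in> bochner_C J (XS \<Omega> \<Omega>C) (l2_norm \<Omega>)" and F: "F \<in> L2 \<Omega>"
  shows "continuous_on J (\<lambda>t. l2_inner \<Omega> (w t) F)"
  unfolding continuous_on_def
proof
  fix t assume t: "t \<in> J"
  have wL: "w s \<in> L2 \<Omega>" if "s \<in> J" for s using w that by (auto simp: bochner_C_def intro: XS_L2)
  have "((\<lambda>s. l2_norm \<Omega> (\<lambda>x. w s x - w t x) * l2_norm \<Omega> F) \<longlongrightarrow> 0 * l2_norm \<Omega> F) (at t within J)"
    using w t by (intro tendsto_intros) (auto simp: bochner_C_def)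
  then have "((\<lambda>s. l2_norm \<Omega> (\<lambda>x. w s x - w t x) * l2_norm \<Omega> F) \<longlongrightarrow> 0) (at t within J)" by simp
  then have "((\<lambda>s. l2_inner \<Omega> (w s) F - l2_inner \<Omega> (w t) F) \<longlongrightarrow> 0) (at t within J)"
  proof (rule Lim_null_comparison[rotated])
    show "\<forall>\<^sub>F s in at t within J. norm (l2_inner \<Omega> (w s) F - l2_inner \<Omega> (w t) F) \<le> l2_norm \<Omega> (\<lambda>x. w s x - w t x) * l2_norm \<Omega> F"
      unfolding eventually_at_filter
    proof (intro always_eventually allI impI)
      fix s assume "s \<in> J"
      then show "norm (l2_inner \<Omega> (w s) F - l2_inner \<Omega> (w t) F) \<le> l2_norm \<Omega> (\<lambda>x. w s x - w t x) * l2_norm \<Omega> F"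
        using l2_Cauchy_Schwarz[of "\<lambda>x. w s x - w t x" \<Omega> F] wL t F by (simp add: l2_inner_diff_left L2_diff)
    qed
  qed
  then show "((\<lambda>s. l2_inner \<Omega> (w s) F) \<longlongrightarrow> l2_inner \<Omega> (w t) F) (at t within J)"
    by (simp add: LIM_zero_iff)
qed

context
  fixes T :: real and \<Omega> \<Omega>C :: "(real^3) set" and w w' :: "real \<Rightarrow> real^3 \<Rightarrow> real^3"
  assumes w: "w \<in> bochner_C {0..T} (XS \<Omega> \<Omega>C) (l2_norm \<Omega>)"
    and w': "bochner_H1loc_deriv T \<Omega> (XS \<Omega> \<Omega>C) w w'"
    and w'X: "\<And>t. w' t \<in> XS \<Omega> \<Omega>C"
begin

lemma w_XS: "t \<in> {0..T} \<Longrightarrow> w t \<in> XS \<Omega> \<Omega>C"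
  using w by (auto simp: bochner_C_def)

lemma w'_L2: "w' t \<in> L2 \<Omega>"
  using w'X XS_L2 by blast

lemma w'_bochner: "\<epsilon> \<in> {0<..<T} \<Longrightarrow> bochner_measurable {\<epsilon>..T} (XS \<Omega> \<Omega>C) (l2_norm \<Omega>) w'"
  using w' by (auto simp: bochner_H1loc_deriv_def bochner_L2_def)

text \<open>The shift by \<open>G\<close> serves two purposes: G = 0 gives the norm of w' itself,
  and other choices give the distance functions whose Lebesgue points enter
  \<open>w_left_derivative\<close>.\<close>

lemma w'_norm_L2:
  assumes \<epsilon>: "\<epsilon> \<in> {0<..<T}" and G: "G \<in> XS \<Omega> \<Omega>C"
  shows "(\<lambda>t. l2_norm \<Omega> (\<lambda>x. w' t x - G x)) \<in> L2 {\<epsilon>..T}"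
proof -
  have m: "(\<lambda>t. l2_norm \<Omega> (\<lambda>x. w' t x - F x)) \<in> borel_measurable (lebesgue_on {\<epsilon>..T})" if F: "F \<in> XS \<Omega> \<Omega>C" for F
  proof (rule bochner_measurable_compose[OF w'_bochner[OF \<epsilon>]])
    fix s g assume s: "\<And>n. s n \<in> XS \<Omega> \<Omega>C" "g \<in> XS \<Omega> \<Omega>C" "(\<lambda>n. l2_norm \<Omega> (\<lambda>x. s n x - g x)) \<longlonglongrightarrow> 0"
    show "(\<lambda>n. l2_norm \<Omega> (\<lambda>x. s n x - F x)) \<longlonglongrightarrow> l2_norm \<Omega> (\<lambda>x. g x - F x)"
      by (rule l2_norm_tendsto) (use s F in \<open>auto intro: XS_L2\<close>)
  qed simp
  have 0: "(\<lambda>t. l2_norm \<Omega> (w' t)) \<in> L2 {\<epsilon>..T}"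
    using m[OF XS_zero] w' \<epsilon> by (auto simp: L2_def bochner_H1loc_deriv_def bochner_L2_def)
  have c: "(\<lambda>t. l2_norm \<Omega> G) \<in> L2 {\<epsilon>..T}"
    using continuous_imp_integrable_real[of \<epsilon> T "\<lambda>_. (l2_norm \<Omega> G)\<^sup>2"] by (simp add: L2_def)
  show ?thesis
  proof (rule L2_bound[OF m[OF G] L2_add[OF 0 c], of 1])
    fix t
    have "l2_norm \<Omega> (\<lambda>x. w' t x - G x) \<le> l2_norm \<Omega> (w' t) + l2_norm \<Omega> G"
      using l2_norm_triangle_diff[OF w'_L2 L2_zero XS_L2[OF G]] l2_norm_minus_commute[of \<Omega> G "\<lambda>_. 0"]
        l2_norm_minus_commute[of \<Omega> "\<lambda>_. 0" G] by simp
    then show "norm (l2_norm \<Omega> (\<lambda>x. w' t x - G x)) \<le> 1 * norm (l2_norm \<Omega> (w' t) + l2_norm \<Omega> G)" by simp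
  qed
qed

lemma w'_inner_integrable:
  assumes \<epsilon>: "\<epsilon> \<in> {0<..<T}" and F: "F \<in> XS \<Omega> \<Omega>C"
  shows "integrable (lebesgue_on {\<epsilon>..T}) (\<lambda>t. l2_inner \<Omega> (w' t) F)"
proof (rule Bochner_Integration.integrable_bound)
  show "integrable (lebesgue_on {\<epsilon>..T}) (\<lambda>t. l2_norm \<Omega> (w' t) * l2_norm \<Omega> F)"
    using L2_integrable_Icc[OF w'_norm_L2[OF \<epsilon> XS_zero]] by simp
  show "(\<lambda>t. l2_inner \<Omega> (w' t) F) \<in> borel_measurable (lebesgue_on {\<epsilon>..T})"
    unfolding l2_inner_commute[of \<Omega> _ F]
    by (rule bochner_measurable_compose[OF w'_bochner[OF \<epsilon>]])
      (use F in \<open>auto intro!: l2_inner_tendsto XS_L2\<close>)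
  show "AE t in lebesgue_on {\<epsilon>..T}. norm (l2_inner \<Omega> (w' t) F) \<le> norm (l2_norm \<Omega> (w' t) * l2_norm \<Omega> F)"
    using l2_Cauchy_Schwarz[OF w'_L2 XS_L2[OF F]] by (intro AE_I2) simp
qed

lemma w_increment_inner:
  assumes F: "F \<in> XS \<Omega> \<Omega>C" and rs: "0 < r" "r < s" "s < T"
  shows "l2_inner \<Omega> (w s) F - l2_inner \<Omega> (w r) F = integral {r..s} (\<lambda>t. l2_inner \<Omega> (w' t) F)"
proof (rule weak_deriv_increment[OF _ _ _ rs])
  show "weak_deriv_on 0 T (\<lambda>t. l2_inner \<Omega> (w t) F) (\<lambda>t. l2_inner \<Omega> (w' t) F)"
    using w' F by (auto simp: bochner_H1loc_deriv_def)
  show "continuous_on {0<..<T} (\<lambda>t. l2_inner \<Omega> (w t) F)"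
    by (rule continuous_on_subset[OF continuous_on_l2_inner[OF w XS_L2[OF F]]]) auto
  show "integrable (lebesgue_on {\<epsilon>..<T}) (\<lambda>t. l2_inner \<Omega> (w' t) F)" if "0 < \<epsilon>" for \<epsilon>
  proof (cases "\<epsilon> < T")
    case True
    show ?thesis
      by (rule integrable_lebesgue_on_subset[OF w'_inner_integrable[of \<epsilon>]]) (use True that F in auto)
  next
    case False
    then have "{\<epsilon>..<T} = {}" by simp
    then show ?thesis by (simp add: integrable_restrict_space)
  qed
qed

text \<open>Testing the scalar increment identity with the field w s - w r - (s - r) G itself
  produces its squared norm, and one factor of the norm is divided out. In this way norm estimates
  follow from scalar integrals, without forming Bochner integrals of w'.\<close>

lemma w_increment_norm:
  assumes G: "G \<in> XS \<Omega> \<Omega>C" and rs: "0 < r" "r < s" "s < T"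
  shows "l2_norm \<Omega> (\<lambda>x. w s x - w r x - (s - r) *\<^sub>R G x) \<le> integral {r..s} (\<lambda>t. l2_norm \<Omega> (\<lambda>x. w' t x - G x))"
proof -
  define F where "F x = w s x - w r x - (s - r) *\<^sub>R G x" for x
  have X: "w s \<in> XS \<Omega> \<Omega>C" "w r \<in> XS \<Omega> \<Omega>C" using w_XS rs by auto
  have F: "F \<in> XS \<Omega> \<Omega>C" unfolding F_def[abs_def] using X G by auto
  note L = X[THEN XS_L2] F[THEN XS_L2] G[THEN XS_L2]
  have sub: "f integrable_on {r..s}" if "integrable (lebesgue_on {r..T}) f" for f :: "real \<Rightarrow> real"
    by (rule integrable_on_lebesgue_on[OF integrable_lebesgue_on_subset[OF that]]) (use rs in auto)
  have r: "r \<in> {0<..<T}" using rs by auto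
  have i1: "(\<lambda>t. l2_inner \<Omega> (w' t) F) integrable_on {r..s}" by (intro sub w'_inner_integrable r F)
  have i2: "(\<lambda>t. l2_norm \<Omega> (\<lambda>x. w' t x - G x)) integrable_on {r..s}"
    by (intro sub L2_integrable_Icc w'_norm_L2 r G)
  have "(l2_norm \<Omega> F)\<^sup>2 = l2_inner \<Omega> (w s) F - l2_inner \<Omega> (w r) F - (s - r) * l2_inner \<Omega> G F"
  proof -
    have "l2_inner \<Omega> F F = l2_inner \<Omega> (\<lambda>x. w s x - w r x - (s - r) *\<^sub>R G x) F"
      by (simp add: F_def[abs_def])
    also have "\<dots> = l2_inner \<Omega> (w s) F - l2_inner \<Omega> (w r) F - (s - r) * l2_inner \<Omega> G F"
      using L by (simp add: l2_inner_diff_left L2_diff L2_scaleR l2_inner_scaleR_left)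
    finally show ?thesis by (simp add: l2_norm_power2)
  qed
  also have "\<dots> = integral {r..s} (\<lambda>t. l2_inner \<Omega> (w' t) F) - integral {r..s} (\<lambda>t. l2_inner \<Omega> G F)"
    using w_increment_inner[OF F rs] rs by simp
  also have "\<dots> = integral {r..s} (\<lambda>t. l2_inner \<Omega> (\<lambda>x. w' t x - G x) F)"
    using i1 by (subst Henstock_Kurzweil_Integration.integral_diff[symmetric])
      (auto simp: l2_inner_diff_left[OF w'_L2 L(4) L(3)])
  also have "\<dots> \<le> integral {r..s} (\<lambda>t. l2_norm \<Omega> (\<lambda>x. w' t x - G x) * l2_norm \<Omega> F)"
  proof (rule integral_le)
    show "(\<lambda>t. l2_inner \<Omega> (\<lambda>x. w' t x - G x) F) integrable_on {r..s}"
      using i1 by (auto simp: l2_inner_diff_left[OF w'_L2 L(4) L(3)] intro!: integrable_diff)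
    show "(\<lambda>t. l2_norm \<Omega> (\<lambda>x. w' t x - G x) * l2_norm \<Omega> F) integrable_on {r..s}"
      using i2 by (rule integrable_on_mult_left)
    fix t
    show "l2_inner \<Omega> (\<lambda>x. w' t x - G x) F \<le> l2_norm \<Omega> (\<lambda>x. w' t x - G x) * l2_norm \<Omega> F"
      using l2_Cauchy_Schwarz[OF L2_diff[OF w'_L2 L(4)] L(3), of t] by simp
  qed
  finally have "(l2_norm \<Omega> F)\<^sup>2 \<le> integral {r..s} (\<lambda>t. l2_norm \<Omega> (\<lambda>x. w' t x - G x)) * l2_norm \<Omega> F" by simp
  then have "l2_norm \<Omega> F * l2_norm \<Omega> F \<le> integral {r..s} (\<lambda>t. l2_norm \<Omega> (\<lambda>x. w' t x - G x)) * l2_norm \<Omega> F"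
    by (simp add: power2_eq_square)
  moreover have "0 \<le> integral {r..s} (\<lambda>t. l2_norm \<Omega> (\<lambda>x. w' t x - G x))"
    using i2 by (rule integral_nonneg) simp
  ultimately have "l2_norm \<Omega> F \<le> integral {r..s} (\<lambda>t. l2_norm \<Omega> (\<lambda>x. w' t x - G x))"
    using l2_norm_nonneg[of \<Omega> F] by (cases "l2_norm \<Omega> F = 0") (auto simp: mult_le_cancel_right)
  then show ?thesis by (simp add: F_def[abs_def])
qed

text \<open>Lebesgue points of \<open>t \<mapsto> \<parallel>w' t - d\<parallel>\<close> for the countably many values \<open>d\<close> of the simple
  functions approximating \<open>w'\<close> are left derivative points of \<open>w\<close> in norm.\<close>

lemma w_left_derivative:
  obtains N where "negligible N"
    "\<And>s e. \<lbrakk>s \<in> {0<..<T} - N; 0 < e\<rbrakk> \<Longrightarrow>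
       \<exists>d>0. \<forall>r. 0 < r \<and> s - d < r \<and> r < s \<longrightarrow>
         l2_norm \<Omega> (\<lambda>x. w s x - w r x - (s - r) *\<^sub>R w' s x) \<le> e * (s - r)"
proof -
  let ?n = "\<lambda>d t. l2_norm \<Omega> (\<lambda>x. w' t x - d x)"
  \<comment> \<open>The countable set D depends on the lower endpoint \<epsilon>, so it is hidden
    inside the predicate to fit \<open>negligible_exhaustion\<close>.\<close>
  define Pr where "Pr \<epsilon> N \<longleftrightarrow> (\<exists>D \<subseteq> XS \<Omega> \<Omega>C.
      (\<forall>t\<in>{\<epsilon>..T} - N. \<exists>d. (\<forall>n. d n \<in> D) \<and> (\<lambda>n. l2_norm \<Omega> (\<lambda>x. d n x - w' t x)) \<longlonglongrightarrow> 0) \<and>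
      (\<forall>t\<in>{\<epsilon><..T} - N. \<forall>d\<in>D. ((\<lambda>h. integral {t-h..t} (?n d) /\<^sub>R h) \<longlongrightarrow> ?n d t) (at_right 0)))" for \<epsilon> N
  have each: "\<forall>\<epsilon>\<in>{0<..<T}. \<exists>N. negligible N \<and> Pr \<epsilon> N"
  proof
    fix \<epsilon> assume \<epsilon>: "\<epsilon> \<in> {0<..<T}"
    obtain D where D: "countable D" "D \<subseteq> XS \<Omega> \<Omega>C"
      "AE t in lebesgue_on {\<epsilon>..T}. \<exists>d. (\<forall>n. d n \<in> D) \<and> (\<lambda>n. l2_norm \<Omega> (\<lambda>x. d n x - w' t x)) \<longlonglongrightarrow> 0"
      using bochner_measurable_separable[OF w'_bochner[OF \<epsilon>]] by blast
    obtain N0 where N0: "negligible N0"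
      "\<And>t. t \<in> {\<epsilon>..T} - N0 \<Longrightarrow> \<exists>d. (\<forall>n. d n \<in> D) \<and> (\<lambda>n. l2_norm \<Omega> (\<lambda>x. d n x - w' t x)) \<longlonglongrightarrow> 0"
      using AE_lebesgue_on_negligible[OF D(3)] by auto
    have "\<exists>N. negligible N \<and> (\<forall>t\<in>{\<epsilon><..T} - N. ((\<lambda>h. integral {t-h..t} (?n d) /\<^sub>R h) \<longlongrightarrow> ?n d t) (at_right 0))"
      if "d \<in> D" for d
      by (rule lebesgue_left_differentiation[OF L2_integrable_Icc[OF w'_norm_L2[OF \<epsilon>]]])
        (use that D(2) in blast)+
    then obtain N1 where N1: "\<forall>d\<in>D. negligible (N1 d) \<and>
        (\<forall>t\<in>{\<epsilon><..T} - N1 d. ((\<lambda>h. integral {t-h..t} (?n d) /\<^sub>R h) \<longlongrightarrow> ?n d t) (at_right 0))"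
      using bchoice[of D "\<lambda>d N. negligible N \<and>
        (\<forall>t\<in>{\<epsilon><..T} - N. ((\<lambda>h. integral {t-h..t} (?n d) /\<^sub>R h) \<longlongrightarrow> ?n d t) (at_right 0))"] by blast
    have "negligible (\<Union>d\<in>D. N1 d)"
      using D(1) N1 by (intro negligible_countable_Union) auto
    then have "negligible (N0 \<union> (\<Union>d\<in>D. N1 d))" using N0(1) by (rule negligible_Un[rotated])
    moreover have "Pr \<epsilon> (N0 \<union> (\<Union>d\<in>D. N1 d))"
      unfolding Pr_def using D(2) N0(2) N1 by (intro exI[of _ D]) auto
    ultimately show "\<exists>N. negligible N \<and> Pr \<epsilon> N" by blast
  qed
  obtain N where N: "negligible N"
    "\<forall>t\<in>{0<..<T}. \<exists>\<epsilon> M. \<epsilon> \<in> {0<..<t} \<and> M \<subseteq> N \<and> Pr \<epsilon> M"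
    using negligible_exhaustion[OF each] by (elim exE conjE) (rule that)
  show ?thesis
  proof (rule that)
    show "negligible N" by (rule N(1))
    fix s e assume s: "s \<in> {0<..<T} - N" and e: "0 < (e::real)"
    obtain \<epsilon> M where \<epsilon>: "\<epsilon> \<in> {0<..<s}" "M \<subseteq> N" "Pr \<epsilon> M" using bspec[OF N(2), of s] s by auto
    obtain D where D: "D \<subseteq> XS \<Omega> \<Omega>C"
      "\<forall>t\<in>{\<epsilon>..T} - M. \<exists>d. (\<forall>n. d n \<in> D) \<and> (\<lambda>n. l2_norm \<Omega> (\<lambda>x. d n x - w' t x)) \<longlonglongrightarrow> 0"
      "\<forall>t\<in>{\<epsilon><..T} - M. \<forall>d\<in>D. ((\<lambda>h. integral {t-h..t} (?n d) /\<^sub>R h) \<longlongrightarrow> ?n d t) (at_right 0)"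
      using \<epsilon>(3) unfolding Pr_def by blast
    have sk: "s \<in> {\<epsilon>..T} - M" "s \<in> {\<epsilon><..T} - M" using s \<epsilon>(1,2) by auto
    obtain ds where ds: "\<And>n. ds n \<in> D" "(\<lambda>n. l2_norm \<Omega> (\<lambda>x. ds n x - w' s x)) \<longlonglongrightarrow> 0"
      using D(2) sk(1) by blast
    have "\<forall>\<^sub>F n in sequentially. l2_norm \<Omega> (\<lambda>x. ds n x - w' s x) < e / 3"
      using ds(2) e by (intro order_tendstoD) auto
    then obtain n where "l2_norm \<Omega> (\<lambda>x. ds n x - w' s x) < e / 3" by (auto simp: eventually_sequentially)
    \<comment> \<open>The reference value d lies within e / 3 of w' s. The mean of the distance
      between w' and d just before s is then below 2 e / 3, and replacing d by w' s in the increment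
      costs another e / 3.\<close>
    then obtain d where d: "d \<in> D" "l2_norm \<Omega> (\<lambda>x. d x - w' s x) < e / 3" using ds(1) by blast
    have dX: "d \<in> XS \<Omega> \<Omega>C" using D(1) d(1) by blast
    have nd: "?n d s < e / 3" using d(2) l2_norm_minus_commute[of \<Omega> d "w' s"] by simp
    have "((\<lambda>h. integral {s-h..s} (?n d) /\<^sub>R h) \<longlongrightarrow> ?n d s) (at_right 0)" using D(3) sk(2) d(1) by blast
    then have "\<forall>\<^sub>F h in at_right 0. integral {s-h..s} (?n d) /\<^sub>R h < 2 * e / 3"
      using nd e by (intro order_tendstoD) auto
    then obtain \<delta> where \<delta>: "0 < \<delta>" "\<And>h. \<lbrakk>0 < h; h < \<delta>\<rbrakk> \<Longrightarrow> integral {s-h..s} (?n d) /\<^sub>R h < 2 * e / 3"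
      unfolding eventually_at_right_field by auto
    have "l2_norm \<Omega> (\<lambda>x. w s x - w r x - (s - r) *\<^sub>R w' s x) \<le> e * (s - r)"
      if r: "0 < r" "s - \<delta> < r" "r < s" for r
    proof -
      define I where "I = integral {r..s} (?n d)"
      have "I /\<^sub>R (s - r) < 2 * e / 3" using \<delta>(2)[of "s - r"] r unfolding I_def by simp
      then have A: "I \<le> 2 * e / 3 * (s - r)" using r by (simp add: field_simps)
      have L: "w s \<in> L2 \<Omega>" "w r \<in> L2 \<Omega>" "d \<in> L2 \<Omega>" using w_XS[of s] w_XS[of r] r s dX XS_L2 by auto
      have "l2_norm \<Omega> (\<lambda>x. (w s x - w r x) - (s - r) *\<^sub>R w' s x)
        \<le> l2_norm \<Omega> (\<lambda>x. (w s x - w r x) - (s - r) *\<^sub>R d x) + l2_norm \<Omega> (\<lambda>x. (s - r) *\<^sub>R d x - (s - r) *\<^sub>R w' s x)"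
        by (rule l2_norm_triangle_diff) (use L w'_L2 in auto)
      moreover have "l2_norm \<Omega> (\<lambda>x. (s - r) *\<^sub>R d x - (s - r) *\<^sub>R w' s x) = (s - r) * l2_norm \<Omega> (\<lambda>x. d x - w' s x)"
        using l2_norm_scaleR[of \<Omega> "s - r" "\<lambda>x. d x - w' s x"] r by (simp add: scaleR_diff_right)
      moreover have "(s - r) * l2_norm \<Omega> (\<lambda>x. d x - w' s x) \<le> (s - r) * (e / 3)"
        using d(2) r by (intro mult_left_mono) auto
      moreover have "l2_norm \<Omega> (\<lambda>x. (w s x - w r x) - (s - r) *\<^sub>R d x) \<le> I"
        unfolding I_def by (rule w_increment_norm[OF dX]) (use r s in auto)
      moreover have "2 * e / 3 * (s - r) + (s - r) * (e / 3) = e * (s - r)" by (simp add: field_simps)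
      ultimately show ?thesis using A by linarith
    qed
    then show "\<exists>d>0. \<forall>r. 0 < r \<and> s - d < r \<and> r < s \<longrightarrow>
         l2_norm \<Omega> (\<lambda>x. w s x - w r x - (s - r) *\<^sub>R w' s x) \<le> e * (s - r)"
      using \<delta>(1) by blast
  qed
qed

end

section \<open>The magnetic energy\<close>

text \<open>In the variable p = \<surd>\<rho>, the field strength, the density is a plain primitive
  of \<open>\<zeta> \<mapsto> \<nu> \<xi> \<zeta> * \<zeta>\<close>. Under
  \<open>reluctivity\<close> that integrand is nondecreasing, so the primitive is convex for p \<ge>
  0.\<close>

definition energy_primitive :: "(real^3 \<Rightarrow> real \<Rightarrow> real) \<Rightarrow> real^3 \<Rightarrow> real \<Rightarrow> real" where
  "energy_primitive \<nu> \<xi> p = integral {0..p} (\<lambda>\<zeta>. \<nu> \<xi> \<zeta> * \<zeta>)"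

text \<open>The constitutive law H = \<nu>(|B|) B with B = \<open>a\<close>; H is the gradient of
  the energy density as a function of B.\<close>

definition magnetic_field :: "(real^3 \<Rightarrow> real \<Rightarrow> real) \<Rightarrow> (real^3 \<Rightarrow> real^3) \<Rightarrow> real^3 \<Rightarrow> real^3" where
  "magnetic_field \<nu> a \<xi> = \<nu> \<xi> (norm (a \<xi>)) *\<^sub>R a \<xi>"

text \<open>The energy as a real functional of the curl, which keeps the value \<infinity> out of
  the analysis.\<close>

definition field_energy :: "(real^3) set \<Rightarrow> (real^3 \<Rightarrow> real \<Rightarrow> real) \<Rightarrow> (real^3 \<Rightarrow> real^3) \<Rightarrow> real" where
  "field_energy \<Omega> \<nu> a = (LINT \<xi>|lebesgue_on \<Omega>. energy_density \<nu> \<xi> ((norm (a \<xi>))\<^sup>2))"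

context
  fixes \<Omega> :: "(real^3) set" and \<nu> :: "real^3 \<Rightarrow> real \<Rightarrow> real" and m\<nu> L\<nu> :: real
  assumes rel: "reluctivity \<Omega> \<nu> m\<nu> L\<nu>"
begin

lemma reluctivity_constants: "0 < m\<nu>" "0 < L\<nu>"
  using rel by (auto simp: reluctivity_def)

lemma reluctivity_nonneg: "\<xi> \<in> \<Omega> \<Longrightarrow> 0 \<le> \<zeta> \<Longrightarrow> 0 \<le> \<nu> \<xi> \<zeta>"
  using rel by (auto simp: reluctivity_def)

lemma field_strength_lipschitz:
  "\<xi> \<in> \<Omega> \<Longrightarrow> 0 \<le> \<zeta> \<Longrightarrow> 0 \<le> \<eta> \<Longrightarrow> \<bar>\<nu> \<xi> \<zeta> * \<zeta> - \<nu> \<xi> \<eta> * \<eta>\<bar> \<le> L\<nu> * \<bar>\<zeta> - \<eta>\<bar>"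
  using rel by (auto simp: reluctivity_def)

lemma field_strength_strongly_mono:
  assumes "\<xi> \<in> \<Omega>" "0 \<le> \<eta>" "\<eta> \<le> \<zeta>"
  shows "m\<nu> * (\<zeta> - \<eta>) \<le> \<nu> \<xi> \<zeta> * \<zeta> - \<nu> \<xi> \<eta> * \<eta>"
proof (cases "\<eta> = \<zeta>")
  case False
  have "m\<nu> * (\<zeta> - \<eta>)\<^sup>2 \<le> (\<nu> \<xi> \<zeta> * \<zeta> - \<nu> \<xi> \<eta> * \<eta>) * (\<zeta> - \<eta>)"
    using rel assms by (auto simp: reluctivity_def)
  then have "(m\<nu> * (\<zeta> - \<eta>)) * (\<zeta> - \<eta>) \<le> (\<nu> \<xi> \<zeta> * \<zeta> - \<nu> \<xi> \<eta> * \<eta>) * (\<zeta> - \<eta>)"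
    by (simp add: power2_eq_square mult.assoc)
  then show ?thesis using assms False by (simp add: mult_le_cancel_right)
qed simp

lemma field_strength_mono:
  assumes "\<xi> \<in> \<Omega>" "0 \<le> \<eta>" "\<eta> \<le> \<zeta>"
  shows "\<nu> \<xi> \<eta> * \<eta> \<le> \<nu> \<xi> \<zeta> * \<zeta>"
  using field_strength_strongly_mono[OF assms] assms reluctivity_constants
    mult_nonneg_nonneg[of m\<nu> "\<zeta> - \<eta>"] by linarith

lemma field_strength_continuous:
  assumes "\<xi> \<in> \<Omega>" shows "continuous_on {0..} (\<lambda>\<zeta>. \<nu> \<xi> \<zeta> * \<zeta>)"
proof -
  have "L\<nu>-lipschitz_on {0..} (\<lambda>\<zeta>. \<nu> \<xi> \<zeta> * \<zeta>)"
    using field_strength_lipschitz[OF assms] reluctivity_constants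
    by (intro lipschitz_onI) (auto simp: dist_real_def)
  then show ?thesis by (rule lipschitz_on_continuous_on)
qed

lemma field_strength_integrable:
  assumes "\<xi> \<in> \<Omega>" "0 \<le> p" shows "(\<lambda>\<zeta>. \<nu> \<xi> \<zeta> * \<zeta>) integrable_on {p..q}"
  by (rule integrable_continuous_real, rule continuous_on_subset[OF field_strength_continuous]) (use assms in auto)

lemma energy_density_eq_primitive: "0 \<le> p \<Longrightarrow> energy_density \<nu> \<xi> (p\<^sup>2) = energy_primitive \<nu> \<xi> p"
  by (simp add: energy_density_def energy_primitive_def)

lemma energy_primitive_increment:
  assumes "\<xi> \<in> \<Omega>" "0 \<le> p" "p \<le> q"
  shows "\<nu> \<xi> p * p * (q - p) \<le> energy_primitive \<nu> \<xi> q - energy_primitive \<nu> \<xi> p" "energy_primitive \<nu> \<xi> q - energy_primitive \<nu> \<xi> p \<le> \<nu> \<xi> q * q * (q - p)"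
proof -
  have eq: "energy_primitive \<nu> \<xi> q - energy_primitive \<nu> \<xi> p = integral {p..q} (\<lambda>\<zeta>. \<nu> \<xi> \<zeta> * \<zeta>)"
    using Henstock_Kurzweil_Integration.integral_combine[of 0 p q "\<lambda>\<zeta>. \<nu> \<xi> \<zeta> * \<zeta>"] assms
      field_strength_integrable[of \<xi> 0] by (simp add: energy_primitive_def)
  have "integral {p..q} (\<lambda>\<zeta>. \<nu> \<xi> p * p) \<le> integral {p..q} (\<lambda>\<zeta>. \<nu> \<xi> \<zeta> * \<zeta>)"
    using assms by (intro integral_le field_strength_integrable field_strength_mono) auto
  then show "\<nu> \<xi> p * p * (q - p) \<le> energy_primitive \<nu> \<xi> q - energy_primitive \<nu> \<xi> p" using eq assms by (simp add: mult_ac)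
  have "integral {p..q} (\<lambda>\<zeta>. \<nu> \<xi> \<zeta> * \<zeta>) \<le> integral {p..q} (\<lambda>\<zeta>. \<nu> \<xi> q * q)"
    using assms by (intro integral_le field_strength_integrable field_strength_mono) auto
  then show "energy_primitive \<nu> \<xi> q - energy_primitive \<nu> \<xi> p \<le> \<nu> \<xi> q * q * (q - p)" using eq assms by (simp add: mult_ac)
qed

lemma energy_primitive_subgradient:
  assumes "\<xi> \<in> \<Omega>" "0 \<le> p" "0 \<le> q"
  shows "\<nu> \<xi> p * p * (q - p) \<le> energy_primitive \<nu> \<xi> q - energy_primitive \<nu> \<xi> p"
proof (cases "p \<le> q")
  case True
  then show ?thesis using energy_primitive_increment(1) assms by blast
next
  case False
  then have "energy_primitive \<nu> \<xi> p - energy_primitive \<nu> \<xi> q \<le> \<nu> \<xi> p * p * (p - q)" using energy_primitive_increment(2) assms by auto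
  then show ?thesis by (simp add: algebra_simps)
qed

text \<open>Comparison with the argument 0 in the two reluctivity conditions gives m\<nu> \<zeta>
  \<le> \<nu>(\<zeta>) \<zeta> \<le> L\<nu> \<zeta>, and this is integrated over [0, p]. The factor
  \<surd>(L\<nu> / m\<nu>) of the curl estimate originates here.\<close>

lemma energy_primitive_bounds:
  assumes "\<xi> \<in> \<Omega>" "0 \<le> p"
  shows "m\<nu> / 2 * p\<^sup>2 \<le> energy_primitive \<nu> \<xi> p" "energy_primitive \<nu> \<xi> p \<le> L\<nu> / 2 * p\<^sup>2"
proof -
  have I: "((\<lambda>\<zeta>. c * \<zeta>) has_integral c / 2 * p\<^sup>2) {0..p}" for c
  proof -
    have "((\<lambda>\<zeta>. c * \<zeta>) has_integral c / 2 * p\<^sup>2 - c / 2 * 0\<^sup>2) {0..p}"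
      using assms by (intro fundamental_theorem_of_calculus)
        (auto intro!: derivative_eq_intros simp: has_real_derivative_iff_has_vector_derivative[symmetric])
    then show ?thesis by simp
  qed
  have prim: "((\<lambda>\<zeta>. \<nu> \<xi> \<zeta> * \<zeta>) has_integral energy_primitive \<nu> \<xi> p) {0..p}"
    unfolding energy_primitive_def by (rule integrable_integral[OF field_strength_integrable]) (use assms in auto)
  show "m\<nu> / 2 * p\<^sup>2 \<le> energy_primitive \<nu> \<xi> p"
    by (rule has_integral_le[OF I prim]) (use field_strength_strongly_mono[of \<xi> 0] assms in auto)
  show "energy_primitive \<nu> \<xi> p \<le> L\<nu> / 2 * p\<^sup>2"
    by (rule has_integral_le[OF prim I]) (use field_strength_lipschitz[of \<xi> _ 0] assms in \<open>auto simp: abs_le_iff\<close>)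
qed

text \<open>Cauchy-Schwarz for the two vectors at \<xi>, together with \<nu> \<ge> 0, reduces the
  claim to the scalar subgradient inequality at their norms.\<close>

lemma energy_primitive_subgradient_vector:
  assumes "\<xi> \<in> \<Omega>"
  shows "magnetic_field \<nu> a \<xi> \<bullet> b \<xi> - magnetic_field \<nu> a \<xi> \<bullet> a \<xi> \<le> energy_primitive \<nu> \<xi> (norm (b \<xi>)) - energy_primitive \<nu> \<xi> (norm (a \<xi>))"
proof -
  have "magnetic_field \<nu> a \<xi> \<bullet> b \<xi> - magnetic_field \<nu> a \<xi> \<bullet> a \<xi> = \<nu> \<xi> (norm (a \<xi>)) * (a \<xi> \<bullet> b \<xi> - (norm (a \<xi>))\<^sup>2)"
    by (simp add: magnetic_field_def power2_norm_eq_inner algebra_simps)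
  also have "\<dots> \<le> \<nu> \<xi> (norm (a \<xi>)) * (norm (a \<xi>) * norm (b \<xi>) - (norm (a \<xi>))\<^sup>2)"
    using reluctivity_nonneg[OF assms] norm_cauchy_schwarz[of "a \<xi>" "b \<xi>"] by (intro mult_left_mono) auto
  also have "\<dots> = \<nu> \<xi> (norm (a \<xi>)) * norm (a \<xi>) * (norm (b \<xi>) - norm (a \<xi>))"
    by (simp add: power2_eq_square algebra_simps)
  also have "\<dots> \<le> energy_primitive \<nu> \<xi> (norm (b \<xi>)) - energy_primitive \<nu> \<xi> (norm (a \<xi>))"
    by (rule energy_primitive_subgradient[OF assms]) auto
  finally show ?thesis .
qed

lemma magnetic_field_bound: "\<xi> \<in> \<Omega> \<Longrightarrow> norm (magnetic_field \<nu> a \<xi>) \<le> L\<nu> * norm (a \<xi>)"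
  using field_strength_lipschitz[of \<xi> "norm (a \<xi>)" 0] reluctivity_nonneg[of \<xi> "norm (a \<xi>)"]
  by (simp add: magnetic_field_def abs_mult)

text \<open>\<nu> is only Lebesgue measurable on the product, and restricting it to a graph need not
  preserve that. Integration over \<zeta> is safe: exchanging \<nu> for a Borel function alters, for
  almost every \<xi>, only a null set of \<zeta> by Fubini. With \<open>p\<close> also exchanged for
  a Borel function, the parametric integral U is measurable and agrees with the original one almost
  everywhere.\<close>

lemma energy_primitive_measurable:
  assumes \<Omega>: "open \<Omega>" and p: "p \<in> borel_measurable (lebesgue_on \<Omega>)"
  shows "(\<lambda>\<xi>. energy_primitive \<nu> \<xi> (p \<xi>)) \<in> borel_measurable (lebesgue_on \<Omega>)"
proof -
  have \<Omega>m: "\<Omega> \<in> sets lebesgue" using \<Omega> by auto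
  define Q where "Q = \<Omega> \<times> {0::real..}"
  have "Q = (\<Omega> \<times> UNIV) \<inter> (UNIV \<times> {0..})" by (auto simp: Q_def)
  moreover have "open (\<Omega> \<times> (UNIV::real set))" "closed ((UNIV::(real^3) set) \<times> {0::real..})"
    using \<Omega> by (auto intro: open_Times closed_Times)
  ultimately have Q: "Q \<in> sets borel" by (metis borel_closed borel_open sets.Int)
  then have Qm: "Q \<in> sets lebesgue" by auto
  define f where "f x = indicat_real Q x *\<^sub>R (case x of (\<xi>, \<zeta>) \<Rightarrow> \<nu> \<xi> \<zeta>)" for x
  have "f \<in> borel_measurable lebesgue"
    using rel Qm unfolding f_def[abs_def] reluctivity_def Q_def[symmetric]
    by (simp add: borel_measurable_restrict_space_iff)
  then obtain g where g: "g \<in> borel_measurable lborel" "AE x in lborel. f x = g x"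
    using completion_ex_borel_measurable_real by blast
  have gm[measurable]: "g \<in> borel_measurable (lborel \<Otimes>\<^sub>M lborel)" using g(1) by (subst lborel_prod)
  have "AE x in lborel \<Otimes>\<^sub>M lborel. f x = g x" using g(2) by (subst lborel_prod)
  then have AE1: "AE \<xi> in lborel. AE \<zeta> in lborel. f (\<xi>, \<zeta>) = g (\<xi>, \<zeta>)"
    by (rule lborel_pair.AE_pair)
  define p0 where "p0 \<xi> = indicat_real \<Omega> \<xi> *\<^sub>R p \<xi>" for \<xi>
  have "p0 \<in> borel_measurable lebesgue"
    unfolding p0_def[abs_def] using p \<Omega>m by (simp add: borel_measurable_restrict_space_iff)
  then obtain p1 where p1: "p1 \<in> borel_measurable lborel" "AE \<xi> in lborel. p0 \<xi> = p1 \<xi>"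
    using completion_ex_borel_measurable_real by blast
  have [measurable]: "p1 \<in> borel_measurable lborel" by (rule p1(1))
  define U where "U \<xi> = (\<integral>\<zeta>. indicat_real {0..p1 \<xi>} \<zeta> * (g (\<xi>, \<zeta>) * \<zeta>) \<partial>lborel)" for \<xi>
  have [measurable]: "(\<lambda>(\<xi>, \<zeta>). indicat_real {0..p1 \<xi>} \<zeta> * (g (\<xi>, \<zeta>) * \<zeta>)) \<in> borel_measurable (lborel \<Otimes>\<^sub>M lborel)"
  proof -
    have "(\<lambda>x. indicat_real {0..p1 (fst x)} (snd x)) = (\<lambda>x. if 0 \<le> snd x \<and> snd x \<le> p1 (fst x) then 1 else 0)"
      by (auto simp: indicator_def)
    then have [measurable]: "(\<lambda>x. indicat_real {0..p1 (fst x)} (snd x)) \<in> borel_measurable (lborel \<Otimes>\<^sub>M lborel)"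
      by simp
    show ?thesis unfolding split_beta' by measurable
  qed
  have "U \<in> borel_measurable lborel" unfolding U_def by measurable
  then have Um: "U \<in> borel_measurable lebesgue" by (rule measurable_completion)
  have AE2: "AE \<xi> in lborel. \<xi> \<in> \<Omega> \<longrightarrow> U \<xi> = energy_primitive \<nu> \<xi> (p \<xi>)"
    using AE1 p1(2)
  proof eventually_elim
    case (elim \<xi>)
    show ?case
    proof
      assume \<xi>: "\<xi> \<in> \<Omega>"
      then have pp: "p1 \<xi> = p \<xi>" using elim(2) by (simp add: p0_def)
      have c: "continuous_on {0..p \<xi>} (\<lambda>\<zeta>. \<nu> \<xi> \<zeta> * \<zeta>)"
        by (rule continuous_on_subset[OF field_strength_continuous[OF \<xi>]]) auto
      have "U \<xi> = (\<integral>\<zeta>. indicat_real {0..p \<xi>} \<zeta> *\<^sub>R (\<nu> \<xi> \<zeta> * \<zeta>) \<partial>lborel)"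
        unfolding U_def pp
      proof (rule integral_cong_AE)
        have [measurable]: "(\<lambda>\<zeta>. g (\<xi>, \<zeta>)) \<in> borel_measurable lborel"
          using measurable_compose_Pair1[of \<xi> lborel g lborel borel] gm by simp
        show "(\<lambda>\<zeta>. indicat_real {0..p \<xi>} \<zeta> * (g (\<xi>, \<zeta>) * \<zeta>)) \<in> borel_measurable lborel" by measurable
        show "(\<lambda>\<zeta>. indicat_real {0..p \<xi>} \<zeta> *\<^sub>R (\<nu> \<xi> \<zeta> * \<zeta>)) \<in> borel_measurable lborel"
          using borel_measurable_continuous_on_indicator[OF _ c] by simp
        show "AE \<zeta> in lborel. indicat_real {0..p \<xi>} \<zeta> * (g (\<xi>, \<zeta>) * \<zeta>) = indicat_real {0..p \<xi>} \<zeta> *\<^sub>R (\<nu> \<xi> \<zeta> * \<zeta>)"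
          using elim(1) by eventually_elim (use \<xi> in \<open>auto simp: f_def Q_def indicator_def\<close>)
      qed
      also have "\<dots> = integral {0..p \<xi>} (\<lambda>\<zeta>. \<nu> \<xi> \<zeta> * \<zeta>)"
        using set_borel_integral_eq_integral(2)[OF borel_integrable_atLeastAtMost'[OF c]]
        by (simp add: set_lebesgue_integral_def)
      finally show "U \<xi> = energy_primitive \<nu> \<xi> (p \<xi>)" by (simp add: energy_primitive_def)
    qed
  qed
  have "(\<lambda>\<xi>. indicat_real \<Omega> \<xi> *\<^sub>R energy_primitive \<nu> \<xi> (p \<xi>)) \<in> borel_measurable lebesgue"
  proof (rule borel_measurable_AE)
    show "(\<lambda>\<xi>. indicat_real \<Omega> \<xi> *\<^sub>R U \<xi>) \<in> borel_measurable lebesgue"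
      using Um \<Omega>m by (intro borel_measurable_scaleR borel_measurable_indicator) auto
    show "AE \<xi> in lebesgue. indicat_real \<Omega> \<xi> *\<^sub>R U \<xi> = indicat_real \<Omega> \<xi> *\<^sub>R energy_primitive \<nu> \<xi> (p \<xi>)"
      using AE_completion[OF AE2] by eventually_elim (auto simp: indicator_def)
  qed
  then show ?thesis using \<Omega>m by (simp add: borel_measurable_restrict_space_iff)
qed

text \<open>Composition does not give measurability when \<open>p\<close> is substituted into a
  Lebesgue measurable \<nu>. But \<nu>(\<zeta>) \<zeta> is Lipschitz in \<zeta>, hence the limit of
  right difference quotients of \<open>energy_primitive\<close>, and these are measurable by
  \<open>energy_primitive_measurable\<close>.\<close>

lemma field_strength_measurable:
  assumes \<Omega>: "open \<Omega>" and p: "p \<in> borel_measurable (lebesgue_on \<Omega>)" and p0: "\<And>\<xi>. 0 \<le> p \<xi>"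
  shows "(\<lambda>\<xi>. \<nu> \<xi> (p \<xi>) * p \<xi>) \<in> borel_measurable (lebesgue_on \<Omega>)"
proof (rule borel_measurable_LIMSEQ_real)
  show "(\<lambda>\<xi>. real (Suc k) * (energy_primitive \<nu> \<xi> (p \<xi> + 1 / Suc k) - energy_primitive \<nu> \<xi> (p \<xi>))) \<in> borel_measurable (lebesgue_on \<Omega>)" for k
    using p by (intro borel_measurable_times borel_measurable_diff energy_primitive_measurable[OF \<Omega>] borel_measurable_add) auto
  fix \<xi> assume "\<xi> \<in> space (lebesgue_on \<Omega>)"
  then have \<xi>: "\<xi> \<in> \<Omega>" by simp
  have up: "(\<lambda>k. \<nu> \<xi> (p \<xi>) * p \<xi> + L\<nu> * (1 / real (Suc k))) \<longlonglongrightarrow> \<nu> \<xi> (p \<xi>) * p \<xi> + L\<nu> * 0"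
    using LIMSEQ_inverse_real_of_nat by (intro tendsto_intros) (simp add: inverse_eq_divide)
  show "(\<lambda>k. real (Suc k) * (energy_primitive \<nu> \<xi> (p \<xi> + 1 / Suc k) - energy_primitive \<nu> \<xi> (p \<xi>))) \<longlonglongrightarrow> \<nu> \<xi> (p \<xi>) * p \<xi>"
  proof (rule tendsto_sandwich[OF _ _ tendsto_const up[simplified]])
    have k: "\<nu> \<xi> (p \<xi>) * p \<xi> \<le> real (Suc k) * (energy_primitive \<nu> \<xi> (p \<xi> + 1 / Suc k) - energy_primitive \<nu> \<xi> (p \<xi>))"
      "real (Suc k) * (energy_primitive \<nu> \<xi> (p \<xi> + 1 / Suc k) - energy_primitive \<nu> \<xi> (p \<xi>)) \<le> \<nu> \<xi> (p \<xi>) * p \<xi> + L\<nu> * (1 / real (Suc k))" for k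
    proof -
      define q where "q = p \<xi> + 1 / Suc k"
      have q: "p \<xi> \<le> q" "0 \<le> q" "q - p \<xi> = 1 / Suc k" using p0[of \<xi>] by (auto simp: q_def)
      have "real (Suc k) * (\<nu> \<xi> (p \<xi>) * p \<xi> * (q - p \<xi>)) \<le> real (Suc k) * (energy_primitive \<nu> \<xi> q - energy_primitive \<nu> \<xi> (p \<xi>))"
        by (rule mult_left_mono[OF energy_primitive_increment(1)[OF \<xi> p0 q(1)]]) simp
      then show "\<nu> \<xi> (p \<xi>) * p \<xi> \<le> real (Suc k) * (energy_primitive \<nu> \<xi> (p \<xi> + 1 / Suc k) - energy_primitive \<nu> \<xi> (p \<xi>))"
        unfolding q(3) by (simp add: q_def)
      have "real (Suc k) * (energy_primitive \<nu> \<xi> q - energy_primitive \<nu> \<xi> (p \<xi>)) \<le> real (Suc k) * (\<nu> \<xi> q * q * (q - p \<xi>))"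
        by (rule mult_left_mono[OF energy_primitive_increment(2)[OF \<xi> p0 q(1)]]) simp
      also have "\<dots> = \<nu> \<xi> q * q" unfolding q(3) by simp
      also have "\<dots> \<le> \<nu> \<xi> (p \<xi>) * p \<xi> + L\<nu> * (q - p \<xi>)"
        using field_strength_lipschitz[OF \<xi> q(2) p0[of \<xi>]] q(1) by (simp add: abs_le_iff)
      finally show "real (Suc k) * (energy_primitive \<nu> \<xi> (p \<xi> + 1 / Suc k) - energy_primitive \<nu> \<xi> (p \<xi>)) \<le> \<nu> \<xi> (p \<xi>) * p \<xi> + L\<nu> * (1 / real (Suc k))"
        unfolding q(3) by (simp add: q_def)
    qed
    show "\<forall>\<^sub>F k in sequentially. \<nu> \<xi> (p \<xi>) * p \<xi> \<le> real (Suc k) * (energy_primitive \<nu> \<xi> (p \<xi> + 1 / Suc k) - energy_primitive \<nu> \<xi> (p \<xi>))"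
      using k(1) by (intro always_eventually allI)
    show "\<forall>\<^sub>F k in sequentially. real (Suc k) * (energy_primitive \<nu> \<xi> (p \<xi> + 1 / Suc k) - energy_primitive \<nu> \<xi> (p \<xi>)) \<le> \<nu> \<xi> (p \<xi>) * p \<xi> + L\<nu> / (1 + real k)"
      using k(2) by (intro always_eventually allI) (simp add: add.commute)
  qed
qed

lemma magnetic_field_L2:
  assumes \<Omega>: "open \<Omega>" and a: "a \<in> L2 \<Omega>"
  shows "magnetic_field \<nu> a \<in> L2 \<Omega>"
proof (rule L2_bound[OF _ a magnetic_field_bound[of _ a]])
  have am: "a \<in> borel_measurable (lebesgue_on \<Omega>)" using a by (rule L2_measurable)
  \<comment> \<open>Division by zero yields 0, so the formula also holds where a \<xi> = 0; it
    expresses the field through the product treated in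
    \<open>field_strength_measurable\<close>.\<close>
  have eq: "magnetic_field \<nu> a = (\<lambda>\<xi>. (\<nu> \<xi> (norm (a \<xi>)) * norm (a \<xi>) / norm (a \<xi>)) *\<^sub>R a \<xi>)"
    by (auto simp: magnetic_field_def fun_eq_iff)
  show "magnetic_field \<nu> a \<in> borel_measurable (lebesgue_on \<Omega>)"
    unfolding eq using am
    by (intro borel_measurable_scaleR borel_measurable_divide field_strength_measurable[OF \<Omega>]) auto
qed

lemma magnetic_field_norm:
  assumes \<Omega>: "open \<Omega>" and a: "a \<in> L2 \<Omega>"
  shows "l2_norm \<Omega> (magnetic_field \<nu> a) \<le> L\<nu> * l2_norm \<Omega> a"
proof -
  have "(LINT \<xi>|lebesgue_on \<Omega>. (norm (magnetic_field \<nu> a \<xi>))\<^sup>2) \<le> (LINT \<xi>|lebesgue_on \<Omega>. (norm (L\<nu> *\<^sub>R a \<xi>))\<^sup>2)"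
  proof (rule integral_mono)
    fix \<xi> assume "\<xi> \<in> space (lebesgue_on \<Omega>)"
    then show "(norm (magnetic_field \<nu> a \<xi>))\<^sup>2 \<le> (norm (L\<nu> *\<^sub>R a \<xi>))\<^sup>2"
      using magnetic_field_bound[of \<xi> a] reluctivity_constants by (intro power_mono) auto
  qed (use magnetic_field_L2[OF \<Omega> a] L2_scaleR[OF a, of L\<nu>] in \<open>auto simp: L2_def\<close>)
  then have "l2_norm \<Omega> (magnetic_field \<nu> a) \<le> l2_norm \<Omega> (\<lambda>\<xi>. L\<nu> *\<^sub>R a \<xi>)"
    unfolding l2_norm_def by (rule real_sqrt_le_mono)
  then show ?thesis using reluctivity_constants by (simp add: l2_norm_scaleR)
qed

lemma field_energy_eq_primitive: "field_energy \<Omega> \<nu> a = (LINT \<xi>|lebesgue_on \<Omega>. energy_primitive \<nu> \<xi> (norm (a \<xi>)))"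
  by (simp add: field_energy_def energy_density_eq_primitive)

lemma energy_primitive_integrable:
  assumes \<Omega>: "open \<Omega>" and a: "a \<in> L2 \<Omega>"
  shows "integrable (lebesgue_on \<Omega>) (\<lambda>\<xi>. energy_primitive \<nu> \<xi> (norm (a \<xi> :: real^3)))"
proof (rule Bochner_Integration.integrable_bound)
  show "integrable (lebesgue_on \<Omega>) (\<lambda>\<xi>. L\<nu> / 2 * (norm (a \<xi>))\<^sup>2)" using a by (simp add: L2_def)
  show "(\<lambda>\<xi>. energy_primitive \<nu> \<xi> (norm (a \<xi>))) \<in> borel_measurable (lebesgue_on \<Omega>)"
    using L2_measurable[OF a] by (intro energy_primitive_measurable[OF \<Omega>]) simp
  show "AE \<xi> in lebesgue_on \<Omega>. norm (energy_primitive \<nu> \<xi> (norm (a \<xi>))) \<le> norm (L\<nu> / 2 * (norm (a \<xi>))\<^sup>2)"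
  proof (rule AE_I2)
    fix \<xi> assume "\<xi> \<in> space (lebesgue_on \<Omega>)"
    then have "m\<nu> / 2 * (norm (a \<xi>))\<^sup>2 \<le> energy_primitive \<nu> \<xi> (norm (a \<xi>))" "energy_primitive \<nu> \<xi> (norm (a \<xi>)) \<le> L\<nu> / 2 * (norm (a \<xi>))\<^sup>2"
      using energy_primitive_bounds[of \<xi> "norm (a \<xi>)"] by auto
    moreover have "0 \<le> m\<nu> / 2 * (norm (a \<xi>))\<^sup>2" using reluctivity_constants by simp
    ultimately show "norm (energy_primitive \<nu> \<xi> (norm (a \<xi>))) \<le> norm (L\<nu> / 2 * (norm (a \<xi>))\<^sup>2)" by simp
  qed
qed

lemma field_energy_bounds:
  assumes \<Omega>: "open \<Omega>" and a: "a \<in> L2 \<Omega>"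
  shows "m\<nu> / 2 * (l2_norm \<Omega> a)\<^sup>2 \<le> field_energy \<Omega> \<nu> a" "field_energy \<Omega> \<nu> a \<le> L\<nu> / 2 * (l2_norm \<Omega> a)\<^sup>2"
proof -
  have i: "integrable (lebesgue_on \<Omega>) (\<lambda>\<xi>. (norm (a \<xi>))\<^sup>2)" using a by (simp add: L2_def)
  have n: "(l2_norm \<Omega> a)\<^sup>2 = (LINT \<xi>|lebesgue_on \<Omega>. (norm (a \<xi>))\<^sup>2)"
    by (simp add: l2_norm_def)
  have "(LINT \<xi>|lebesgue_on \<Omega>. m\<nu> / 2 * (norm (a \<xi>))\<^sup>2) \<le> field_energy \<Omega> \<nu> a"
    unfolding field_energy_eq_primitive by (rule integral_mono) (use i energy_primitive_integrable[OF \<Omega> a] energy_primitive_bounds in auto)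
  then show "m\<nu> / 2 * (l2_norm \<Omega> a)\<^sup>2 \<le> field_energy \<Omega> \<nu> a" by (simp add: n)
  have "field_energy \<Omega> \<nu> a \<le> (LINT \<xi>|lebesgue_on \<Omega>. L\<nu> / 2 * (norm (a \<xi>))\<^sup>2)"
    unfolding field_energy_eq_primitive by (rule integral_mono) (use i energy_primitive_integrable[OF \<Omega> a] energy_primitive_bounds in auto)
  then show "field_energy \<Omega> \<nu> a \<le> L\<nu> / 2 * (l2_norm \<Omega> a)\<^sup>2" by (simp add: n)
qed

lemma field_energy_nonneg: "open \<Omega> \<Longrightarrow> a \<in> L2 \<Omega> \<Longrightarrow> 0 \<le> field_energy \<Omega> \<nu> a"
  using field_energy_bounds(1)[of a] reluctivity_constants by (smt (verit) mult_nonneg_nonneg divide_nonneg_nonneg zero_le_power2)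

lemma field_energy_subgradient:
  assumes \<Omega>: "open \<Omega>" and a: "a \<in> L2 \<Omega>" and b: "b \<in> L2 \<Omega>"
  shows "l2_inner \<Omega> (magnetic_field \<nu> a) b - l2_inner \<Omega> (magnetic_field \<nu> a) a \<le> field_energy \<Omega> \<nu> b - field_energy \<Omega> \<nu> a"
proof -
  have i: "integrable (lebesgue_on \<Omega>) (\<lambda>\<xi>. magnetic_field \<nu> a \<xi> \<bullet> b \<xi>)" "integrable (lebesgue_on \<Omega>) (\<lambda>\<xi>. magnetic_field \<nu> a \<xi> \<bullet> a \<xi>)"
    by (intro L2_integrable_inner magnetic_field_L2 assms)+
  have "(LINT \<xi>|lebesgue_on \<Omega>. magnetic_field \<nu> a \<xi> \<bullet> b \<xi> - magnetic_field \<nu> a \<xi> \<bullet> a \<xi>)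
      \<le> (LINT \<xi>|lebesgue_on \<Omega>. energy_primitive \<nu> \<xi> (norm (b \<xi>)) - energy_primitive \<nu> \<xi> (norm (a \<xi>)))"
    by (rule integral_mono) (use i energy_primitive_integrable[OF \<Omega>] a b energy_primitive_subgradient_vector in auto)
  then show ?thesis using i energy_primitive_integrable[OF \<Omega>] a b by (simp add: field_energy_eq_primitive l2_inner_def)
qed

text \<open>The subgradient inequality is used in both directions, together with
  \<open>magnetic_field_norm\<close>. The resulting local Lipschitz continuity makes the energy of
  A(t) a measurable function of time.\<close>

lemma field_energy_diff_bound:
  assumes \<Omega>: "open \<Omega>" and a: "a \<in> L2 \<Omega>" and b: "b \<in> L2 \<Omega>"
  shows "\<bar>field_energy \<Omega> \<nu> b - field_energy \<Omega> \<nu> a\<bar> \<le> L\<nu> * (l2_norm \<Omega> a + l2_norm \<Omega> b) * l2_norm \<Omega> (\<lambda>\<xi>. b \<xi> - a \<xi>)"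
proof -
  have *: "- (L\<nu> * l2_norm \<Omega> a * l2_norm \<Omega> (\<lambda>\<xi>. b \<xi> - a \<xi>)) \<le> field_energy \<Omega> \<nu> b - field_energy \<Omega> \<nu> a" if a: "a \<in> L2 \<Omega>" and b: "b \<in> L2 \<Omega>" for a b
  proof -
    have "\<bar>l2_inner \<Omega> (magnetic_field \<nu> a) (\<lambda>\<xi>. b \<xi> - a \<xi>)\<bar> \<le> l2_norm \<Omega> (magnetic_field \<nu> a) * l2_norm \<Omega> (\<lambda>\<xi>. b \<xi> - a \<xi>)"
      by (intro l2_Cauchy_Schwarz magnetic_field_L2 \<Omega> a L2_diff b)
    also have "\<dots> \<le> L\<nu> * l2_norm \<Omega> a * l2_norm \<Omega> (\<lambda>\<xi>. b \<xi> - a \<xi>)"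
      by (intro mult_right_mono magnetic_field_norm \<Omega> a) simp
    finally show ?thesis
      using field_energy_subgradient[OF \<Omega> a b] l2_inner_diff_right[OF b a magnetic_field_L2[OF \<Omega> a]] by simp
  qed
  have "0 \<le> L\<nu> * l2_norm \<Omega> a * l2_norm \<Omega> (\<lambda>\<xi>. b \<xi> - a \<xi>)" "0 \<le> L\<nu> * l2_norm \<Omega> b * l2_norm \<Omega> (\<lambda>\<xi>. b \<xi> - a \<xi>)"
    using reluctivity_constants by simp_all
  then show ?thesis
    using *[OF a b] *[OF b a] l2_norm_minus_commute[of \<Omega> a b] by (simp add: algebra_simps abs_le_iff)
qed

end

section \<open>Energy decay\<close>

lemma spd_matrix_inv:
  fixes R :: "real^'m^'m"
  assumes R: "spd R"
  shows "matrix_inv R *v (R *v x) = x" "R *v (matrix_inv R *v x) = x" "spd (matrix_inv R)"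
proof -
  have inv: "R ** matrix_inv R = mat 1 \<and> matrix_inv R ** R = mat 1"
    using spd_invertible[OF R] unfolding matrix_inv_def invertible_def by (rule someI_ex)
  then show l: "matrix_inv R *v (R *v x) = x" and r: "R *v (matrix_inv R *v x) = x" for x
    by (simp_all add: matrix_vector_mul_assoc)
  have adj: "x \<bullet> (matrix_inv R *v y) = (matrix_inv R *v x) \<bullet> y" for x y
  proof -
    have "x \<bullet> (matrix_inv R *v y) = (R *v (matrix_inv R *v x)) \<bullet> (matrix_inv R *v y)" by (simp add: r)
    also have "\<dots> = (matrix_inv R *v x) \<bullet> (R *v (matrix_inv R *v y))"
      by (rule spd_adjoint[OF R, symmetric])
    finally show ?thesis by (simp add: r)
  qed
  then have "x \<bullet> (matrix_inv R *v y) = x \<bullet> (transpose (matrix_inv R) *v y)" for x y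
    by (simp add: dot_lmul_matrix flip: vector_transpose_matrix)
  then have t: "transpose (matrix_inv R) = matrix_inv R"
    by (metis matrix_eq vector_eq_ldot)
  have "0 < x \<bullet> (matrix_inv R *v x)" if "x \<noteq> 0" for x
  proof -
    have "matrix_inv R *v x \<noteq> 0" using r[of x] that by (metis matrix_vector_mult_0_right)
    then have "0 < (matrix_inv R *v x) \<bullet> (R *v (matrix_inv R *v x))"
      using R unfolding spd_def by blast
    then show ?thesis by (simp add: r inner_commute)
  qed
  with t show "spd (matrix_inv R)" unfolding spd_def by blast
qed

lemma negligible_avoid:
  fixes a b :: real
  assumes "negligible N" "a < b"
  obtains x where "a < x" "x < b" "x \<notin> N"
proof -
  have "\<not> negligible {a<..<b}" using assms(2) by (intro open_not_negligible) auto
  then have "\<not> {a<..<b} \<subseteq> N" using assms(1) negligible_subset by blast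
  then obtain x where "x \<in> {a<..<b}" "x \<notin> N" by blast
  then show ?thesis using that[of x] by simp
qed

text \<open>Expand the nonnegative form at a - b. The gradient is taken at \<open>a\<close>, the
  later time in the application, to match left difference quotients.\<close>

lemma quadratic_increment:
  fixes Q :: "real^'m^'m"
  assumes Q: "spd Q"
  shows "a \<bullet> (Q *v a) - b \<bullet> (Q *v b) \<le> 2 * ((a - b) \<bullet> (Q *v a))"
proof -
  have "0 \<le> (a - b) \<bullet> (Q *v (a - b))"
    using Q unfolding spd_def by (cases "a - b = 0") (auto intro: less_imp_le)
  then show ?thesis using spd_adjoint[OF Q, of a b]
    by (simp add: matrix_vector_mult_diff_distrib inner_simps inner_commute)
qed

lemma l2_quadratic_increment:
  assumes "f \<in> L2 S" "g \<in> L2 S" "h \<in> L2 S"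
  shows "(l2_norm S (\<lambda>x. f x - h x))\<^sup>2 - (l2_norm S (\<lambda>x. g x - h x))\<^sup>2
    \<le> 2 * l2_inner S (\<lambda>x. f x - g x) (\<lambda>x. f x - h x)"
proof -
  define a b where "a x = f x - h x" and "b x = g x - h x" for x
  have L: "a \<in> L2 S" "b \<in> L2 S" using assms unfolding a_def[abs_def] b_def[abs_def] by auto
  have "0 \<le> (l2_norm S (\<lambda>x. a x - b x))\<^sup>2" by simp
  also have "\<dots> = (l2_norm S a)\<^sup>2 - 2 * l2_inner S a b + (l2_norm S b)\<^sup>2"
    unfolding l2_norm_power2
    using L by (simp add: l2_inner_diff_left l2_inner_diff_right L2_diff l2_inner_commute[of S b a])
  finally have "(l2_norm S a)\<^sup>2 - (l2_norm S b)\<^sup>2 \<le> 2 * (l2_inner S a a - l2_inner S b a)"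
    by (simp add: l2_norm_power2 l2_inner_commute[of S b a])
  also have "\<dots> = 2 * l2_inner S (\<lambda>x. a x - b x) a" using L by (simp add: l2_inner_diff_left)
  also have "(\<lambda>x. a x - b x) = (\<lambda>x. f x - g x)" by (simp add: a_def b_def)
  finally show ?thesis by (simp add: a_def[abs_def] b_def[abs_def])
qed

lemma matrix_vector_L2:
  fixes v :: "'a::euclidean_space \<Rightarrow> real^'n" and M :: "real^'n^'k"
  assumes v: "v \<in> L2 S"
  shows "(\<lambda>s. M *v v s) \<in> L2 S"
proof -
  obtain K where K: "\<And>x. norm (M *v x) \<le> norm x * K"
    using bounded_linear.pos_bounded[OF matrix_vector_mul_bounded_linear[of M]] by blast
  show ?thesis
  proof (rule L2_bound[OF _ v, of _ K])
    have "(\<lambda>x. M *v x) \<in> borel_measurable borel"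
      by (intro borel_measurable_continuous_onI continuous_intros)
    then show "(\<lambda>s. M *v v s) \<in> borel_measurable (lebesgue_on S)"
      using measurable_compose[OF L2_measurable[OF v]] by blast
    show "norm (M *v v s) \<le> K * norm (v s)" for s using K[of "v s"] by (simp add: mult.commute)
  qed
qed

section \<open>Energy decay from the abstract increment inequalities\<close>

context
  fixes T :: real and \<Omega> \<Omega>C :: "(real^3) set" and w w' :: "real \<Rightarrow> real^3 \<Rightarrow> real^3"
    and y y' i v :: "real \<Rightarrow> real^'m" and R :: "real^'m^'m" and \<sigma> :: real
    and E :: "real \<Rightarrow> real" and E0 :: real and N :: "real set"
  assumes T: "0 < T"
    and w: "w \<in> bochner_C {0..T} (XS \<Omega> \<Omega>C) (l2_norm \<Omega>)"
    and w': "bochner_H1loc_deriv T \<Omega> (XS \<Omega> \<Omega>C) w w'"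
    and w'X: "\<And>t. w' t \<in> XS \<Omega> \<Omega>C"
    and y: "continuous_on {0..T} y" and y': "H1loc_deriv T y y'"
    and i: "\<And>\<epsilon>. \<epsilon> \<in> {0<..<T} \<Longrightarrow> i \<in> L2 {\<epsilon>..T}"
    and v: "v \<in> L2 {0..T}"
    and R: "spd R" and \<sigma>: "0 < \<sigma>"
    and E: "integrable (lebesgue_on {0..T}) E" "\<And>t. 0 \<le> E t" and E0: "0 \<le> E0"
    and N: "negligible N"
    and law: "\<And>s. s \<in> {0<..<T} - N \<Longrightarrow> y' s + R *v i s = v s"
    and KI: "\<And>s r. \<lbrakk>s \<in> {0<..<T} - N; r \<in> {0<..<T} - N\<rbrakk> \<Longrightarrow>
      E s - E r \<le> i s \<bullet> (y s - y r) - 1 / \<sigma> * l2_inner \<Omega> (w' s) (\<lambda>x. w s x - w r x)"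
    and KI0: "\<And>s. s \<in> {0<..<T} - N \<Longrightarrow>
      E s - E0 \<le> i s \<bullet> (y s - y 0) - 1 / \<sigma> * l2_inner \<Omega> (w' s) (\<lambda>x. w s x - w 0 x)"
begin

text \<open>By \<open>spd_power_bound\<close> this majorises the net power i \<bullet> (v - R i). It
  is integrable down to t = 0, while the current is controlled only away from 0.\<close>

definition power_bound where "power_bound s = 1 / 4 * (norm (inv_sqrt R *v v s))\<^sup>2"

lemma power_bound_integrable: "integrable (lebesgue_on {0..T}) power_bound"
  using matrix_vector_L2[OF v, of "inv_sqrt R"] unfolding power_bound_def[abs_def] by (simp add: L2_def)

lemma power_bound_nonneg: "0 \<le> power_bound s" by (simp add: power_bound_def)

lemma w_L2: "t \<in> {0..T} \<Longrightarrow> w t \<in> L2 \<Omega>"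
  using w_XS[OF w w' w'X] XS_L2 by blast

lemma w'_in_L2: "w' t \<in> L2 \<Omega>"
  using w'X XS_L2 by blast

lemma y'_L2: "\<epsilon> \<in> {0<..<T} \<Longrightarrow> y' \<in> L2 {\<epsilon>..T}"
  using y' by (auto simp: H1loc_deriv_def)

lemma y_increment:
  assumes "0 < r" "r < s" "s < T" shows "y s - y r = integral {r..s} y'"
proof (rule weak_deriv_increment[OF _ _ _ assms])
  show "weak_deriv_on 0 T y y'" using y' by (auto simp: H1loc_deriv_def)
  show "continuous_on {0<..<T} y" by (rule continuous_on_subset[OF y]) auto
  show "integrable (lebesgue_on {\<epsilon>..<T}) y'" if "0 < \<epsilon>" for \<epsilon>
  proof (cases "\<epsilon> < T")
    case True
    show ?thesis
      by (rule integrable_lebesgue_on_subset[OF L2_integrable_Icc[OF y'_L2[of \<epsilon>]]]) (use True that in auto)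
  next
    case False
    then have "{\<epsilon>..<T} = {}" by simp
    then show ?thesis by (simp add: integrable_restrict_space)
  qed
qed

text \<open>One scalar majorant for the speeds of y and w, so that a single application of
  \<open>increment_upper_bound\<close> handles both.\<close>

definition rate where "rate s = norm (y' s) + l2_norm \<Omega> (w' s)"

lemma w'_norm_in_L2: "\<epsilon> \<in> {0<..<T} \<Longrightarrow> (\<lambda>s. l2_norm \<Omega> (w' s)) \<in> L2 {\<epsilon>..T}"
  using w'_norm_L2[OF w w' w'X _ XS_zero] by simp

lemma norm_L2: "f \<in> L2 S \<Longrightarrow> (\<lambda>s. norm (f s)) \<in> L2 S"
  by (auto simp: L2_def)

lemma rate_L2: "\<epsilon> \<in> {0<..<T} \<Longrightarrow> rate \<in> L2 {\<epsilon>..T}"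
  unfolding rate_def[abs_def] by (intro L2_add norm_L2 y'_L2 w'_norm_in_L2)

lemma increments_le:
  assumes "0 < r" "r < s" "s < T"
  shows "norm (y s - y r) \<le> integral {r..s} rate" "l2_norm \<Omega> (\<lambda>x. w s x - w r x) \<le> integral {r..s} rate"
proof -
  have r: "r \<in> {0<..<T}" using assms by auto
  have sub: "f integrable_on {r..s}" if "f \<in> L2 {r..T}" for f :: "real \<Rightarrow> 'b::euclidean_space"
    by (rule integrable_on_lebesgue_on[OF integrable_lebesgue_on_subset[OF L2_integrable_Icc[OF that]]])
      (use assms in auto)
  show "norm (y s - y r) \<le> integral {r..s} rate"
    unfolding y_increment[OF assms]
    by (rule integral_norm_bound_integral) (auto simp: rate_def intro!: sub y'_L2 r rate_L2)
  have "l2_norm \<Omega> (\<lambda>x. w s x - w r x) \<le> integral {r..s} (\<lambda>t. l2_norm \<Omega> (w' t))"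
    using w_increment_norm[OF w w' w'X XS_zero assms] by simp
  also have "\<dots> \<le> integral {r..s} rate"
    by (rule integral_le[OF sub[OF w'_norm_in_L2[OF r]] sub[OF rate_L2[OF r]]]) (simp add: rate_def)
  finally show "l2_norm \<Omega> (\<lambda>x. w s x - w r x) \<le> integral {r..s} rate" .
qed

lemma common_left_derivative:
  obtains M where "negligible M"
    "\<And>s e. \<lbrakk>s \<in> {0<..<T} - M; 0 < e\<rbrakk> \<Longrightarrow>
       \<exists>d>0. \<forall>r. 0 < r \<and> s - d < r \<and> r < s \<longrightarrow>
         norm (y s - y r - (s - r) *\<^sub>R y' s) \<le> e * (s - r) \<and>
         l2_norm \<Omega> (\<lambda>x. w s x - w r x - (s - r) *\<^sub>R w' s x) \<le> e * (s - r)"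
proof -
  obtain M1 where M1: "negligible M1"
    "\<And>s e. \<lbrakk>s \<in> {0<..<T} - M1; 0 < e\<rbrakk> \<Longrightarrow>
       \<exists>d>0. \<forall>r. 0 < r \<and> s - d < r \<and> r < s \<longrightarrow>
         l2_norm \<Omega> (\<lambda>x. w s x - w r x - (s - r) *\<^sub>R w' s x) \<le> e * (s - r)"
    using w_left_derivative[OF w w' w'X] by blast
  obtain M2 where M2: "negligible M2"
    "\<And>s e. \<lbrakk>s \<in> {0<..<T} - M2; 0 < e\<rbrakk> \<Longrightarrow>
       \<exists>d>0. \<forall>r. 0 < r \<and> s - d < r \<and> r < s \<longrightarrow> norm (y s - y r - (s - r) *\<^sub>R y' s) \<le> e * (s - r)"
    using increment_left_derivative[of T y' y] L2_integrable_Icc[OF y'_L2] y_increment by blast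
  show ?thesis
  proof (rule that[of "M1 \<union> M2"])
    show "negligible (M1 \<union> M2)" using M1(1) M2(1) by (rule negligible_Un)
    fix s e assume s: "s \<in> {0<..<T} - (M1 \<union> M2)" and e: "0 < (e::real)"
    obtain d1 where "0 < d1" "\<forall>r. 0 < r \<and> s - d1 < r \<and> r < s \<longrightarrow>
         l2_norm \<Omega> (\<lambda>x. w s x - w r x - (s - r) *\<^sub>R w' s x) \<le> e * (s - r)"
      using M1(2)[of s e] s e by auto
    moreover obtain d2 where "0 < d2" "\<forall>r. 0 < r \<and> s - d2 < r \<and> r < s \<longrightarrow>
         norm (y s - y r - (s - r) *\<^sub>R y' s) \<le> e * (s - r)"
      using M2(2)[of s e] s e by auto
    ultimately show "\<exists>d>0. \<forall>r. 0 < r \<and> s - d < r \<and> r < s \<longrightarrow>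
         norm (y s - y r - (s - r) *\<^sub>R y' s) \<le> e * (s - r) \<and>
         l2_norm \<Omega> (\<lambda>x. w s x - w r x - (s - r) *\<^sub>R w' s x) \<le> e * (s - r)"
      by (intro exI[of _ "min d1 d2"]) auto
  qed
qed

text \<open>Increments of \<open>\<Psi>\<close> are bounded by linear functionals, taken at the
  later time s, of the increments of y and w. Dividing by s - r and letting r approach s from the
  left yields the derivative bound \<open>H\<close>, while \<open>F\<close> and \<open>rate\<close>
  supply the domination for \<open>increment_upper_bound\<close>. The lemma serves twice: for the
  energy and for the distance to the initial state.\<close>

lemma linear_increment_bound:
  fixes \<Psi> F :: "real \<Rightarrow> real" and p :: "real \<Rightarrow> real^'m" and f :: "real \<Rightarrow> real^3 \<Rightarrow> real^3"
  assumes \<Psi>: "integrable (lebesgue_on {0..T}) \<Psi>"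
    and F: "\<And>\<epsilon>. \<epsilon> \<in> {0<..<T} \<Longrightarrow> F \<in> L2 {\<epsilon>..T}"
    and Fp: "\<And>s. s \<in> {0<..<T} \<Longrightarrow> norm (p s) + l2_norm \<Omega> (f s) \<le> F s"
    and f: "\<And>s. s \<in> {0<..<T} \<Longrightarrow> f s \<in> L2 \<Omega>"
    and H: "integrable (lebesgue_on {0..T}) H"
    and M: "negligible M"
    and inc: "\<And>s r. \<lbrakk>s \<in> {0<..<T} - M; r \<in> {0<..<T} - M; r < s\<rbrakk> \<Longrightarrow>
      \<Psi> s - \<Psi> r \<le> p s \<bullet> (y s - y r) + l2_inner \<Omega> (f s) (\<lambda>x. w s x - w r x)"
    and lim: "\<And>s. s \<in> {0<..<T} - M \<Longrightarrow> p s \<bullet> y' s + l2_inner \<Omega> (f s) (w' s) \<le> H s"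
  obtains M' where "negligible M'"
    "\<And>\<delta> \<tau>. \<lbrakk>\<delta> \<in> {0<..<T} - M'; \<tau> \<in> {0<..<T} - M'; \<delta> < \<tau>\<rbrakk> \<Longrightarrow> \<Psi> \<tau> - \<Psi> \<delta> \<le> integral {\<delta>..\<tau>} H"
proof -
  obtain L where L: "negligible L"
    "\<And>s e. \<lbrakk>s \<in> {0<..<T} - L; 0 < e\<rbrakk> \<Longrightarrow>
       \<exists>d>0. \<forall>r. 0 < r \<and> s - d < r \<and> r < s \<longrightarrow>
         norm (y s - y r - (s - r) *\<^sub>R y' s) \<le> e * (s - r) \<and>
         l2_norm \<Omega> (\<lambda>x. w s x - w r x - (s - r) *\<^sub>R w' s x) \<le> e * (s - r)"
    using common_left_derivative by blast
  \<comment> \<open>T is excluded because left derivatives are known on the open interval only,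
    whereas \<open>increment_upper_bound\<close> includes the right endpoint.\<close>
  define K where "K = M \<union> L \<union> {T}"
  have K: "negligible K" unfolding K_def using M L(1) by (intro negligible_Un) auto
  have "\<exists>M'. negligible M' \<and> (\<forall>\<delta>\<in>{\<epsilon><..T} - M'. \<forall>\<tau>\<in>{\<epsilon><..T} - M'. \<delta> < \<tau> \<longrightarrow> \<Psi> \<tau> - \<Psi> \<delta> \<le> integral {\<delta>..\<tau>} H)"
    if \<epsilon>: "\<epsilon> \<in> {0<..<T}" for \<epsilon>
  proof (rule increment_upper_bound[of \<epsilon> T \<Psi> F rate H K])
    have sub: "integrable (lebesgue_on {\<epsilon>..T}) h" if "integrable (lebesgue_on {0..T}) h" for h :: "real \<Rightarrow> real"
      by (rule integrable_lebesgue_on_subset[OF that]) (use \<epsilon> in auto)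
    show "integrable (lebesgue_on {\<epsilon>..T}) \<Psi>" "integrable (lebesgue_on {\<epsilon>..T}) H"
      by (intro sub \<Psi> H)+
    show "integrable (lebesgue_on {\<epsilon>..T}) (\<lambda>s. (F s)\<^sup>2)" using F[OF \<epsilon>] by (simp add: L2_def)
    show "rate \<in> borel_measurable (lebesgue_on {\<epsilon>..T})" "integrable (lebesgue_on {\<epsilon>..T}) (\<lambda>s. (rate s)\<^sup>2)"
      using rate_L2[OF \<epsilon>] by (auto simp: L2_def)
    show "\<Psi> s - \<Psi> r \<le> F s * integral {r..s} rate"
      if rs: "r \<in> {\<epsilon>..T} - K" "s \<in> {\<epsilon>..T} - K" "r < s" for r s
    proof -
      have m: "s \<in> {0<..<T} - M" "r \<in> {0<..<T} - M" and sT: "0 < r" "s < T" "s \<in> {0<..<T}"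
        using rs \<epsilon> by (auto simp: K_def less_le)
      note le = increments_le[OF sT(1) rs(3) sT(2)]
      have "\<Psi> s - \<Psi> r \<le> p s \<bullet> (y s - y r) + l2_inner \<Omega> (f s) (\<lambda>x. w s x - w r x)"
        by (rule inc[OF m rs(3)])
      also have "p s \<bullet> (y s - y r) \<le> norm (p s) * integral {r..s} rate"
        using norm_cauchy_schwarz[of "p s" "y s - y r"] mult_left_mono[OF le(1), of "norm (p s)"] by simp
      also have "l2_inner \<Omega> (f s) (\<lambda>x. w s x - w r x) \<le> l2_norm \<Omega> (f s) * integral {r..s} rate"
        using l2_Cauchy_Schwarz[OF f[OF sT(3)] L2_diff[OF w_L2[of s] w_L2[of r]]]
          mult_left_mono[OF le(2), of "l2_norm \<Omega> (f s)"] sT rs(3) by simp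
      also have "norm (p s) * integral {r..s} rate + l2_norm \<Omega> (f s) * integral {r..s} rate \<le> F s * integral {r..s} rate"
      proof -
        have "0 \<le> integral {r..s} rate" using le(1) norm_ge_zero order_trans by blast
        then show ?thesis using mult_right_mono[OF Fp[OF sT(3)], of "integral {r..s} rate"] by (simp add: distrib_right)
      qed
      finally show ?thesis by simp
    qed
    show "\<exists>d>0. \<forall>r\<in>{\<epsilon>..T} - K. s - d < r \<and> r < s \<longrightarrow> \<Psi> s - \<Psi> r \<le> (H s + e) * (s - r)"
      if s: "s \<in> {\<epsilon><..T} - K" and e: "0 < e" for s e
    proof -
      have sT: "s \<in> {0<..<T} - M" "s \<in> {0<..<T} - L" "s \<in> {0<..<T}"
        using s \<epsilon> by (auto simp: K_def less_le)
      \<comment> \<open>Chosen so that the errors of the two first-order expansions, weighted with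
        the norms of p s and f s, add up to at most e; the summand 1 keeps the denominator
        positive.\<close>
      define e' where "e' = e / (1 + norm (p s) + l2_norm \<Omega> (f s))"
      have pos: "0 < 1 + norm (p s) + l2_norm \<Omega> (f s)" by (simp add: add_pos_nonneg)
      then have e': "0 < e'" "(norm (p s) + l2_norm \<Omega> (f s)) * e' \<le> e"
        using e by (auto simp: e'_def field_simps)
      obtain d where d: "0 < d" "\<And>r. \<lbrakk>0 < r; s - d < r; r < s\<rbrakk> \<Longrightarrow>
         norm (y s - y r - (s - r) *\<^sub>R y' s) \<le> e' * (s - r) \<and>
         l2_norm \<Omega> (\<lambda>x. w s x - w r x - (s - r) *\<^sub>R w' s x) \<le> e' * (s - r)"
        using L(2)[OF sT(2) e'(1)] by blast
      have "\<Psi> s - \<Psi> r \<le> (H s + e) * (s - r)" if r: "r \<in> {\<epsilon>..T} - K" "s - d < r" "r < s" for r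
      proof -
        have rT: "r \<in> {0<..<T} - M" "0 < r" using r \<epsilon> by (auto simp: K_def less_le)
        have dy: "norm (y s - y r - (s - r) *\<^sub>R y' s) \<le> e' * (s - r)"
          and dw: "l2_norm \<Omega> (\<lambda>x. w s x - w r x - (s - r) *\<^sub>R w' s x) \<le> e' * (s - r)"
          using d(2)[OF rT(2) r(2,3)] by auto
        have wL: "(\<lambda>x. w s x - w r x) \<in> L2 \<Omega>" using w_L2[of s] w_L2[of r] sT rT r by auto
        have "p s \<bullet> (y s - y r) = (s - r) * (p s \<bullet> y' s) + p s \<bullet> (y s - y r - (s - r) *\<^sub>R y' s)"
          by (simp add: inner_diff_right)
        moreover have "p s \<bullet> (y s - y r - (s - r) *\<^sub>R y' s) \<le> norm (p s) * (e' * (s - r))"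
          using norm_cauchy_schwarz[of "p s" "y s - y r - (s - r) *\<^sub>R y' s"] mult_left_mono[OF dy, of "norm (p s)"] by simp
        moreover have "l2_inner \<Omega> (f s) (\<lambda>x. w s x - w r x) = (s - r) * l2_inner \<Omega> (f s) (w' s)
            + l2_inner \<Omega> (f s) (\<lambda>x. w s x - w r x - (s - r) *\<^sub>R w' s x)"
          using l2_inner_diff_right[OF wL L2_scaleR[OF w'_in_L2] f[OF sT(3)], of "s - r" s]
            l2_inner_scaleR_left[of \<Omega> "s - r" "w' s" "f s"]
          by (simp add: l2_inner_commute[of \<Omega> "f s" "\<lambda>x. (s - r) *\<^sub>R w' s x"] l2_inner_commute[of \<Omega> "f s" "w' s"])
        moreover have "l2_inner \<Omega> (f s) (\<lambda>x. w s x - w r x - (s - r) *\<^sub>R w' s x) \<le> l2_norm \<Omega> (f s) * (e' * (s - r))"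
          using l2_Cauchy_Schwarz[OF f[OF sT(3)] L2_diff[OF wL L2_scaleR[OF w'_in_L2]], of "s - r" s]
            mult_left_mono[OF dw, of "l2_norm \<Omega> (f s)"] by simp
        moreover have "(s - r) * (p s \<bullet> y' s) + (s - r) * l2_inner \<Omega> (f s) (w' s) \<le> (s - r) * H s"
          using mult_left_mono[OF lim[OF sT(1)], of "s - r"] r by (simp add: distrib_left)
        moreover have "norm (p s) * (e' * (s - r)) + l2_norm \<Omega> (f s) * (e' * (s - r)) \<le> e * (s - r)"
          using mult_right_mono[OF e'(2), of "s - r"] r by (simp add: algebra_simps)
        ultimately have "\<Psi> s - \<Psi> r \<le> (s - r) * H s + e * (s - r)"
          using inc[OF sT(1) rT(1) r(3)] by linarith
        then show ?thesis by (simp add: algebra_simps)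
      qed
      then show ?thesis using d(1) by blast
    qed
  qed (use K in blast)+
  then have "\<forall>\<epsilon>\<in>{0<..<T}. \<exists>M'. negligible M' \<and> (\<forall>\<delta>\<in>{\<epsilon><..T} - M'. \<forall>\<tau>\<in>{\<epsilon><..T} - M'. \<delta> < \<tau> \<longrightarrow> \<Psi> \<tau> - \<Psi> \<delta> \<le> integral {\<delta>..\<tau>} H)"
    by (rule ballI)
  from negligible_exhaustion[OF this] obtain M' where M': "negligible M'"
    "\<forall>t\<in>{0<..<T}. \<exists>\<epsilon> M. \<epsilon> \<in> {0<..<t} \<and> M \<subseteq> M' \<and>
      (\<forall>\<delta>\<in>{\<epsilon><..T} - M. \<forall>\<tau>\<in>{\<epsilon><..T} - M. \<delta> < \<tau> \<longrightarrow> \<Psi> \<tau> - \<Psi> \<delta> \<le> integral {\<delta>..\<tau>} H)"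
    by (elim exE conjE) (rule that)
  show ?thesis
  proof (rule that[OF M'(1)])
    fix \<delta> \<tau> assume dt: "\<delta> \<in> {0<..<T} - M'" "\<tau> \<in> {0<..<T} - M'" "\<delta> < \<tau>"
    then obtain \<epsilon> M where \<epsilon>: "\<epsilon> \<in> {0<..<\<delta>}" "M \<subseteq> M'"
      "\<forall>\<delta>\<in>{\<epsilon><..T} - M. \<forall>\<tau>\<in>{\<epsilon><..T} - M. \<delta> < \<tau> \<longrightarrow> \<Psi> \<tau> - \<Psi> \<delta> \<le> integral {\<delta>..\<tau>} H"
      using bspec[OF M'(2), of \<delta>] by auto
    have "\<delta> \<in> {\<epsilon><..T} - M" "\<tau> \<in> {\<epsilon><..T} - M" using dt \<epsilon>(1,2) by auto
    then show "\<Psi> \<tau> - \<Psi> \<delta> \<le> integral {\<delta>..\<tau>} H" using \<epsilon>(3) dt(3) by blast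
  qed
qed

lemma energy_increment:
  obtains M where "negligible M"
    "\<And>\<delta> \<tau>. \<lbrakk>\<delta> \<in> {0<..<T} - M; \<tau> \<in> {0<..<T} - M; \<delta> < \<tau>\<rbrakk> \<Longrightarrow> E \<tau> - E \<delta> \<le> integral {\<delta>..\<tau>} power_bound"
proof (rule linear_increment_bound[of E "\<lambda>s. norm (i s) + 1 / \<sigma> * l2_norm \<Omega> (w' s)" i "\<lambda>s x. (- 1 / \<sigma>) *\<^sub>R w' s x" power_bound N])
  show "(\<lambda>s. norm (i s) + 1 / \<sigma> * l2_norm \<Omega> (w' s)) \<in> L2 {\<epsilon>..T}" if "\<epsilon> \<in> {0<..<T}" for \<epsilon>
    using L2_add[OF norm_L2[OF i[OF that]] L2_scaleR[OF w'_norm_in_L2[OF that], of "1 / \<sigma>"]] by simp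
  show "norm (i s) + l2_norm \<Omega> (\<lambda>x. (- 1 / \<sigma>) *\<^sub>R w' s x) \<le> norm (i s) + 1 / \<sigma> * l2_norm \<Omega> (w' s)" for s
    using l2_norm_scaleR[of \<Omega> "- 1 / \<sigma>" "w' s"] \<sigma> by simp
  show "E s - E r \<le> i s \<bullet> (y s - y r) + l2_inner \<Omega> (\<lambda>x. (- 1 / \<sigma>) *\<^sub>R w' s x) (\<lambda>x. w s x - w r x)"
    if "s \<in> {0<..<T} - N" "r \<in> {0<..<T} - N" for s r
    using KI[OF that] l2_inner_scaleR_left[of \<Omega> "- 1 / \<sigma>" "w' s" "\<lambda>x. w s x - w r x"] by simp
  show "i s \<bullet> y' s + l2_inner \<Omega> (\<lambda>x. (- 1 / \<sigma>) *\<^sub>R w' s x) (w' s) \<le> power_bound s" if s: "s \<in> {0<..<T} - N" for s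
  proof -
    have "i s \<bullet> y' s = i s \<bullet> (v s - R *v i s)" using law[OF s] by (simp flip: law[OF s])
    also have "\<dots> \<le> power_bound s" unfolding power_bound_def by (rule spd_power_bound[OF R])
    finally have "i s \<bullet> y' s \<le> power_bound s" .
    moreover have "l2_inner \<Omega> (\<lambda>x. (- 1 / \<sigma>) *\<^sub>R w' s x) (w' s) = - ((l2_norm \<Omega> (w' s))\<^sup>2 / \<sigma>)"
      using l2_inner_scaleR_left[of \<Omega> "- 1 / \<sigma>" "w' s" "w' s"] by (simp add: l2_norm_power2)
    moreover have "0 \<le> (l2_norm \<Omega> (w' s))\<^sup>2 / \<sigma>" using \<sigma> by simp
    ultimately show ?thesis by linarith
  qed
qed (use E(1) power_bound_integrable N w'_in_L2 L2_scaleR that in blast)+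

section \<open>Control near the initial time\<close>

definition Rinv where "Rinv = matrix_inv R"
definition flux_change where "flux_change t = y t - y 0"
text \<open>The weights 1 / \<sigma> and R\<inverse> are dictated by \<open>KI0\<close>: since
  R\<inverse> y' = R\<inverse> v - i, half the derivative along the system is the pairing of w' with
  w - w 0 over \<sigma>, minus i \<bullet> (y - y 0), plus a voltage term.\<close>

definition init_dist where "init_dist t = 1 / \<sigma> * (l2_norm \<Omega> (\<lambda>x. w t x - w 0 x))\<^sup>2 + flux_change t \<bullet> (Rinv *v flux_change t)"
text \<open>The majorant of the derivative of \<open>init_dist\<close> once \<open>KI0\<close> has
  eliminated w', y' and i; what remains is integrable down to t = 0.\<close>

definition init_rate where "init_rate s = 2 * (E0 - E s + v s \<bullet> (Rinv *v flux_change s))"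

lemma Rinv: "spd Rinv" "Rinv *v (R *v x) = x"
  using spd_matrix_inv[OF R] by (auto simp: Rinv_def)

lemma flux_change_continuous: "continuous_on {0..T} flux_change"
  unfolding flux_change_def[abs_def] by (intro continuous_intros y)

lemma Rinv_flux_change_continuous: "continuous_on {0..T} (\<lambda>s. Rinv *v flux_change s)"
  by (rule bounded_linear.continuous_on[OF matrix_vector_mul_bounded_linear flux_change_continuous])

lemma w_norm_continuous: "continuous_on {0..T} (\<lambda>t. l2_norm \<Omega> (\<lambda>x. w t x - w 0 x))"
  unfolding continuous_on_def
proof
  fix t assume t: "t \<in> {0..T}"
  have "((\<lambda>s. l2_norm \<Omega> (\<lambda>x. w s x - w t x)) \<longlongrightarrow> 0) (at t within {0..T})"
    using w t by (auto simp: bochner_C_def)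
  then have "((\<lambda>s. l2_norm \<Omega> (\<lambda>x. w s x - w 0 x) - l2_norm \<Omega> (\<lambda>x. w t x - w 0 x)) \<longlongrightarrow> 0) (at t within {0..T})"
  proof (rule Lim_null_comparison[rotated])
    show "\<forall>\<^sub>F s in at t within {0..T}. norm (l2_norm \<Omega> (\<lambda>x. w s x - w 0 x) - l2_norm \<Omega> (\<lambda>x. w t x - w 0 x)) \<le> l2_norm \<Omega> (\<lambda>x. w s x - w t x)"
      unfolding eventually_at_filter
    proof (intro always_eventually allI impI)
      fix s assume s: "s \<in> {0..T}"
      have "0 \<in> {0..T}" using T by simp
      from l2_norm_diff_abs[OF L2_diff[OF w_L2[OF s] w_L2[OF this]] L2_diff[OF w_L2[OF t] w_L2[OF this]]]
      show "norm (l2_norm \<Omega> (\<lambda>x. w s x - w 0 x) - l2_norm \<Omega> (\<lambda>x. w t x - w 0 x)) \<le> l2_norm \<Omega> (\<lambda>x. w s x - w t x)"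
        by simp
    qed
  qed
  then show "((\<lambda>s. l2_norm \<Omega> (\<lambda>x. w s x - w 0 x)) \<longlongrightarrow> l2_norm \<Omega> (\<lambda>x. w t x - w 0 x)) (at t within {0..T})"
    by (simp add: LIM_zero_iff)
qed

lemma init_dist_continuous: "continuous_on {0..T} init_dist"
  unfolding init_dist_def[abs_def] by (intro continuous_intros w_norm_continuous flux_change_continuous Rinv_flux_change_continuous)

lemma voltage_flux_change_integrable: "integrable (lebesgue_on {0..T}) (\<lambda>s. v s \<bullet> (Rinv *v flux_change s))"
proof (rule L2_integrable_inner[OF v])
  have "integrable (lebesgue_on {0..T}) (\<lambda>s. (norm (Rinv *v flux_change s))\<^sup>2)"
    by (intro continuous_imp_integrable_real continuous_intros Rinv_flux_change_continuous)
  moreover have "(\<lambda>s. Rinv *v flux_change s) \<in> borel_measurable (lebesgue_on {0..T})"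
    using Rinv_flux_change_continuous by (rule continuous_imp_measurable_on_sets_lebesgue) simp
  ultimately show "(\<lambda>s. Rinv *v flux_change s) \<in> L2 {0..T}" by (simp add: L2_def)
qed

lemma init_rate_integrable: "integrable (lebesgue_on {0..T}) init_rate"
  unfolding init_rate_def[abs_def] using E(1) voltage_flux_change_integrable continuous_imp_integrable_real[of 0 T "\<lambda>_. E0"]
  by simp

lemma init_dist_increment:
  obtains M where "negligible M"
    "\<And>\<delta> \<tau>. \<lbrakk>\<delta> \<in> {0<..<T} - M; \<tau> \<in> {0<..<T} - M; \<delta> < \<tau>\<rbrakk> \<Longrightarrow> init_dist \<tau> - init_dist \<delta> \<le> integral {\<delta>..\<tau>} init_rate"
proof -
  define p where "p s = 2 *\<^sub>R (Rinv *v flux_change s)" for s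
  define f where "f s x = (2 / \<sigma>) *\<^sub>R (w s x - w 0 x)" for s x
  define F where "F s = norm (p s) + l2_norm \<Omega> (f s)" for s
  have w0: "w 0 \<in> L2 \<Omega>" using w_L2[of 0] T by simp
  have fL: "f s \<in> L2 \<Omega>" if "s \<in> {0<..<T}" for s
    unfolding f_def[abs_def] using w_L2[of s] w0 that by (intro L2_scaleR L2_diff) auto
  have Fc: "continuous_on {0..T} F"
    unfolding F_def[abs_def] p_def f_def[abs_def] l2_norm_scaleR
    by (intro continuous_intros Rinv_flux_change_continuous w_norm_continuous)
  show ?thesis
  proof (rule linear_increment_bound[of init_dist F p f init_rate N])
    show "integrable (lebesgue_on {0..T}) init_dist" using init_dist_continuous by (rule continuous_imp_integrable_real)
    show "F \<in> L2 {\<epsilon>..T}" if "\<epsilon> \<in> {0<..<T}" for \<epsilon>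
    proof -
      have c: "continuous_on {\<epsilon>..T} F" by (rule continuous_on_subset[OF Fc]) (use that in auto)
      then have "integrable (lebesgue_on {\<epsilon>..T}) (\<lambda>s. (norm (F s))\<^sup>2)"
        by (intro continuous_imp_integrable_real continuous_intros)
      moreover have "F \<in> borel_measurable (lebesgue_on {\<epsilon>..T})"
        using c by (rule continuous_imp_measurable_on_sets_lebesgue) simp
      ultimately show ?thesis by (simp add: L2_def)
    qed
    show "init_dist s - init_dist r \<le> p s \<bullet> (y s - y r) + l2_inner \<Omega> (f s) (\<lambda>x. w s x - w r x)"
      if "s \<in> {0<..<T} - N" "r \<in> {0<..<T} - N" for s r
    proof -
      have L: "w s \<in> L2 \<Omega>" "w r \<in> L2 \<Omega>" using w_L2[of s] w_L2[of r] that by auto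
      have "1 / \<sigma> * ((l2_norm \<Omega> (\<lambda>x. w s x - w 0 x))\<^sup>2 - (l2_norm \<Omega> (\<lambda>x. w r x - w 0 x))\<^sup>2)
        \<le> 1 / \<sigma> * (2 * l2_inner \<Omega> (\<lambda>x. w s x - w r x) (\<lambda>x. w s x - w 0 x))"
        using \<sigma> by (intro mult_left_mono l2_quadratic_increment L w0) auto
      also have "\<dots> = l2_inner \<Omega> (f s) (\<lambda>x. w s x - w r x)"
        unfolding f_def[abs_def] l2_inner_scaleR_left by (simp add: l2_inner_commute[of \<Omega> "\<lambda>x. w s x - w r x"])
      finally have a: "1 / \<sigma> * ((l2_norm \<Omega> (\<lambda>x. w s x - w 0 x))\<^sup>2 - (l2_norm \<Omega> (\<lambda>x. w r x - w 0 x))\<^sup>2)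
        \<le> l2_inner \<Omega> (f s) (\<lambda>x. w s x - w r x)" .
      have "flux_change s \<bullet> (Rinv *v flux_change s) - flux_change r \<bullet> (Rinv *v flux_change r) \<le> 2 * ((flux_change s - flux_change r) \<bullet> (Rinv *v flux_change s))"
        by (rule quadratic_increment[OF Rinv(1)])
      also have "\<dots> = p s \<bullet> (y s - y r)" by (simp add: p_def flux_change_def inner_commute)
      finally show ?thesis using a unfolding init_dist_def by (simp add: right_diff_distrib)
    qed
    show "p s \<bullet> y' s + l2_inner \<Omega> (f s) (w' s) \<le> init_rate s" if s: "s \<in> {0<..<T} - N" for s
    proof -
      have y's: "y' s = v s - R *v i s" using law[OF s] by (simp add: eq_diff_eq)
      have "p s \<bullet> y' s = 2 * (y' s \<bullet> (Rinv *v flux_change s))" by (simp add: p_def inner_commute)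
      also have "y' s \<bullet> (Rinv *v flux_change s) = v s \<bullet> (Rinv *v flux_change s) - (Rinv *v (R *v i s)) \<bullet> flux_change s"
        unfolding y's using spd_adjoint[OF Rinv(1), of "R *v i s" "flux_change s"] by (simp add: inner_diff_left)
      also have "(Rinv *v (R *v i s)) \<bullet> flux_change s = i s \<bullet> flux_change s" by (simp add: Rinv(2))
      finally have "p s \<bullet> y' s = 2 * (v s \<bullet> (Rinv *v flux_change s) - i s \<bullet> flux_change s)" .
      moreover have "l2_inner \<Omega> (f s) (w' s) = 2 * (1 / \<sigma> * l2_inner \<Omega> (w' s) (\<lambda>x. w s x - w 0 x))"
        unfolding f_def[abs_def] l2_inner_scaleR_left by (simp add: l2_inner_commute[of \<Omega> "\<lambda>x. w s x - w 0 x"])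
      ultimately show ?thesis using KI0[OF s] by (simp add: init_rate_def flux_change_def)
    qed
    show "norm (p s) + l2_norm \<Omega> (f s) \<le> F s" for s by (simp add: F_def)
  qed (use init_rate_integrable N fL that in blast)+
qed

text \<open>\<open>init_dist_increment\<close> concerns positive times off a null set. The
  difference \<Phi> of the two sides is continuous on [0,T], vanishes at 0 and does not increase
  along a dense set of times, so it is nonpositive.\<close>

lemma init_dist_le:
  assumes \<tau>: "0 < \<tau>" "\<tau> < T"
  shows "init_dist \<tau> \<le> integral {0..\<tau>} init_rate"
proof -
  obtain M where M: "negligible M"
    "\<And>\<delta> \<tau>. \<lbrakk>\<delta> \<in> {0<..<T} - M; \<tau> \<in> {0<..<T} - M; \<delta> < \<tau>\<rbrakk> \<Longrightarrow> init_dist \<tau> - init_dist \<delta> \<le> integral {\<delta>..\<tau>} init_rate"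
    using init_dist_increment by blast
  have Pi: "init_rate integrable_on {0..T}" by (rule integrable_on_lebesgue_on[OF init_rate_integrable]) simp
  define \<Phi> where "\<Phi> t = init_dist t - integral {0..t} init_rate" for t
  have \<Phi>c: "continuous_on {0..T} \<Phi>"
    unfolding \<Phi>_def[abs_def]
    by (intro continuous_intros init_dist_continuous indefinite_integral_continuous_1 Pi)
  have \<Phi>0: "\<Phi> 0 = 0" by (simp add: \<Phi>_def init_dist_def flux_change_def)
  have dec: "\<Phi> t \<le> \<Phi> \<delta>" if "\<delta> \<in> {0<..<T} - M" "t \<in> {0<..<T} - M" "\<delta> < t" for \<delta> t
  proof -
    have "init_rate integrable_on {0..t}" by (rule integrable_on_subinterval[OF Pi]) (use that in auto)
    then have "integral {0..\<delta>} init_rate + integral {\<delta>..t} init_rate = integral {0..t} init_rate"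
      using that by (intro Henstock_Kurzweil_Integration.integral_combine) auto
    then show ?thesis using M(2)[OF that] by (simp add: \<Phi>_def)
  qed
  have near: "\<exists>d>0. \<forall>x\<in>{0..T}. \<bar>x - t\<bar> < d \<longrightarrow> \<bar>\<Phi> x - \<Phi> t\<bar> < e" if "t \<in> {0..T}" "0 < e" for t e
    using \<Phi>c that unfolding continuous_on_iff dist_real_def by blast
  have "\<Phi> \<tau> \<le> 0"
  proof (rule ccontr)
    assume "\<not> \<Phi> \<tau> \<le> 0"
    then have pos: "0 < \<Phi> \<tau> / 2" by simp
    obtain d1 where d1: "0 < d1" "\<And>x. \<lbrakk>x \<in> {0..T}; \<bar>x - \<tau>\<bar> < d1\<rbrakk> \<Longrightarrow> \<bar>\<Phi> x - \<Phi> \<tau>\<bar> < \<Phi> \<tau> / 2"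
      using near[of \<tau>, OF _ pos] \<tau> by auto
    obtain t where t: "max (\<tau> - d1) (\<tau> / 2) < t" "t < \<tau>" "t \<notin> M"
      using negligible_avoid[OF M(1), of "max (\<tau> - d1) (\<tau> / 2)" \<tau>] d1(1) \<tau> by auto
    obtain d2 where d2: "0 < d2" "\<And>x. \<lbrakk>x \<in> {0..T}; \<bar>x - 0\<bar> < d2\<rbrakk> \<Longrightarrow> \<bar>\<Phi> x - \<Phi> 0\<bar> < \<Phi> \<tau> / 2"
      using near[of 0, OF _ pos] T by auto
    obtain \<delta> where \<delta>: "0 < \<delta>" "\<delta> < min d2 (\<tau> / 2)" "\<delta> \<notin> M"
      using negligible_avoid[OF M(1), of 0 "min d2 (\<tau> / 2)"] d2(1) \<tau> by auto
    have "\<Phi> t \<le> \<Phi> \<delta>" by (rule dec) (use t \<delta> \<tau> in auto)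
    moreover have "\<bar>\<Phi> t - \<Phi> \<tau>\<bar> < \<Phi> \<tau> / 2" by (rule d1(2)) (use t \<tau> in auto)
    moreover have "\<bar>\<Phi> \<delta> - \<Phi> 0\<bar> < \<Phi> \<tau> / 2" by (rule d2(2)) (use \<delta> \<tau> in auto)
    ultimately show False using \<Phi>0 by linarith
  qed
  then show ?thesis by (simp add: \<Phi>_def)
qed

text \<open>Since \<open>init_dist t\<close> is \<open>O(t)\<close>, the voltage term is negligible in the average of the energy
  over a short initial interval.\<close>

lemma initial_average:
  assumes \<eta>: "0 < \<eta>"
  obtains h0 where "0 < h0" "h0 \<le> T" "\<And>h. \<lbrakk>0 < h; h < h0\<rbrakk> \<Longrightarrow> integral {0..h} E \<le> h * (E0 + \<eta>)"
proof -
  obtain c where c: "0 < c" "\<And>x. c * (norm x)\<^sup>2 \<le> x \<bullet> (Rinv *v x)"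
    using spd_coercive[OF Rinv(1)] by blast
  obtain K where K: "0 < K" "\<And>x. norm (Rinv *v x) \<le> norm x * K"
    using bounded_linear.pos_bounded[OF matrix_vector_mul_bounded_linear[of Rinv]] by blast
  define q g where "q t = norm (flux_change t)" and "g t = norm (v t)" for t
  have qc: "continuous_on {0..T} q" unfolding q_def by (intro continuous_intros flux_change_continuous)
  have gL: "g \<in> L2 {0..T}" unfolding g_def by (rule norm_L2[OF v])
  have qL: "q \<in> L2 {0..T}"
  proof -
    have "integrable (lebesgue_on {0..T}) (\<lambda>s. (norm (q s))\<^sup>2)"
      by (intro continuous_imp_integrable_real continuous_intros qc)
    moreover have "q \<in> borel_measurable (lebesgue_on {0..T})"
      using qc by (rule continuous_imp_measurable_on_sets_lebesgue) simp
    ultimately show ?thesis by (simp add: L2_def)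
  qed
  have gq: "integrable (lebesgue_on {0..T}) (\<lambda>s. g s * q s)"
    using L2_integrable_inner[OF gL qL] by simp
  have on: "f integrable_on {0..t}" if "integrable (lebesgue_on {0..T}) f" "t \<le> T" for f :: "real \<Rightarrow> real" and t
    by (rule integrable_on_subinterval[OF integrable_on_lebesgue_on[OF that(1)]]) (use that(2) in auto)
  \<comment> \<open>The integrated distance inequality with the energy moved to the left. Dropping
    the energy there gives the hypothesis of \<open>square_root_growth\<close> for q; dropping
    \<open>init_dist\<close> gives the bound on the mean energy.\<close>
  have up: "init_dist t + 2 * integral {0..t} E \<le> 2 * t * E0 + 2 * K * integral {0..t} (\<lambda>s. g s * q s)"
    if t: "0 < t" "t < T" for t
  proof -
    have Ei: "E integrable_on {0..t}" by (rule on[OF E(1)]) (use t in auto)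
    have gqi: "(\<lambda>s. g s * q s) integrable_on {0..t}" by (rule on[OF gq]) (use t in auto)
    have "init_dist t \<le> integral {0..t} init_rate" by (rule init_dist_le[OF t])
    also have "\<dots> \<le> integral {0..t} (\<lambda>s. 2 * E0 - 2 * E s + 2 * K * (g s * q s))"
    proof (rule integral_le)
      show "init_rate integrable_on {0..t}" by (rule on[OF init_rate_integrable]) (use t in auto)
      show "(\<lambda>s. 2 * E0 - 2 * E s + 2 * K * (g s * q s)) integrable_on {0..t}"
        using Ei gqi by (intro integrable_add integrable_diff integrable_on_mult_right) auto
      fix s
      have "v s \<bullet> (Rinv *v flux_change s) \<le> norm (v s) * norm (Rinv *v flux_change s)" by (rule norm_cauchy_schwarz)
      also have "\<dots> \<le> norm (v s) * (norm (flux_change s) * K)" by (intro mult_left_mono K) auto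
      also have "\<dots> = K * (g s * q s)" by (simp add: g_def q_def)
      finally show "init_rate s \<le> 2 * E0 - 2 * E s + 2 * K * (g s * q s)" by (simp add: init_rate_def)
    qed
    also have "\<dots> = integral {0..t} (\<lambda>s. 2 * E0 - 2 * E s) + integral {0..t} (\<lambda>s. 2 * K * (g s * q s))"
      using Ei gqi by (intro Henstock_Kurzweil_Integration.integral_add integrable_diff integrable_on_mult_right) auto
    also have "integral {0..t} (\<lambda>s. 2 * E0 - 2 * E s) = integral {0..t} (\<lambda>s. 2 * E0) - integral {0..t} (\<lambda>s. 2 * E s)"
      using Ei by (intro Henstock_Kurzweil_Integration.integral_diff integrable_on_mult_right) auto
    finally show ?thesis using t by simp
  qed
  have Enn: "0 \<le> integral {0..t} E" if "t < T" for t
    using E(2) that by (intro integral_nonneg on[OF E(1)]) auto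
  have kc: "c * (q t)\<^sup>2 \<le> init_dist t" for t
    using c(2)[of "flux_change t"] \<sigma> by (simp add: init_dist_def q_def add.commute add_increasing2)
  \<comment> \<open>The factor 1 / K compensates the norm bound for \<open>Rinv\<close> in the
    voltage term.\<close>
  have "0 < \<eta> / K" using \<eta> K by simp
  then obtain h0 where h0: "0 < h0" "h0 \<le> T" "\<And>h. \<lbrakk>0 < h; h < h0\<rbrakk> \<Longrightarrow> integral {0..h} (\<lambda>s. g s * q s) \<le> \<eta> / K * h"
  proof (rule square_root_growth[OF T qc _ gL, of "2 * E0 / c" "2 * K / c" "\<eta> / K", rotated 6])
    show "(q t)\<^sup>2 \<le> 2 * E0 / c * t + 2 * K / c * integral {0..t} (\<lambda>s. g s * q s)" if t: "0 < t" "t < T" for t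
    proof -
      have "c * (q t)\<^sup>2 \<le> 2 * t * E0 + 2 * K * integral {0..t} (\<lambda>s. g s * q s)"
        using up[OF t] Enn[OF t(2)] kc[of t] by linarith
      then show ?thesis using c(1) by (simp add: field_simps)
    qed
    show "q 0 = 0" by (simp add: q_def flux_change_def)
  qed (use E0 c K in \<open>auto simp: q_def g_def\<close>)
  show ?thesis
  proof (rule that[OF h0(1,2)])
    fix h assume h: "0 < h" "h < h0"
    have "0 \<le> init_dist h" using kc[of h] c(1) by (smt (verit) mult_nonneg_nonneg zero_le_power2)
    then have "integral {0..h} E \<le> h * E0 + K * integral {0..h} (\<lambda>s. g s * q s)"
      using up[of h] h h0(2) by simp
    also have "\<dots> \<le> h * E0 + K * (\<eta> / K * h)"
      using h0(3)[OF h] K by (intro add_left_mono mult_left_mono) auto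
    also have "\<dots> = h * (E0 + \<eta>)" using K by (simp add: algebra_simps)
    finally show "integral {0..h} E \<le> h * (E0 + \<eta>)" .
  qed
qed

text \<open>Convergence of E \<delta> as \<delta> tends to 0 is not known. Instead the bound B \<le>
  E \<delta>, valid for almost every \<delta> in (0, h), is averaged over that interval and compared
  with \<open>initial_average\<close>.\<close>

lemma energy_decay:
  obtains M where "negligible M" "\<And>\<tau>. \<tau> \<in> {0<..<T} - M \<Longrightarrow> E \<tau> \<le> E0 + integral {0..\<tau>} (\<lambda>s. 1 / 4 * (norm (inv_sqrt R *v v s))\<^sup>2)"
proof -
  obtain M where M: "negligible M"
    "\<And>\<delta> \<tau>. \<lbrakk>\<delta> \<in> {0<..<T} - M; \<tau> \<in> {0<..<T} - M; \<delta> < \<tau>\<rbrakk> \<Longrightarrow> E \<tau> - E \<delta> \<le> integral {\<delta>..\<tau>} power_bound"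
    using energy_increment by blast
  have "E \<tau> \<le> E0 + integral {0..\<tau>} power_bound" if \<tau>: "\<tau> \<in> {0<..<T} - M" for \<tau>
  proof (rule field_le_epsilon)
    fix \<eta> :: real assume \<eta>: "0 < \<eta>"
    define B where "B = E \<tau> - integral {0..\<tau>} power_bound"
    obtain h0 where h0: "0 < h0" "h0 \<le> T" "\<And>h. \<lbrakk>0 < h; h < h0\<rbrakk> \<Longrightarrow> integral {0..h} E \<le> h * (E0 + \<eta>)"
      using initial_average[OF \<eta>] by blast
    define h where "h = min h0 \<tau> / 2"
    have h: "0 < h" "h < h0" "h < \<tau>" using h0 \<tau> by (auto simp: h_def min_def)
    have Gi: "power_bound integrable_on {0..\<tau>}"
      by (rule integrable_on_subinterval[OF integrable_on_lebesgue_on[OF power_bound_integrable]]) (use \<tau> in auto)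
    have B: "B \<le> E \<delta>" if \<delta>: "\<delta> \<in> {0..h} - (M \<union> {0})" for \<delta>
    proof -
      have "integral {\<delta>..\<tau>} power_bound \<le> integral {0..\<tau>} power_bound"
        using \<delta> h Gi power_bound_nonneg by (intro integral_subset_le integrable_on_subinterval[OF Gi]) auto
      then show ?thesis using M(2)[of \<delta> \<tau>] \<delta> \<tau> h by (auto simp: B_def)
    qed
    \<comment> \<open>The value B on the null set makes the comparison hold at every \<delta>
      without changing the integral.\<close>
    define E' where "E' \<delta> = (if \<delta> \<in> M \<union> {0} then B else E \<delta>)" for \<delta>
    have neg: "negligible (M \<union> {0})" using M(1) by (intro negligible_Un) auto
    have Ei: "E integrable_on {0..h}"
      by (rule integrable_on_subinterval[OF integrable_on_lebesgue_on[OF E(1)]]) (use \<tau> h in auto)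
    have "integral {0..h} (\<lambda>_. B) \<le> integral {0..h} E'"
    proof (rule integral_le)
      show "E' integrable_on {0..h}"
        by (rule integrable_spike[OF Ei neg]) (auto simp: E'_def)
      show "B \<le> E' \<delta>" if "\<delta> \<in> {0..h}" for \<delta> using B[of \<delta>] that by (auto simp: E'_def)
      show "(\<lambda>_. B) integrable_on {0..h}" by (rule integrable_const_ivl)
    qed
    also have "integral {0..h} E' = integral {0..h} E"
      by (rule integral_spike[OF neg]) (auto simp: E'_def)
    also have "\<dots> \<le> h * (E0 + \<eta>)" by (rule h0(3)[OF h(1,2)])
    finally have "h * B \<le> h * (E0 + \<eta>)" using h by simp
    then have "B \<le> E0 + \<eta>" using h(1) by simp
    then show "E \<tau> \<le> E0 + integral {0..\<tau>} power_bound + \<eta>" by (simp add: B_def)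
  qed
  then show ?thesis using that[OF M(1)] by (simp add: power_bound_def[abs_def])
qed

end

section \<open>The coupled system\<close>

text \<open>By completeness f and g are measurable together; when neither is, both integrals have
  the default value 0.\<close>

lemma integral_cong_AE_lebesgue:
  fixes f g :: "'a::euclidean_space \<Rightarrow> 'b::euclidean_space"
  assumes J: "J \<in> sets lebesgue" and eq: "AE t in lebesgue_on J. f t = g t"
  shows "integral\<^sup>L (lebesgue_on J) f = integral\<^sup>L (lebesgue_on J) g"
proof -
  have m: "f' \<in> borel_measurable (lebesgue_on J)"
    if g': "g' \<in> borel_measurable (lebesgue_on J)" "AE t in lebesgue_on J. g' t = f' t" for f' g' :: "'a \<Rightarrow> 'b"
    by (rule borel_measurable_AE_limit[OF g'(1) J]) (use g'(2) in \<open>eventually_elim, simp\<close>)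
  have eq': "AE t in lebesgue_on J. g t = f t" using eq by eventually_elim simp
  show ?thesis
  proof (cases "f \<in> borel_measurable (lebesgue_on J)")
    case True
    then show ?thesis using m[OF True eq] eq by (intro integral_cong_AE)
  next
    case False
    then have "g \<notin> borel_measurable (lebesgue_on J)" using m[OF _ eq'] by blast
    with False have "\<not> integrable (lebesgue_on J) f" "\<not> integrable (lebesgue_on J) g"
      using borel_measurable_integrable by blast+
    then show ?thesis by (simp add: not_integrable_integral_eq)
  qed
qed

lemma AE_exhaust_interval:
  assumes "\<And>\<epsilon>. \<epsilon> \<in> {0<..<T} \<Longrightarrow> AE t in lebesgue_on {\<epsilon>..T}. Pr t"
  obtains N :: "real set" where "negligible N" "\<And>t. t \<in> {0<..<T} - N \<Longrightarrow> Pr t"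
proof -
  have "\<forall>\<epsilon>\<in>{0<..<T}. \<exists>M. negligible M \<and> (\<forall>t\<in>{\<epsilon>..T} - M. Pr t)"
    by (intro ballI, rule AE_lebesgue_on_negligible[OF assms]) auto
  from negligible_exhaustion[OF this] obtain N where N: "negligible N"
    "\<forall>t\<in>{0<..<T}. \<exists>\<epsilon> M. \<epsilon> \<in> {0<..<t} \<and> M \<subseteq> N \<and> (\<forall>t\<in>{\<epsilon>..T} - M. Pr t)"
    by (elim exE conjE) (rule that)
  show ?thesis
  proof (rule that[OF N(1)])
    fix t assume t: "t \<in> {0<..<T} - N"
    then obtain \<epsilon> M where \<epsilon>: "\<epsilon> \<in> {0<..<t}" "M \<subseteq> N" "\<forall>t\<in>{\<epsilon>..T} - M. Pr t" using bspec[OF N(2), of t] by auto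
    then have "t \<in> {\<epsilon>..T} - M" using t by auto
    then show "Pr t" using \<epsilon>(3) by blast
  qed
qed

text \<open>The weak derivative lies in \<open>X\<close> for almost every time only.\<close>

lemma bochner_H1loc_deriv_everywhere:
  assumes w: "bochner_H1loc_deriv T \<Omega> (XS \<Omega> \<Omega>C) w w0'"
  obtains w' N where "negligible N" "\<And>t. t \<in> {0<..<T} - N \<Longrightarrow> w' t = w0' t"
    "\<And>t. w' t \<in> XS \<Omega> \<Omega>C" "bochner_H1loc_deriv T \<Omega> (XS \<Omega> \<Omega>C) w w'"
proof -
  define w' where "w' t = (if w0' t \<in> XS \<Omega> \<Omega>C then w0' t else (\<lambda>_. 0))" for t
  have X: "w' t \<in> XS \<Omega> \<Omega>C" for t by (simp add: w'_def)
  have bm: "bochner_measurable {\<epsilon>..T} (XS \<Omega> \<Omega>C) (l2_norm \<Omega>) w0'"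
    and sq: "integrable (lebesgue_on {\<epsilon>..T}) (\<lambda>t. (l2_norm \<Omega> (w0' t))\<^sup>2)" if "\<epsilon> \<in> {0<..<T}" for \<epsilon>
    using w that by (auto simp: bochner_H1loc_deriv_def bochner_L2_def)
  have inX: "AE t in lebesgue_on {\<epsilon>..T}. w0' t \<in> XS \<Omega> \<Omega>C" if "\<epsilon> \<in> {0<..<T}" for \<epsilon>
    using bm[OF that] by (simp add: bochner_measurable_def)
  have eq: "AE t in lebesgue_on {\<epsilon>..T}. w0' t = w' t" if "\<epsilon> \<in> {0<..<T}" for \<epsilon>
    using inX[OF that] by eventually_elim (simp add: w'_def)
  obtain N where N: "negligible N" "\<And>t. t \<in> {0<..<T} - N \<Longrightarrow> w0' t = w' t"
    using AE_exhaust_interval[OF eq] by blast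
  have "w' \<in> bochner_L2 {\<epsilon>..T} (XS \<Omega> \<Omega>C) (l2_norm \<Omega>)" if \<epsilon>: "\<epsilon> \<in> {0<..<T}" for \<epsilon>
  proof -
    have m: "bochner_measurable {\<epsilon>..T} (XS \<Omega> \<Omega>C) (l2_norm \<Omega>) w'"
      by (rule bochner_measurable_cong[OF bm[OF \<epsilon>] eq[OF \<epsilon>]])
    have "(\<lambda>t. l2_norm \<Omega> (w' t)) \<in> borel_measurable (lebesgue_on {\<epsilon>..T})"
    proof (rule bochner_measurable_compose[OF m])
      show "(\<lambda>n. l2_norm \<Omega> (s n)) \<longlonglongrightarrow> l2_norm \<Omega> g"
        if "\<And>n. s n \<in> XS \<Omega> \<Omega>C" "g \<in> XS \<Omega> \<Omega>C" "(\<lambda>n. l2_norm \<Omega> (\<lambda>x. s n x - g x)) \<longlonglongrightarrow> 0" for s g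
        by (rule l2_norm_tendsto) (use that in \<open>auto intro: XS_L2\<close>)
    qed simp
    moreover have "AE t in lebesgue_on {\<epsilon>..T}. (l2_norm \<Omega> (w0' t))\<^sup>2 = (l2_norm \<Omega> (w' t))\<^sup>2"
      using eq[OF \<epsilon>] by eventually_elim simp
    ultimately have "integrable (lebesgue_on {\<epsilon>..T}) (\<lambda>t. (l2_norm \<Omega> (w' t))\<^sup>2)"
      using sq[OF \<epsilon>] by (intro integrable_cong_AE_imp[OF sq[OF \<epsilon>]]) (auto elim: eventually_mono)
    then show ?thesis using m by (simp add: bochner_L2_def)
  qed
  moreover have "weak_deriv_on 0 T (\<lambda>t. l2_inner \<Omega> (w t) F) (\<lambda>t. l2_inner \<Omega> (w' t) F)" if F: "F \<in> XS \<Omega> \<Omega>C" for F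
  proof -
    have "(LINT t|lebesgue_on {0<..<T}. \<phi> t *\<^sub>R l2_inner \<Omega> (w0' t) F) = (LINT t|lebesgue_on {0<..<T}. \<phi> t *\<^sub>R l2_inner \<Omega> (w' t) F)" for \<phi> :: "real \<Rightarrow> real"
      by (intro integral_cong_AE_lebesgue AE_lebesgue_on_Diff_negligible[OF N(1)]) (auto simp: N(2))
    then show ?thesis using w F by (simp add: weak_deriv_on_def bochner_H1loc_deriv_def)
  qed
  ultimately have "bochner_H1loc_deriv T \<Omega> (XS \<Omega> \<Omega>C) w w'"
    using w by (simp add: bochner_H1loc_deriv_def)
  then show ?thesis using that[OF N(1), of w'] N(2) X by simp
qed

lemma l2_norm_indicator_le:
  fixes g :: "'a::euclidean_space \<Rightarrow> 'b::euclidean_space"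
  assumes g: "g \<in> L2 S" and B: "B \<in> sets lebesgue"
  shows "(\<lambda>x. indicat_real B x *\<^sub>R g x) \<in> L2 S" "l2_norm S (\<lambda>x. indicat_real B x *\<^sub>R g x) \<le> l2_norm S g"
proof -
  have "indicat_real B \<in> borel_measurable (lebesgue_on S)"
    using B by (intro measurable_restrict_space1 borel_measurable_indicator) simp
  then have m: "(\<lambda>x. indicat_real B x *\<^sub>R g x) \<in> borel_measurable (lebesgue_on S)"
    using L2_measurable[OF g] by (rule borel_measurable_scaleR)
  then show L: "(\<lambda>x. indicat_real B x *\<^sub>R g x) \<in> L2 S"
    by (rule L2_bound[OF _ g, of _ 1]) (auto simp: indicator_def)
  have "(LINT x|lebesgue_on S. (norm (indicat_real B x *\<^sub>R g x))\<^sup>2) \<le> (LINT x|lebesgue_on S. (norm (g x))\<^sup>2)"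
    by (rule integral_mono) (use L g in \<open>auto simp: L2_def indicator_def\<close>)
  then show "l2_norm S (\<lambda>x. indicat_real B x *\<^sub>R g x) \<le> l2_norm S g"
    unfolding l2_norm_def by (rule real_sqrt_le_mono)
qed

lemma mqs_energy_estimate_AE:
  fixes R :: "real^'m^'m" and chi :: "real^3 \<Rightarrow> real^'m^3"
  assumes \<Omega>: "open \<Omega>" and \<Omega>C: "\<Omega>C \<in> sets lebesgue" and \<sigma>: "0 < \<sigma>C"
    and rel: "reluctivity \<Omega> \<nu> m\<nu> L\<nu>" and R: "spd R"
    and chi: "\<And>j. (\<lambda>\<xi>. column j (chi \<xi>)) \<in> L2 \<Omega>"
    and v: "v \<in> L2 {0..T}" and A0: "A0 \<in> X0curl \<Omega> \<Omega>C" and T: "0 < T"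
    and sol: "mqs_solution_cpt \<Omega> \<Omega>C \<sigma>C \<nu> R chi A0 v T A i"
  shows "AE t in lebesgue_on {0..T}. A t \<in> X0curl \<Omega> \<Omega>C \<and>
    field_energy \<Omega> \<nu> (weak_curl \<Omega> (A t)) \<le> field_energy \<Omega> \<nu> (weak_curl \<Omega> A0)
      + 1 / 4 * (l2_norm {0..<t} (\<lambda>s. inv_sqrt R *v v s))\<^sup>2"
proof -
  obtain w w0' y y' where
    wA: "AE t in lebesgue_on {0..T}. AE \<xi> in lebesgue_on \<Omega>. w t \<xi> = conductivity \<sigma>C \<Omega>C \<xi> *\<^sub>R A t \<xi>" and
    wC: "w \<in> bochner_C {0..T} (XS \<Omega> \<Omega>C) (l2_norm \<Omega>)" and
    w0': "bochner_H1loc_deriv T \<Omega> (XS \<Omega> \<Omega>C) w w0'" and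
    w_init: "AE \<xi> in lebesgue_on \<Omega>. w 0 \<xi> = conductivity \<sigma>C \<Omega>C \<xi> *\<^sub>R A0 \<xi>" and
    yA: "AE t in lebesgue_on {0..T}. y t = flux \<Omega> chi (A t)" and
    yC: "continuous_on {0..T} y" and
    y': "H1loc_deriv T y y'" and
    y_init: "y 0 = flux \<Omega> chi A0" and
    AL: "A \<in> bochner_L2 {0..T} (X0curl \<Omega> \<Omega>C) (hcurl_norm \<Omega>)" and
    i: "\<forall>\<epsilon>\<in>{0<..<T}. i \<in> L2 {\<epsilon>..T}" and
    eq: "\<forall>F\<in>X0curl \<Omega> \<Omega>C. AE t in lebesgue_on {0..T}.
           l2_inner \<Omega> (w0' t) F
             + (LINT \<xi>|lebesgue_on \<Omega>.
                  \<nu> \<xi> (norm (weak_curl \<Omega> (A t) \<xi>)) *\<^sub>R weak_curl \<Omega> (A t) \<xi> \<bullet> weak_curl \<Omega> F \<xi>)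
           = (LINT \<xi>|lebesgue_on \<Omega>. (chi \<xi> *v i t) \<bullet> F \<xi>)" and
    law: "AE t in lebesgue_on {0..T}. y' t + R *v i t = v t"
    using sol unfolding mqs_solution_cpt_def by (elim exE conjE) (rule that)
  obtain w' Nw where Nw: "negligible Nw" "\<And>t. t \<in> {0<..<T} - Nw \<Longrightarrow> w' t = w0' t"
    and w'X: "\<And>t. w' t \<in> XS \<Omega> \<Omega>C" and w': "bochner_H1loc_deriv T \<Omega> (XS \<Omega> \<Omega>C) w w'"
    by (rule bochner_H1loc_deriv_everywhere[OF w0']) (rule that)
  have Abm: "bochner_measurable {0..T} (X0curl \<Omega> \<Omega>C) (hcurl_norm \<Omega>) A"
    and Asq: "integrable (lebesgue_on {0..T}) (\<lambda>t. (hcurl_norm \<Omega> (A t))\<^sup>2)"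
    using AL by (auto simp: bochner_L2_def)
  obtain D where D: "countable D" "D \<subseteq> X0curl \<Omega> \<Omega>C"
    "AE t in lebesgue_on {0..T}. \<exists>d. (\<forall>n. d n \<in> D) \<and> (\<lambda>n. hcurl_norm \<Omega> (\<lambda>x. d n x - A t x)) \<longlonglongrightarrow> 0"
    by (rule bochner_measurable_separable[OF Abm]) (rule that)
  have XL: "F \<in> L2 \<Omega>" if "F \<in> X0curl \<Omega> \<Omega>C" for F using Hcurl_L2[OF X0curl_Hcurl[OF that]] .
  have cL: "weak_curl \<Omega> F \<in> L2 \<Omega>" if "F \<in> X0curl \<Omega> \<Omega>C" for F using weak_curl_L2[OF X0curl_Hcurl[OF that]] .
  define h where "h t = magnetic_field \<nu> (weak_curl \<Omega> (A t))" for t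
  define Eq where "Eq t F \<longleftrightarrow> l2_inner \<Omega> (w0' t) F + l2_inner \<Omega> (h t) (weak_curl \<Omega> F) = i t \<bullet> flux \<Omega> chi F" for t F
  have "AE t in lebesgue_on {0..T}. Eq t F" if F: "F \<in> X0curl \<Omega> \<Omega>C" for F
    using eq[rule_format, OF F]
    by eventually_elim (simp add: Eq_def h_def magnetic_field_def l2_inner_def inner_flux[OF chi XL[OF F], unfolded l2_inner_def])
  \<comment> \<open>Every test field has its own exceptional set of times; for the countable family
    D together with \<open>A0\<close> these combine into one null set.\<close>
  then have EqD: "AE t in lebesgue_on {0..T}. \<forall>F\<in>insert A0 D. Eq t F"
    using D(1,2) A0 by (subst AE_ball_countable) auto
  have AX: "AE t in lebesgue_on {0..T}. A t \<in> X0curl \<Omega> \<Omega>C" using Abm by (simp add: bochner_measurable_def)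
  have "AE t in lebesgue_on {0..T}. (AE \<xi> in lebesgue_on \<Omega>. w t \<xi> = conductivity \<sigma>C \<Omega>C \<xi> *\<^sub>R A t \<xi>) \<and>
      y t = flux \<Omega> chi (A t) \<and> A t \<in> X0curl \<Omega> \<Omega>C \<and>
      (\<exists>d. (\<forall>n. d n \<in> D) \<and> (\<lambda>n. hcurl_norm \<Omega> (\<lambda>x. d n x - A t x)) \<longlonglongrightarrow> 0) \<and>
      (\<forall>F\<in>insert A0 D. Eq t F) \<and> y' t + R *v i t = v t"
    using wA yA AX D(3) EqD law by eventually_elim (intro conjI)
  then obtain N1 where N1: "negligible N1" "\<And>t. t \<in> {0..T} - N1 \<Longrightarrow> (AE \<xi> in lebesgue_on \<Omega>. w t \<xi> = conductivity \<sigma>C \<Omega>C \<xi> *\<^sub>R A t \<xi>) \<and>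
      y t = flux \<Omega> chi (A t) \<and> A t \<in> X0curl \<Omega> \<Omega>C \<and>
      (\<exists>d. (\<forall>n. d n \<in> D) \<and> (\<lambda>n. hcurl_norm \<Omega> (\<lambda>x. d n x - A t x)) \<longlonglongrightarrow> 0) \<and>
      (\<forall>F\<in>insert A0 D. Eq t F) \<and> y' t + R *v i t = v t"
    by (rule AE_lebesgue_on_negligible) auto
  obtain N2 where N2: "negligible N2"
    "\<And>s e. \<lbrakk>s \<in> {0<..<T} - N2; 0 < e\<rbrakk> \<Longrightarrow> \<exists>d>0. \<forall>r. 0 < r \<and> s - d < r \<and> r < s \<longrightarrow>
         l2_norm \<Omega> (\<lambda>x. w s x - w r x - (s - r) *\<^sub>R w' s x) \<le> e * (s - r)"
    by (rule w_left_derivative[OF wC w' w'X]) (rule that)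
  define N where "N = N1 \<union> N2 \<union> Nw"
  have N: "negligible N" unfolding N_def by (intro negligible_Un N1 N2 Nw)
  define good where "good = {0<..<T} - N"
  have g_w: "AE \<xi> in lebesgue_on \<Omega>. w t \<xi> = conductivity \<sigma>C \<Omega>C \<xi> *\<^sub>R A t \<xi>"
    and g_y: "y t = flux \<Omega> chi (A t)" and g_X: "A t \<in> X0curl \<Omega> \<Omega>C"
    and g_d: "\<exists>d. (\<forall>n. d n \<in> D) \<and> (\<lambda>n. hcurl_norm \<Omega> (\<lambda>x. d n x - A t x)) \<longlonglongrightarrow> 0"
    and g_Eq: "\<And>F. F \<in> insert A0 D \<Longrightarrow> Eq t F"
    and g_law: "y' t + R *v i t = v t" and g_w': "w' t = w0' t" and g_t: "t \<in> {0..T}" "0 < t"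
    if "t \<in> good" for t
    using N1(2)[of t] Nw(2)[of t] that by (auto simp: good_def N_def)
  have wL: "w t \<in> L2 \<Omega>" if "t \<in> {0..T}" for t using w_XS[OF wC w' w'X that] XS_L2 by blast
  have w'L: "w' t \<in> L2 \<Omega>" for t using w'X XS_L2 by blast
  have hL: "h t \<in> L2 \<Omega>" if "t \<in> good" for t
    unfolding h_def by (rule magnetic_field_L2[OF rel \<Omega> cL[OF g_X[OF that]]])
  \<comment> \<open>For fixed t both sides are continuous in the test field along sequences
    converging in \<open>hcurl_norm\<close>, so the equation at time t passes from D to the field A
    r at any good time r.\<close>
  have test: "l2_inner \<Omega> (w' t) (A r) + l2_inner \<Omega> (h t) (weak_curl \<Omega> (A r)) = i t \<bullet> y r"
    if t: "t \<in> good" and r: "r \<in> good" for t r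
  proof -
    obtain d where d: "\<And>n. d n \<in> D" "(\<lambda>n. hcurl_norm \<Omega> (\<lambda>x. d n x - A r x)) \<longlonglongrightarrow> 0"
      using g_d[OF r] by blast
    have dX: "d n \<in> X0curl \<Omega> \<Omega>C" for n using d(1) D(2) by blast
    note lim = hcurl_norm_tendsto[OF \<Omega> dX g_X[OF r] d(2)]
    have "(\<lambda>n. l2_inner \<Omega> (w' t) (d n) + l2_inner \<Omega> (h t) (weak_curl \<Omega> (d n)))
      \<longlonglongrightarrow> l2_inner \<Omega> (w' t) (A r) + l2_inner \<Omega> (h t) (weak_curl \<Omega> (A r))"
      by (intro tendsto_add l2_inner_tendsto lim XL cL dX g_X r w'L hL t)
    moreover have "(\<lambda>n. i t \<bullet> flux \<Omega> chi (d n)) \<longlonglongrightarrow> i t \<bullet> flux \<Omega> chi (A r)"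
      by (intro tendsto_inner tendsto_const flux_tendsto chi lim XL dX g_X r)
    moreover have "l2_inner \<Omega> (w' t) (d n) + l2_inner \<Omega> (h t) (weak_curl \<Omega> (d n)) = i t \<bullet> flux \<Omega> chi (d n)" for n
      using g_Eq[OF t, of "d n"] d(1) by (simp add: Eq_def g_w'[OF t])
    ultimately show ?thesis using g_y[OF r] LIMSEQ_unique by simp
  qed
  have test0: "l2_inner \<Omega> (w' t) A0 + l2_inner \<Omega> (h t) (weak_curl \<Omega> A0) = i t \<bullet> y 0" if t: "t \<in> good" for t
    using g_Eq[OF t, of A0] by (simp add: Eq_def g_w'[OF t] y_init)
  have CB: "- \<Omega>C \<in> sets lebesgue" using \<Omega>C by (simp add: Compl_in_sets_lebesgue)
  \<comment> \<open>At good times w vanishes off \<Omega>C up to a null set, hence so do the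
    difference quotients between good times, and w' s is approximated by them in norm.\<close>
  have supp: "AE \<xi> in lebesgue_on \<Omega>. indicat_real (- \<Omega>C) \<xi> *\<^sub>R w' s \<xi> = 0" if s: "s \<in> good" for s
  proof (rule l2_norm_zero_AE[OF l2_norm_indicator_le(1)[OF w'L CB]])
    have "l2_norm \<Omega> (\<lambda>\<xi>. indicat_real (- \<Omega>C) \<xi> *\<^sub>R w' s \<xi>) \<le> 0 + e" if e: "0 < e" for e
    proof -
      have "s \<in> {0<..<T} - N2" using s by (auto simp: good_def N_def)
      then obtain d where d: "0 < d" "\<forall>r. 0 < r \<and> s - d < r \<and> r < s \<longrightarrow>
         l2_norm \<Omega> (\<lambda>x. w s x - w r x - (s - r) *\<^sub>R w' s x) \<le> e * (s - r)"
        using N2(2)[OF _ e] by blast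
      obtain r where r: "max 0 (s - d) < r" "r < s" "r \<notin> N"
        using negligible_avoid[OF N, of "max 0 (s - d)" s] d(1) g_t[OF s] by auto
      have rg: "r \<in> good" using r g_t[OF s] s by (auto simp: good_def)
      let ?g = "\<lambda>x. w s x - w r x - (s - r) *\<^sub>R w' s x"
      have gL: "?g \<in> L2 \<Omega>" by (intro L2_diff L2_scaleR wL w'L g_t(1) s rg)
      have "AE \<xi> in lebesgue_on \<Omega>. (s - r) *\<^sub>R (indicat_real (- \<Omega>C) \<xi> *\<^sub>R w' s \<xi>) = (-1) *\<^sub>R (indicat_real (- \<Omega>C) \<xi> *\<^sub>R ?g \<xi>)"
        using g_w[OF s] g_w[OF rg] by eventually_elim (simp add: conductivity_def indicator_def)
      then have "l2_norm \<Omega> (\<lambda>\<xi>. (s - r) *\<^sub>R (indicat_real (- \<Omega>C) \<xi> *\<^sub>R w' s \<xi>)) = l2_norm \<Omega> (\<lambda>\<xi>. (-1) *\<^sub>R (indicat_real (- \<Omega>C) \<xi> *\<^sub>R ?g \<xi>))"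
        by (rule l2_norm_cong_AE) (intro L2_scaleR l2_norm_indicator_le(1) w'L gL CB)+
      then have "(s - r) * l2_norm \<Omega> (\<lambda>\<xi>. indicat_real (- \<Omega>C) \<xi> *\<^sub>R w' s \<xi>) = l2_norm \<Omega> (\<lambda>\<xi>. indicat_real (- \<Omega>C) \<xi> *\<^sub>R ?g \<xi>)"
        unfolding l2_norm_scaleR using r(2) by simp
      also have "\<dots> \<le> l2_norm \<Omega> ?g" by (rule l2_norm_indicator_le(2)[OF gL CB])
      also have "\<dots> \<le> e * (s - r)" using d(2) r by simp
      finally have "(s - r) * l2_norm \<Omega> (\<lambda>\<xi>. indicat_real (- \<Omega>C) \<xi> *\<^sub>R w' s \<xi>) \<le> (s - r) * e" by (simp add: mult.commute)
      then show ?thesis using r(2) by simp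
    qed
    then have "l2_norm \<Omega> (\<lambda>\<xi>. indicat_real (- \<Omega>C) \<xi> *\<^sub>R w' s \<xi>) \<le> 0" by (rule field_le_epsilon)
    then show "l2_norm \<Omega> (\<lambda>\<xi>. indicat_real (- \<Omega>C) \<xi> *\<^sub>R w' s \<xi>) = 0"
      using l2_norm_nonneg[of \<Omega> "\<lambda>\<xi>. indicat_real (- \<Omega>C) \<xi> *\<^sub>R w' s \<xi>"] by linarith
  qed
  \<comment> \<open>On \<Omega>C the conductivity is the constant \<sigma>C and can be divided out.
    Off \<Omega>C it vanishes, but by \<open>supp\<close> so does w' s, and both integrands are zero
    there.\<close>
  have pair: "l2_inner \<Omega> (w' s) F = 1 / \<sigma>C * l2_inner \<Omega> (w' s) W"
    if s: "s \<in> good" and F: "F \<in> L2 \<Omega>" and W: "W \<in> L2 \<Omega>"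
      and FW: "AE \<xi> in lebesgue_on \<Omega>. W \<xi> = conductivity \<sigma>C \<Omega>C \<xi> *\<^sub>R F \<xi>" for s F W
  proof -
    have "AE \<xi> in lebesgue_on \<Omega>. w' s \<xi> \<bullet> F \<xi> = w' s \<xi> \<bullet> ((1 / \<sigma>C) *\<^sub>R W \<xi>)"
      using supp[OF s] FW
    proof eventually_elim
      case (elim \<xi>)
      then show ?case using \<sigma> by (cases "\<xi> \<in> \<Omega>C") (auto simp: conductivity_def)
    qed
    then have "l2_inner \<Omega> (w' s) F = l2_inner \<Omega> (w' s) (\<lambda>\<xi>. (1 / \<sigma>C) *\<^sub>R W \<xi>)"
      unfolding l2_inner_def using \<Omega> by (intro integral_cong_AE_lebesgue) auto
    then show ?thesis by (simp add: l2_inner_def)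
  qed
  \<comment> \<open>The default 0 outside \<open>X0curl\<close> makes \<Phi> nonnegative for every
    field, so that \<Phi> (A t) meets the sign condition of \<open>energy_decay\<close> at every
    t.\<close>
  define \<Phi> where "\<Phi> F = (if F \<in> X0curl \<Omega> \<Omega>C then field_energy \<Omega> \<nu> (weak_curl \<Omega> F) else 0)" for F
  have \<Phi>nn: "0 \<le> \<Phi> F" for F unfolding \<Phi>_def using field_energy_nonneg[OF rel \<Omega> cL] by auto
  \<comment> \<open>Stated for a pair F, W with W = \<sigma> F almost everywhere and a flux value c,
    so that it covers both A r with w r and \<open>A0\<close> with the continuous representative w
    0.\<close>
  have KI: "\<Phi> (A s) - \<Phi> F \<le> i s \<bullet> (y s - c) - 1 / \<sigma>C * l2_inner \<Omega> (w' s) (\<lambda>x. w s x - W x)"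
    if s: "s \<in> good" and F: "F \<in> X0curl \<Omega> \<Omega>C" and W: "W \<in> L2 \<Omega>"
      and FW: "AE \<xi> in lebesgue_on \<Omega>. W \<xi> = conductivity \<sigma>C \<Omega>C \<xi> *\<^sub>R F \<xi>"
      and tst: "l2_inner \<Omega> (w' s) F + l2_inner \<Omega> (h s) (weak_curl \<Omega> F) = i s \<bullet> c" for s F W c
  proof -
    have "l2_inner \<Omega> (h s) (weak_curl \<Omega> F) - l2_inner \<Omega> (h s) (weak_curl \<Omega> (A s)) \<le> \<Phi> F - \<Phi> (A s)"
      using field_energy_subgradient[OF rel \<Omega> cL[OF g_X[OF s]] cL[OF F]] F g_X[OF s] by (simp add: h_def \<Phi>_def)
    moreover have "l2_inner \<Omega> (w' s) (A s) = 1 / \<sigma>C * l2_inner \<Omega> (w' s) (w s)"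
      by (rule pair[OF s XL[OF g_X[OF s]] wL[OF g_t(1)[OF s]] g_w[OF s]])
    moreover have "l2_inner \<Omega> (w' s) F = 1 / \<sigma>C * l2_inner \<Omega> (w' s) W"
      by (rule pair[OF s XL[OF F] W FW])
    moreover have "l2_inner \<Omega> (w' s) (\<lambda>x. w s x - W x) = l2_inner \<Omega> (w' s) (w s) - l2_inner \<Omega> (w' s) W"
      by (rule l2_inner_diff_right[OF wL[OF g_t(1)[OF s]] W w'L])
    ultimately show ?thesis using test[OF s s] tst by (simp add: inner_diff_right right_diff_distrib)
  qed
  have \<Phi>m: "(\<lambda>t. \<Phi> (A t)) \<in> borel_measurable (lebesgue_on {0..T})"
  proof (rule bochner_measurable_compose[OF Abm])
    fix s F assume s: "\<And>n. s n \<in> X0curl \<Omega> \<Omega>C" and F: "F \<in> X0curl \<Omega> \<Omega>C" and lim: "(\<lambda>n. hcurl_norm \<Omega> (\<lambda>x. s n x - F x)) \<longlonglongrightarrow> 0"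
    let ?n = "\<lambda>n. l2_norm \<Omega> (\<lambda>x. weak_curl \<Omega> (s n) x - weak_curl \<Omega> F x)"
    have l: "?n \<longlonglongrightarrow> 0" by (rule hcurl_norm_tendsto(2)[OF \<Omega> s F lim])
    have "(\<lambda>n. \<Phi> (s n) - \<Phi> F) \<longlonglongrightarrow> 0"
    proof (rule Lim_null_comparison)
      show "\<forall>\<^sub>F n in sequentially. norm (\<Phi> (s n) - \<Phi> F) \<le> L\<nu> * (l2_norm \<Omega> (weak_curl \<Omega> F) + l2_norm \<Omega> (weak_curl \<Omega> (s n))) * ?n n"
        using field_energy_diff_bound[OF rel \<Omega> cL[OF F] cL[OF s]] s F by (auto simp: \<Phi>_def)
      have "(\<lambda>n. l2_norm \<Omega> (weak_curl \<Omega> (s n))) \<longlonglongrightarrow> l2_norm \<Omega> (weak_curl \<Omega> F)"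
        by (rule l2_norm_tendsto[OF cL[OF s] cL[OF F] l])
      then have "(\<lambda>n. L\<nu> * (l2_norm \<Omega> (weak_curl \<Omega> F) + l2_norm \<Omega> (weak_curl \<Omega> (s n))) * ?n n)
         \<longlonglongrightarrow> L\<nu> * (l2_norm \<Omega> (weak_curl \<Omega> F) + l2_norm \<Omega> (weak_curl \<Omega> F)) * 0"
        by (intro tendsto_intros l)
      then show "(\<lambda>n. L\<nu> * (l2_norm \<Omega> (weak_curl \<Omega> F) + l2_norm \<Omega> (weak_curl \<Omega> (s n))) * ?n n) \<longlonglongrightarrow> 0" by simp
    qed
    then show "(\<lambda>n. \<Phi> (s n)) \<longlonglongrightarrow> \<Phi> F" by (simp add: LIM_zero_iff)
  qed simp
  have \<Phi>b: "norm (\<Phi> (A t)) \<le> norm (L\<nu> / 2 * (hcurl_norm \<Omega> (A t))\<^sup>2)" for t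
  proof (cases "A t \<in> X0curl \<Omega> \<Omega>C")
    case True
    have "\<Phi> (A t) \<le> L\<nu> / 2 * (l2_norm \<Omega> (weak_curl \<Omega> (A t)))\<^sup>2"
      using field_energy_bounds(2)[OF rel \<Omega> cL[OF True]] True by (simp add: \<Phi>_def)
    also have "\<dots> \<le> L\<nu> / 2 * (hcurl_norm \<Omega> (A t))\<^sup>2"
      using reluctivity_constants[OF rel] by (intro mult_left_mono power_mono hcurl_norm_bounds) auto
    finally show ?thesis using \<Phi>nn[of "A t"] by simp
  qed (simp add: \<Phi>_def)
  have \<Phi>i: "integrable (lebesgue_on {0..T}) (\<lambda>t. \<Phi> (A t))"
    by (rule Bochner_Integration.integrable_bound[OF integrable_mult_right[OF Asq] \<Phi>m AE_I2[OF \<Phi>b]])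
  have zero: "0 \<in> {0..T}" using T by simp
  obtain M where M: "negligible M" "\<And>\<tau>. \<tau> \<in> {0<..<T} - M \<Longrightarrow> \<Phi> (A \<tau>) \<le> \<Phi> A0 + integral {0..\<tau>} (\<lambda>s. 1 / 4 * (norm (inv_sqrt R *v v s))\<^sup>2)"
  proof (rule energy_decay[OF T wC w' w'X yC y' _ v R \<sigma> \<Phi>i \<Phi>nn \<Phi>nn[of A0] N])
    show "\<Phi> (A s) - \<Phi> (A r) \<le> i s \<bullet> (y s - y r) - 1 / \<sigma>C * l2_inner \<Omega> (w' s) (\<lambda>x. w s x - w r x)"
      if "s \<in> {0<..<T} - N" "r \<in> {0<..<T} - N" for s r
      using that unfolding good_def[symmetric] by (intro KI g_X wL g_t(1) g_w test)
    show "\<Phi> (A s) - \<Phi> A0 \<le> i s \<bullet> (y s - y 0) - 1 / \<sigma>C * l2_inner \<Omega> (w' s) (\<lambda>x. w s x - w 0 x)"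
      if "s \<in> {0<..<T} - N" for s
      using that unfolding good_def[symmetric] by (intro KI A0 wL zero w_init test0)
    show "i \<in> L2 {\<epsilon>..T}" if "\<epsilon> \<in> {0<..<T}" for \<epsilon> using i that by blast
    show "y' s + R *v i s = v s" if "s \<in> {0<..<T} - N" for s
      using that unfolding good_def[symmetric] by (rule g_law)
  qed (rule that)
  show ?thesis
  proof (rule AE_lebesgue_on_Diff_negligible)
    show "negligible (M \<union> N \<union> {0, T})" using M(1) N by (intro negligible_Un) auto
    fix t assume t: "t \<in> {0..T} - (M \<union> N \<union> {0, T})"
    then have tg: "t \<in> good" "t \<in> {0<..<T} - M" by (auto simp: good_def)
    have AtX: "A t \<in> X0curl \<Omega> \<Omega>C" by (rule g_X[OF tg(1)])
    have "integral {0..t} (\<lambda>s. 1 / 4 * (norm (inv_sqrt R *v v s))\<^sup>2) = 1 / 4 * (l2_norm {0..<t} (\<lambda>s. inv_sqrt R *v v s))\<^sup>2"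
    proof -
      let ?f = "\<lambda>s. (norm (inv_sqrt R *v v s))\<^sup>2"
      have "integrable (lebesgue_on {0..T}) ?f" using matrix_vector_L2[OF v, of "inv_sqrt R"] by (simp add: L2_def)
      then have fi: "integrable (lebesgue_on {0..<t}) ?f"
        by (rule integrable_lebesgue_on_subset) (use t in auto)
      then have "(l2_norm {0..<t} (\<lambda>s. inv_sqrt R *v v s))\<^sup>2 = (LINT s|lebesgue_on {0..<t}. ?f s)"
        by (simp add: l2_norm_def)
      also have "\<dots> = integral {0..<t} ?f"
        by (rule lebesgue_integral_eq_integral) (use fi in auto)
      also have "\<dots> = integral {0..t} ?f"
        by (rule integral_spike_set) (auto intro: negligible_subset[of "{t}"])
      finally show ?thesis by simp
    qed
    then show "A t \<in> X0curl \<Omega> \<Omega>C \<and> field_energy \<Omega> \<nu> (weak_curl \<Omega> (A t)) \<le> field_energy \<Omega> \<nu> (weak_curl \<Omega> A0)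
      + 1 / 4 * (l2_norm {0..<t} (\<lambda>s. inv_sqrt R *v v s))\<^sup>2"
      using M(2)[OF tg(2)] AtX A0 by (simp add: \<Phi>_def)
  qed simp
qed

section \<open>Bochner measurability on the half-open time interval\<close>

lemma simple_function_glue:
  assumes f: "simple_function (lebesgue_on A) f" and g: "simple_function (lebesgue_on J) g"
    and sets: "A \<in> sets lebesgue" "B \<in> sets lebesgue" "J \<in> sets lebesgue" and sub: "B \<subseteq> A" "A \<subseteq> J"
  shows "simple_function (lebesgue_on J) (\<lambda>t. if t \<in> B then f t else g t)"
proof -
  let ?h = "\<lambda>t. if t \<in> B then f t else g t"
  have F: "f -` {x} \<inter> A \<in> sets lebesgue" for x
  proof (cases "x \<in> f ` A")
    case True
    then have "f -` {x} \<inter> A \<in> sets (lebesgue_on A)" using f by (auto simp: simple_function_def)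
    then show ?thesis using sets(1) by (simp add: sets_restrict_space_iff)
  next
    case False
    then have "f -` {x} \<inter> A = {}" by auto
    then show ?thesis by simp
  qed
  have G: "g -` {x} \<inter> J \<in> sets lebesgue" for x
  proof (cases "x \<in> g ` J")
    case True
    then have "g -` {x} \<inter> J \<in> sets (lebesgue_on J)" using g by (auto simp: simple_function_def)
    then show ?thesis using sets(3) by (simp add: sets_restrict_space_iff)
  next
    case False
    then have "g -` {x} \<inter> J = {}" by auto
    then show ?thesis by simp
  qed
  have "?h -` {x} \<inter> J = ((f -` {x} \<inter> A) \<inter> B) \<union> ((g -` {x} \<inter> J) - B)" for x
    using subsetD[OF sub(1)] subsetD[OF sub(2)] by (auto split: if_splits)
  then have "?h -` {x} \<inter> J \<in> sets (lebesgue_on J)" for x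
    using F[of x] G[of x] sets by (auto simp: sets_restrict_space_iff)
  moreover have "finite (?h ` J)"
  proof (rule finite_subset)
    show "?h ` J \<subseteq> f ` A \<union> g ` J" using subsetD[OF sub(1)] by auto
    show "finite (f ` A \<union> g ` J)" using f g by (auto simp: simple_function_def)
  qed
  ultimately show ?thesis by (simp add: simple_function_def)
qed

lemma l2_norm_mono_set:
  fixes f :: "'a::euclidean_space \<Rightarrow> 'b::euclidean_space"
  assumes f: "f \<in> L2 B" and sub: "A \<subseteq> B" and sets: "A \<in> sets lebesgue" "B \<in> sets lebesgue"
  shows "l2_norm A f \<le> l2_norm B f"
proof -
  have B: "integrable (lebesgue_on B) (\<lambda>x. (norm (f x))\<^sup>2)" using f by (simp add: L2_def)
  have A: "integrable (lebesgue_on A) (\<lambda>x. (norm (f x))\<^sup>2)"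
    by (rule integrable_lebesgue_on_subset[OF B sets sub])
  have "(LINT x|lebesgue_on A. (norm (f x))\<^sup>2) = (LINT x|lebesgue. indicat_real A x *\<^sub>R (norm (f x))\<^sup>2)"
    using sets by (simp add: integral_restrict_space)
  also have "\<dots> \<le> (LINT x|lebesgue. indicat_real B x *\<^sub>R (norm (f x))\<^sup>2)"
  proof (rule integral_mono)
    show "integrable lebesgue (\<lambda>x. indicat_real A x *\<^sub>R (norm (f x))\<^sup>2)"
      "integrable lebesgue (\<lambda>x. indicat_real B x *\<^sub>R (norm (f x))\<^sup>2)"
      using A B sets by (simp_all add: integrable_restrict_space)
    show "indicat_real A x *\<^sub>R (norm (f x))\<^sup>2 \<le> indicat_real B x *\<^sub>R (norm (f x))\<^sup>2" for x
      using sub by (auto simp: indicator_def)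
  qed
  also have "\<dots> = (LINT x|lebesgue_on B. (norm (f x))\<^sup>2)"
    using sets by (simp add: integral_restrict_space)
  finally show ?thesis unfolding l2_norm_def by (rule real_sqrt_le_mono)
qed

lemma time_interval_lebesgue: "time_interval T \<in> sets lebesgue"
proof (cases T)
  case (real r)
  then have "time_interval T = {0..<r}" by (auto simp: time_interval_def)
  then show ?thesis by simp
next
  case PInf
  then have "time_interval T = {0..}" by (auto simp: time_interval_def)
  then show ?thesis by simp
next
  case MInf
  then have "time_interval T = {}" by (auto simp: time_interval_def)
  then show ?thesis by simp
qed

lemma time_interval_exhaustion:
  assumes "0 < T"
  obtains Ts :: "nat \<Rightarrow> real"
  where "\<And>n. 0 < Ts n" "\<And>n. ereal (Ts n) < T" "time_interval T \<subseteq> (\<Union>n. {0..Ts n})"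
proof (cases T)
  case (real r)
  then have r: "0 < r" using assms by simp
  show ?thesis
  proof (rule that[of "\<lambda>n. r - r / real (n + 2)"])
    have "r * 1 < r * real (n + 2)" for n using r by (intro mult_strict_left_mono) auto
    then show "0 < r - r / real (n + 2)" for n by (simp add: divide_less_eq add.commute)
    show "ereal (r - r / real (n + 2)) < T" for n using r real by simp
    show "time_interval T \<subseteq> (\<Union>n. {0..r - r / real (n + 2)})"
    proof
      fix t assume "t \<in> time_interval T"
      then have t: "0 \<le> t" "t < r" using real by (auto simp: time_interval_def)
      have "(\<lambda>n. r / real (n + 2)) \<longlonglongrightarrow> 0" by (rule LIMSEQ_ignore_initial_segment[OF lim_const_over_n])
      then have "\<forall>\<^sub>F n in sequentially. r / real (n + 2) < r - t" using t by (intro order_tendstoD) auto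
      then obtain n where "r / real (n + 2) < r - t" by (auto simp: eventually_sequentially)
      then show "t \<in> (\<Union>n. {0..r - r / real (n + 2)})" using t by (intro UN_I[of n]) auto
    qed
  qed
next
  case PInf
  show ?thesis
  proof (rule that[of "\<lambda>n. real (Suc n)"])
    show "time_interval T \<subseteq> (\<Union>n. {0..real (Suc n)})"
    proof
      fix t assume "t \<in> time_interval T"
      then have "0 \<le> t" by (simp add: time_interval_def)
      moreover obtain n where "t < real n" using reals_Archimedean2 by blast
      ultimately show "t \<in> (\<Union>n. {0..real (Suc n)})" by (intro UN_I[of n]) auto
    qed
  qed (use PInf in auto)
qed (use assms in auto)

text \<open>The disjoint pieces I n of J carry their own approximating sequences. F n k follows
  these on the pieces with index below n and equals z elsewhere, so the diagonal F k k is simple,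
  and at a point of I n it agrees with s n k as soon as k > n.\<close>

lemma bochner_measurable_exhaust:
  fixes f :: "real \<Rightarrow> 'a \<Rightarrow> 'b::real_normed_vector" and Ts :: "nat \<Rightarrow> real"
  assumes J: "J \<in> sets lebesgue" and JT: "J = (\<Union>n. {0..Ts n})"
    and f: "\<And>n. bochner_measurable {0..Ts n} V N f" and z: "z \<in> V"
  shows "bochner_measurable J V N f"
proof -
  have "\<exists>s. (\<forall>k. simple_function (lebesgue_on {0..Ts n}) (s k) \<and> s k ` {0..Ts n} \<subseteq> V) \<and>
      (AE t in lebesgue_on {0..Ts n}. (\<lambda>k. N (\<lambda>x. s k t x - f t x)) \<longlonglongrightarrow> 0)" for n
    using f[of n] by (simp add: bochner_measurable_def)
  then obtain s where s: "\<And>n. (\<forall>k. simple_function (lebesgue_on {0..Ts n}) (s n k) \<and> s n k ` {0..Ts n} \<subseteq> V) \<and>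
      (AE t in lebesgue_on {0..Ts n}. (\<lambda>k. N (\<lambda>x. s n k t x - f t x)) \<longlonglongrightarrow> 0)"
    using choice[of "\<lambda>n s. (\<forall>k. simple_function (lebesgue_on {0..Ts n}) (s k) \<and> s k ` {0..Ts n} \<subseteq> V) \<and>
      (AE t in lebesgue_on {0..Ts n}. (\<lambda>k. N (\<lambda>x. s k t x - f t x)) \<longlonglongrightarrow> 0)"] by blast
  define I where "I n = {0..Ts n} - (\<Union>m<n. {0..Ts m})" for n
  have I: "I n \<in> sets lebesgue" "I n \<subseteq> {0..Ts n}" "{0..Ts n} \<subseteq> J" for n
    by (auto simp: I_def JT)
  define F where "F = rec_nat (\<lambda>k t. z) (\<lambda>n h k t. if t \<in> I n then s n k t else h k t)"
  have F0: "F 0 = (\<lambda>k t. z)" and FS: "F (Suc n) = (\<lambda>k t. if t \<in> I n then s n k t else F n k t)" for n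
    unfolding F_def by simp_all
  have simple: "simple_function (lebesgue_on J) (F n k)" for n k
  proof (induction n)
    case 0
    show ?case by (simp add: F0)
  next
    case (Suc n)
    show ?case unfolding FS
      by (rule simple_function_glue[OF _ Suc _ I(1) J I(2,3)]) (use s in auto)
  qed
  have FV: "F n k t \<in> V" if "t \<in> J" for n k t
  proof (induction n)
    case 0
    show ?case by (simp add: F0 z)
  next
    case (Suc n)
    have "s n k t \<in> V" if "t \<in> I n" using s[of n] that I(2)[of n] by blast
    then show ?case using Suc by (simp add: FS)
  qed
  have Feq: "F j k t = s n k t" if t: "t \<in> I n" and j: "n < j" for n j k t
    using j
  proof (induction j)
    case (Suc j)
    show ?case
    proof (cases "n = j")
      case False
      then have "n < j" using Suc.prems by simp
      moreover have "t \<notin> I j" using t \<open>n < j\<close> by (auto simp: I_def)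
      ultimately show ?thesis using Suc.IH by (simp add: FS)
    qed (use t in \<open>simp add: FS\<close>)
  qed simp
  have "\<exists>M. negligible M \<and> (\<forall>t\<in>{0..Ts n} - M. f t \<in> V \<and> (\<lambda>k. N (\<lambda>x. s n k t x - f t x)) \<longlonglongrightarrow> 0)" for n
  proof -
    have "AE t in lebesgue_on {0..Ts n}. f t \<in> V" using f[of n] by (simp add: bochner_measurable_def)
    moreover have "AE t in lebesgue_on {0..Ts n}. (\<lambda>k. N (\<lambda>x. s n k t x - f t x)) \<longlonglongrightarrow> 0" using s[of n] by blast
    ultimately have "AE t in lebesgue_on {0..Ts n}. f t \<in> V \<and> (\<lambda>k. N (\<lambda>x. s n k t x - f t x)) \<longlonglongrightarrow> 0"
      by eventually_elim (rule conjI)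
    then show ?thesis by (rule AE_lebesgue_on_negligible) auto
  qed
  then obtain M where M: "\<And>n. negligible (M n) \<and> (\<forall>t\<in>{0..Ts n} - M n. f t \<in> V \<and> (\<lambda>k. N (\<lambda>x. s n k t x - f t x)) \<longlonglongrightarrow> 0)"
    using choice[of "\<lambda>n M. negligible M \<and> (\<forall>t\<in>{0..Ts n} - M. f t \<in> V \<and> (\<lambda>k. N (\<lambda>x. s n k t x - f t x)) \<longlonglongrightarrow> 0)"] by blast
  have neg: "negligible (\<Union>n. M n)" using M by (intro negligible_countable_Union) auto
  have pt: "f t \<in> V \<and> (\<lambda>k. N (\<lambda>x. F k k t x - f t x)) \<longlonglongrightarrow> 0" if t: "t \<in> J - (\<Union>n. M n)" for t
  proof -
    define n where "n = (LEAST n. t \<in> {0..Ts n})"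
    have ex: "\<exists>n. t \<in> {0..Ts n}" using t by (auto simp: JT)
    have tn: "t \<in> {0..Ts n}" unfolding n_def using ex by (rule LeastI_ex)
    have "t \<notin> {0..Ts m}" if "m < n" for m using that unfolding n_def by (rule not_less_Least)
    then have tI: "t \<in> I n" using tn by (auto simp: I_def)
    have lim: "f t \<in> V \<and> (\<lambda>k. N (\<lambda>x. s n k t x - f t x)) \<longlonglongrightarrow> 0" using M[of n] tn t by blast
    have "\<forall>\<^sub>F k in sequentially. N (\<lambda>x. s n k t x - f t x) = N (\<lambda>x. F k k t x - f t x)"
      using eventually_gt_at_top[of n] by eventually_elim (simp add: Feq[OF tI])
    then have "(\<lambda>k. N (\<lambda>x. F k k t x - f t x)) \<longlonglongrightarrow> 0"
      by (rule Lim_transform_eventually[OF conjunct2[OF lim]])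
    then show ?thesis by (rule conjI[OF conjunct1[OF lim]])
  qed
  have "AE t in lebesgue_on J. f t \<in> V" by (rule AE_lebesgue_on_Diff_negligible[OF neg J conjunct1[OF pt]])
  moreover have "AE t in lebesgue_on J. (\<lambda>k. N (\<lambda>x. F k k t x - f t x)) \<longlonglongrightarrow> 0"
    by (rule AE_lebesgue_on_Diff_negligible[OF neg J conjunct2[OF pt]])
  moreover have "\<forall>k. simple_function (lebesgue_on J) (F k k) \<and> F k k ` J \<subseteq> V"
    using simple FV by (intro allI conjI image_subsetI)
  ultimately show ?thesis
    unfolding bochner_measurable_def by (intro conjI exI[of _ "\<lambda>k. F k k"])
qed

text \<open>Simple functions stay simple under any map, so \<open>weak_curl\<close> can be applied
  to the approximants directly; convergence is inherited from the graph norm.\<close>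

lemma bochner_measurable_weak_curl:
  assumes \<Omega>: "open \<Omega>" and A: "bochner_measurable J (X0curl \<Omega> \<Omega>C) (hcurl_norm \<Omega>) A"
  shows "bochner_measurable J (L2 \<Omega>) (l2_norm \<Omega>) (\<lambda>t. weak_curl \<Omega> (A t))"
proof -
  obtain s where s: "\<And>n. simple_function (lebesgue_on J) (s n)" "\<And>n. s n ` J \<subseteq> X0curl \<Omega> \<Omega>C"
      "AE t in lebesgue_on J. (\<lambda>n. hcurl_norm \<Omega> (\<lambda>x. s n t x - A t x)) \<longlonglongrightarrow> 0"
    and AX: "AE t in lebesgue_on J. A t \<in> X0curl \<Omega> \<Omega>C"
    using A unfolding bochner_measurable_def by blast
  have sp: "AE t in lebesgue_on J. t \<in> J" using AE_space[of "lebesgue_on J"] by simp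
  have cL: "weak_curl \<Omega> F \<in> L2 \<Omega>" if "F \<in> X0curl \<Omega> \<Omega>C" for F using weak_curl_L2[OF X0curl_Hcurl[OF that]] .
  have "AE t in lebesgue_on J. weak_curl \<Omega> (A t) \<in> L2 \<Omega>"
    using AX by eventually_elim (rule cL)
  moreover have "AE t in lebesgue_on J. (\<lambda>n. l2_norm \<Omega> (\<lambda>x. weak_curl \<Omega> (s n t) x - weak_curl \<Omega> (A t) x)) \<longlonglongrightarrow> 0"
    using s(3) AX sp
  proof eventually_elim
    case (elim t)
    have "s n t \<in> X0curl \<Omega> \<Omega>C" for n using s(2)[of n] elim(3) by blast
    then show ?case by (rule hcurl_norm_tendsto(2)[OF \<Omega> _ elim(2,1)])
  qed
  moreover have "\<forall>n. simple_function (lebesgue_on J) (\<lambda>t. weak_curl \<Omega> (s n t)) \<and> (\<lambda>t. weak_curl \<Omega> (s n t)) ` J \<subseteq> L2 \<Omega>"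
  proof (intro allI conjI)
    show "simple_function (lebesgue_on J) (\<lambda>t. weak_curl \<Omega> (s n t))" for n
      using s(1) by (rule simple_function_compose1)
    show "(\<lambda>t. weak_curl \<Omega> (s n t)) ` J \<subseteq> L2 \<Omega>" for n using s(2)[of n] cL by blast
  qed
  ultimately show ?thesis
    unfolding bochner_measurable_def by (intro conjI exI[of _ "\<lambda>n t. weak_curl \<Omega> (s n t)"])
qed

text \<open>The estimates are claimed at every t, while a solution determines \<open>A\<close> only
  for almost every t. A single representative \<open>A'\<close> has to serve all claims, and the
  clauses on A' 0 tie it to the initial data.\<close>

theorem proposition2:
  fixes \<Omega> \<Omega>C :: "(real^3) set"
    and \<sigma>C m\<nu> L\<nu> :: real
    and \<nu> :: "real^3 \<Rightarrow> real \<Rightarrow> real"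
    and R :: "real^'m^'m"
    and chi :: "real^3 \<Rightarrow> real^'m^3"
    and A0 :: "real^3 \<Rightarrow> real^3"
    and v i :: "real \<Rightarrow> real^'m"
    and A :: "real \<Rightarrow> real^3 \<Rightarrow> real^3"
    and T :: ereal
  assumes geometry: "mqs_geometry \<Omega> \<Omega>C"
    and conductivity_pos: "0 < \<sigma>C"
    and reluctivity: "reluctivity \<Omega> \<nu> m\<nu> L\<nu>"
    and resistance: "spd R"
    and winding: "\<And>j. (\<lambda>\<xi>. column j (chi \<xi>)) \<in> XS \<Omega> \<Omega>C"
    and time: "0 \<le> T"
    and voltage: "v \<in> L2loc T"
    and initial: "A0 \<in> X0curl \<Omega> \<Omega>C"
    and solution: "mqs_solution \<Omega> \<Omega>C \<sigma>C \<nu> R chi A0 v T A i"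
  shows "\<exists>A'. (AE t in lebesgue_on (time_interval T). A' t = A t) \<and>
    (AE \<xi> in lebesgue_on \<Omega>. conductivity \<sigma>C \<Omega>C \<xi> *\<^sub>R A' 0 \<xi> = conductivity \<sigma>C \<Omega>C \<xi> *\<^sub>R A0 \<xi>) \<and>
    flux \<Omega> chi (A' 0) = flux \<Omega> chi A0 \<and>
    (\<forall>t\<in>time_interval T.
       energy \<Omega> \<Omega>C \<nu> (A' t)
         \<le> energy \<Omega> \<Omega>C \<nu> A0 + ereal (1 / 4 * (l2_norm {0..<t} (\<lambda>s. inv_sqrt R *v v s))\<^sup>2) \<and>
       l2_norm \<Omega> (weak_curl \<Omega> (A' t))
         \<le> sqrt (L\<nu> / m\<nu>) * l2_norm \<Omega> (weak_curl \<Omega> A0)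
           + 1 / sqrt (2 * m\<nu>) * l2_norm {0..<t} (\<lambda>s. inv_sqrt R *v v s)) \<and>
    (v \<in> L2 (time_interval T) \<longrightarrow>
       (\<lambda>t. weak_curl \<Omega> (A' t)) \<in> bochner_Linf (time_interval T) (L2 \<Omega>) (l2_norm \<Omega>) \<and>
       bochner_Linf_norm (time_interval T) (l2_norm \<Omega>) (\<lambda>t. weak_curl \<Omega> (A' t))
         \<le> sqrt (L\<nu> / m\<nu>) * l2_norm \<Omega> (weak_curl \<Omega> A0)
           + 1 / sqrt (2 * m\<nu>) * l2_norm (time_interval T) (\<lambda>s. inv_sqrt R *v v s))"
proof -
  have "lipschitz_regular \<Omega>" "lipschitz_regular \<Omega>C"
    using geometry unfolding mqs_geometry_def by blast+
  then have \<Omega>: "open \<Omega>" and \<Omega>C: "\<Omega>C \<in> sets lebesgue"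
    by (auto simp: lipschitz_regular_def)
  have chi: "(\<lambda>\<xi>. column j (chi \<xi>)) \<in> L2 \<Omega>" for j using winding XS_L2 by blast
  note const = reluctivity_constants[OF reluctivity]
  define J where "J = time_interval T"
  have J: "J \<in> sets lebesgue" by (simp add: J_def time_interval_lebesgue)
  define V where "V t = l2_norm {0..<t} (\<lambda>s. inv_sqrt R *v v s)" for t
  let ?e = "\<lambda>F. field_energy \<Omega> \<nu> (weak_curl \<Omega> F)"
  define ok where "ok t \<longleftrightarrow> A t \<in> X0curl \<Omega> \<Omega>C \<and> ?e (A t) \<le> ?e A0 + 1 / 4 * (V t)\<^sup>2" for t
  \<comment> \<open>\<open>A0\<close> satisfies the energy bound at every time since the voltage
    term is nonnegative. The time 0 always receives \<open>A0\<close>, because the initial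
    conditions must hold there.\<close>
  define A' where "A' t = (if t \<noteq> 0 \<and> ok t then A t else A0)" for t
  have cL: "weak_curl \<Omega> F \<in> L2 \<Omega>" if "F \<in> X0curl \<Omega> \<Omega>C" for F using weak_curl_L2[OF X0curl_Hcurl[OF that]] .
  have A'X: "A' t \<in> X0curl \<Omega> \<Omega>C" and A'e: "?e (A' t) \<le> ?e A0 + 1 / 4 * (V t)\<^sup>2" for t
    using initial by (auto simp: A'_def ok_def)
  have A'0: "A' 0 = A0" by (simp add: A'_def)
  have energy_eq: "energy \<Omega> \<Omega>C \<nu> F = ereal (?e F)" if "F \<in> X0curl \<Omega> \<Omega>C" for F
    using that by (simp add: energy_def field_energy_def)
  have energy_le: "energy \<Omega> \<Omega>C \<nu> (A' t) \<le> energy \<Omega> \<Omega>C \<nu> A0 + ereal (1 / 4 * (V t)\<^sup>2)" for t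
    using A'e[of t] by (simp add: energy_eq[OF A'X] energy_eq[OF initial])
  have curl_le: "l2_norm \<Omega> (weak_curl \<Omega> (A' t))
      \<le> sqrt (L\<nu> / m\<nu>) * l2_norm \<Omega> (weak_curl \<Omega> A0) + 1 / sqrt (2 * m\<nu>) * V t" for t
  proof (rule power2_le_imp_le)
    define a b where "a = l2_norm \<Omega> (weak_curl \<Omega> (A' t))" and "b = l2_norm \<Omega> (weak_curl \<Omega> A0)"
    have nn: "0 \<le> a" "0 \<le> b" "0 \<le> V t" by (simp_all add: a_def b_def V_def)
    have "m\<nu> / 2 * a\<^sup>2 \<le> ?e (A' t)"
      unfolding a_def by (rule field_energy_bounds(1)[OF reluctivity \<Omega> cL[OF A'X]])
    also have "\<dots> \<le> ?e A0 + 1 / 4 * (V t)\<^sup>2" by (rule A'e)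
    also have "?e A0 \<le> L\<nu> / 2 * b\<^sup>2"
      unfolding b_def by (rule field_energy_bounds(2)[OF reluctivity \<Omega> cL[OF initial]])
    \<comment> \<open>Dividing m\<nu> / 2 a^2 \<le> L\<nu> / 2 b^2 + V^2 / 4 by m\<nu> / 2 produces
      the constants L\<nu> / m\<nu> and 1 / (2 m\<nu>); the roots are then separated by x^2 + y^2
      \<le> (x + y)^2 for nonnegative x and y.\<close>
    finally have "a\<^sup>2 \<le> L\<nu> / m\<nu> * b\<^sup>2 + 1 / (2 * m\<nu>) * (V t)\<^sup>2" using const by (simp add: field_simps)
    also have "\<dots> = (sqrt (L\<nu> / m\<nu>) * b)\<^sup>2 + (1 / sqrt (2 * m\<nu>) * V t)\<^sup>2"
      using const by (simp add: power_mult_distrib power_divide)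
    also have "\<dots> \<le> (sqrt (L\<nu> / m\<nu>) * b + 1 / sqrt (2 * m\<nu>) * V t)\<^sup>2"
    proof -
      have "0 \<le> (sqrt (L\<nu> / m\<nu>) * b) * (1 / sqrt (2 * m\<nu>) * V t)"
        using nn const by (intro mult_nonneg_nonneg) auto
      then show ?thesis unfolding power2_sum by linarith
    qed
    finally show "(l2_norm \<Omega> (weak_curl \<Omega> (A' t)))\<^sup>2
        \<le> (sqrt (L\<nu> / m\<nu>) * l2_norm \<Omega> (weak_curl \<Omega> A0) + 1 / sqrt (2 * m\<nu>) * V t)\<^sup>2"
      by (simp add: a_def b_def)
  next
    show "0 \<le> sqrt (L\<nu> / m\<nu>) * l2_norm \<Omega> (weak_curl \<Omega> A0) + 1 / sqrt (2 * m\<nu>) * V t"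
      using const by (intro add_nonneg_nonneg mult_nonneg_nonneg) (auto simp: V_def)
  qed
  have eq_AE: "AE t in lebesgue_on J. A' t = A t"
    and meas: "bochner_measurable J (L2 \<Omega>) (l2_norm \<Omega>) (\<lambda>t. weak_curl \<Omega> (A' t))"
  proof -
    consider "T = 0" | "0 < T" using time by (auto simp: less_le)
    then have "(AE t in lebesgue_on J. A' t = A t) \<and> bochner_measurable J (L2 \<Omega>) (l2_norm \<Omega>) (\<lambda>t. weak_curl \<Omega> (A' t))"
    proof cases
      case 1
      \<comment> \<open>On the empty interval every almost-everywhere statement holds, but
        measurability still asks for a sequence of simple functions; the zero field serves.\<close>
      then have "J = {}" by (auto simp: J_def time_interval_def)
      then have AE: "AE t in lebesgue_on J. Pr t" for Pr using AE_I2[of "lebesgue_on J" Pr] by simp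
      have "simple_function (lebesgue_on J) (\<lambda>t. (\<lambda>_. 0) :: real^3 \<Rightarrow> real^3)" by simp
      then have "\<forall>n::nat. simple_function (lebesgue_on J) (\<lambda>t. (\<lambda>_. 0) :: real^3 \<Rightarrow> real^3) \<and> (\<lambda>t. (\<lambda>_. 0) :: real^3 \<Rightarrow> real^3) ` J \<subseteq> L2 \<Omega>"
        using \<open>J = {}\<close> by simp
      then show ?thesis unfolding bochner_measurable_def by (intro conjI AE exI[of _ "\<lambda>n t _. 0"])
    next
      case 2
      obtain Ts :: "nat \<Rightarrow> real" where Ts: "\<And>n. 0 < Ts n" "\<And>n. ereal (Ts n) < T" "time_interval T \<subseteq> (\<Union>n. {0..Ts n})"
        using time_interval_exhaustion[OF 2] by blast
      then have TsJ: "J \<subseteq> (\<Union>n. {0..Ts n})" by (simp add: J_def)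
      have TJ: "{0..Ts n} \<subseteq> J" for n
      proof
        fix t assume "t \<in> {0..Ts n}"
        then have t: "0 \<le> t" "ereal t \<le> ereal (Ts n)" by auto
        then show "t \<in> J" using le_less_trans[OF t(2) Ts(2)] by (simp add: J_def time_interval_def)
      qed
      have sol: "mqs_solution_cpt \<Omega> \<Omega>C \<sigma>C \<nu> R chi A0 v (Ts n) A i" for n
        using solution Ts(1,2) by (auto simp: mqs_solution_def)
      have vn: "v \<in> L2 {0..Ts n}" for n
        using voltage Ts(1)[of n] Ts(2)[of n] by (auto simp: L2loc_def time_interval_def)
      have ok: "AE t in lebesgue_on {0..Ts n}. ok t" for n
        using mqs_energy_estimate_AE[OF \<Omega> \<Omega>C conductivity_pos reluctivity resistance chi vn initial Ts(1) sol]
        by (simp add: ok_def V_def)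
      have zero: "AE t in lebesgue_on {0..Ts n}. t \<noteq> 0" for n
        by (rule AE_lebesgue_on_Diff_negligible[of "{0}"]) auto
      have eqn: "AE t in lebesgue_on {0..Ts n}. A t = A' t" for n
        using ok[of n] zero[of n] by eventually_elim (simp add: A'_def)
      have "\<exists>M. negligible M \<and> (\<forall>t\<in>{0..Ts n} - M. A t = A' t)" for n
        by (rule AE_lebesgue_on_negligible[OF eqn[of n]]) auto
      then obtain M where M: "\<And>n. negligible (M n) \<and> (\<forall>t\<in>{0..Ts n} - M n. A t = A' t)"
        using choice[of "\<lambda>n M. negligible M \<and> (\<forall>t\<in>{0..Ts n} - M. A t = A' t)"] by blast
      have "negligible (\<Union>n. M n)" using M by (intro negligible_countable_Union) auto
      then have "AE t in lebesgue_on J. A' t = A t"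
      proof (rule AE_lebesgue_on_Diff_negligible[OF _ J])
        fix t assume t: "t \<in> J - (\<Union>n. M n)"
        then obtain n where "t \<in> {0..Ts n}" using TsJ by blast
        then have "A t = A' t" using M[of n] t by blast
        then show "A' t = A t" by simp
      qed
      moreover have "bochner_measurable {0..Ts n} (L2 \<Omega>) (l2_norm \<Omega>) (\<lambda>t. weak_curl \<Omega> (A' t))" for n
      proof (rule bochner_measurable_weak_curl[OF \<Omega> bochner_measurable_cong[OF _ eqn[of n]]])
        show "bochner_measurable {0..Ts n} (X0curl \<Omega> \<Omega>C) (hcurl_norm \<Omega>) A"
          using sol[of n] unfolding mqs_solution_cpt_def bochner_L2_def by (elim exE conjE) simp
      qed
      moreover have "J = (\<Union>n. {0..Ts n})" using TsJ TJ by blast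
      ultimately show ?thesis by (intro conjI bochner_measurable_exhaust[OF J _ _ L2_zero])
    qed
    then show "AE t in lebesgue_on J. A' t = A t"
      "bochner_measurable J (L2 \<Omega>) (l2_norm \<Omega>) (\<lambda>t. weak_curl \<Omega> (A' t))" by blast+
  qed
  have Linf: "(\<lambda>t. weak_curl \<Omega> (A' t)) \<in> bochner_Linf J (L2 \<Omega>) (l2_norm \<Omega>) \<and>
       bochner_Linf_norm J (l2_norm \<Omega>) (\<lambda>t. weak_curl \<Omega> (A' t))
         \<le> sqrt (L\<nu> / m\<nu>) * l2_norm \<Omega> (weak_curl \<Omega> A0)
           + 1 / sqrt (2 * m\<nu>) * l2_norm J (\<lambda>s. inv_sqrt R *v v s)"
    if vJ: "v \<in> L2 J"
  proof -
    define B where "B = sqrt (L\<nu> / m\<nu>) * l2_norm \<Omega> (weak_curl \<Omega> A0)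
           + 1 / sqrt (2 * m\<nu>) * l2_norm J (\<lambda>s. inv_sqrt R *v v s)"
    have B0: "0 \<le> B" unfolding B_def using const by (intro add_nonneg_nonneg mult_nonneg_nonneg) auto
    have le: "l2_norm \<Omega> (weak_curl \<Omega> (A' t)) \<le> B" if t: "t \<in> J" for t
    proof -
      have "{0..<t} \<subseteq> J"
      proof
        fix s assume "s \<in> {0..<t}"
        then have s: "0 \<le> s" "ereal s \<le> ereal t" by auto
        moreover have "ereal t < T" using t by (simp add: J_def time_interval_def)
        ultimately show "s \<in> J" using le_less_trans[OF s(2)] by (simp add: J_def time_interval_def)
      qed
      then have "V t \<le> l2_norm J (\<lambda>s. inv_sqrt R *v v s)"
        unfolding V_def by (rule l2_norm_mono_set[OF matrix_vector_L2[OF vJ]]) (use J in auto)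
      then have "1 / sqrt (2 * m\<nu>) * V t \<le> 1 / sqrt (2 * m\<nu>) * l2_norm J (\<lambda>s. inv_sqrt R *v v s)"
        using const by (intro mult_left_mono) auto
      then show ?thesis using curl_le[of t] unfolding B_def by linarith
    qed
    have AE: "AE t in lebesgue_on J. l2_norm \<Omega> (weak_curl \<Omega> (A' t)) \<le> B"
      by (rule AE_I2) (use le in simp)
    \<comment> \<open>B belongs to the set whose infimum is the norm, and 0 bounds that set from
      below because its members are nonnegative.\<close>
    have "bochner_Linf_norm J (l2_norm \<Omega>) (\<lambda>t. weak_curl \<Omega> (A' t)) \<le> B"
      unfolding bochner_Linf_norm_def using AE B0 by (intro cInf_lower) (auto intro: bdd_belowI[of _ 0])
    then show ?thesis using meas AE unfolding bochner_Linf_def B_def by blast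
  qed
  show ?thesis
  proof (intro exI[of _ A'] conjI ballI impI)
    show "AE t in lebesgue_on (time_interval T). A' t = A t" by (rule eq_AE[unfolded J_def])
    show "AE \<xi> in lebesgue_on \<Omega>. conductivity \<sigma>C \<Omega>C \<xi> *\<^sub>R A' 0 \<xi> = conductivity \<sigma>C \<Omega>C \<xi> *\<^sub>R A0 \<xi>"
      by (simp add: A'0)
    show "flux \<Omega> chi (A' 0) = flux \<Omega> chi A0" by (simp add: A'0)
  next
    fix t
    show "energy \<Omega> \<Omega>C \<nu> (A' t)
         \<le> energy \<Omega> \<Omega>C \<nu> A0 + ereal (1 / 4 * (l2_norm {0..<t} (\<lambda>s. inv_sqrt R *v v s))\<^sup>2)"
      by (rule energy_le[unfolded V_def])
    show "l2_norm \<Omega> (weak_curl \<Omega> (A' t))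
         \<le> sqrt (L\<nu> / m\<nu>) * l2_norm \<Omega> (weak_curl \<Omega> A0)
           + 1 / sqrt (2 * m\<nu>) * l2_norm {0..<t} (\<lambda>s. inv_sqrt R *v v s)"
      by (rule curl_le[unfolded V_def])
  next
    assume vT: "v \<in> L2 (time_interval T)"
    note Linf' = Linf[unfolded J_def, OF vT]
    show "(\<lambda>t. weak_curl \<Omega> (A' t)) \<in> bochner_Linf (time_interval T) (L2 \<Omega>) (l2_norm \<Omega>)"
      by (rule conjunct1[OF Linf'])
    show "bochner_Linf_norm (time_interval T) (l2_norm \<Omega>) (\<lambda>t. weak_curl \<Omega> (A' t))
         \<le> sqrt (L\<nu> / m\<nu>) * l2_norm \<Omega> (weak_curl \<Omega> A0)
           + 1 / sqrt (2 * m\<nu>) * l2_norm (time_interval T) (\<lambda>s. inv_sqrt R *v v s)"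
      by (rule conjunct2[OF Linf'])
  qed
qed

end
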